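(* Let $\mathcal{A}$ be a $\operatorname{Hom}$-finite idempotent complete $\mathbb{F}_q$-linear additive category and $\mathcal{E}$ an $\operatorname{Ext}^1$-finite exact structure on $\mathcal{A}$. If $w:\operatorname{Iso}(\mathcal{A})\to\mathbb{N}$ is $\mathcal{E}^{\mathrm{add}}$-characteristic in $\mathcal{E}$, then the associated graded algebra of $\mathcal{H}(\mathcal{E})$ with respect to the filtration $\mathcal{F}^w_\bullet$, where $\mathcal{F}^w_n$ is spanned by the $[M]$ with $w(M)\le n$, is $\mathcal{H}(\mathcal{E}^{\mathrm{add}})$. This is a skew polynomial algebra, namely the monoid algebra of $(\operatorname{Iso}(\mathcal{A}),\oplus)$ twisted by the form $\frac{1}{|\operatorname{Hom}_{\mathcal{A}}(-,-)|}$; that is, its product is given by $[A]\cdot[B]=\frac{1}{|\operatorname{Hom}_{\mathcal{A}}(A,B)|}[A\oplus B]$ for all $A,B\in\operatorname{Iso}(\mathcal{A})$.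
   Context: All categories are essentially small; $\mathbb{N}$ contains $0$; $\operatorname{Iso}(\mathcal{A})$ is the set of isomorphism classes of objects of $\mathcal{A}$. An exact structure on $\mathcal{A}$ is a Quillen exact structure, i.e. a class of kernel-cokernel pairs, called conflations, closed under isomorphism and satisfying Quillen's axioms; $\mathcal{E}^{\mathrm{add}}$ is the split exact structure. $\mathcal{E}$ is $\operatorname{Ext}^1$-finite if all $\operatorname{Ext}^1_{\mathcal{E}}(A,B)$ are finite. Hall algebra: $\mathcal{H}(\mathcal{E})$ is the $\mathbb{Q}$-vector space with basis $\{[A]\mid A\in\operatorname{Iso}(\mathcal{A})\}$ and multiplication $[A]\diamond[C]=\sum_{B}\frac{|\operatorname{Ext}^1_{\mathcal{E}}(A,C)_B|}{|\operatorname{Hom}(A,C)|}[B]$, where $\operatorname{Ext}^1_{\mathcal{E}}(A,C)_B$ is the set of classes of conflations $C\rightarrowtail B'\twoheadrightarrow A$ in $\mathcal{E}$ with $B'\cong B$; it is associative with unit $[0]$. A function $w:\operatorname{Iso}(\mathcal{A})\to\mathbb{N}$ is $\mathcal{E}^{\mathrm{add}}$-characteristic in $\mathcal{E}$ if $w(M\oplus N)=w(M)+w(N)$ for all $M,N$, and $w(X)<w(M)+w(N)$ whenever there is a non-split conflation $N\rightarrowtail X\twoheadrightarrow M$ in $\mathcal{E}$. The associated graded algebra is identified with $\mathcal{H}(\mathcal{E}^{\mathrm{add}})$ by identifying the class of $[M]$ in degree $w(M)$ with the basis element $[M]$. *)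

theory Defs
  imports Complex_Main "HOL-Algebra.QuotRing" "HOL-Algebra.Module" "HOL-Library.Poly_Mapping"
    "HOL-Library.Multiset"
begin

section \<open>Linear and additive categories\<close>

text \<open>
  A small category given by a set of objects, the morphism spaces (of which only the
  \<open>module\<close> operations are used, not \<open>mult\<close> and \<open>one\<close>), composition
  \<open>g \<bullet> f\<close> (first \<open>f\<close>, then \<open>g\<close>) and identities. The morphism
  spaces of different pairs of objects need not be disjoint.
\<close>

record ('o, 'm, 'k) lincat =
  Ob :: "'o set"
  Hom :: "'o \<Rightarrow> 'o \<Rightarrow> ('k, 'm) module"
  Comp :: "'m \<Rightarrow> 'm \<Rightarrow> 'm"  (infixl \<open>\<bullet>\<index>\<close> 70)
  Ident :: "'o \<Rightarrow> 'm"

abbreviation mor :: "('o, 'm, 'k) lincat \<Rightarrow> 'o \<Rightarrow> 'o \<Rightarrow> 'm set" where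
  "mor C A B \<equiv> carrier (Hom C A B)"

locale linear_category = field K for K :: "'k ring" +
  fixes C :: "('o, 'm, 'k) lincat" (structure)
  assumes module_Hom: "\<lbrakk>A \<in> Ob C; B \<in> Ob C\<rbrakk> \<Longrightarrow> module K (Hom C A B)"
    and comp_closed: "\<lbrakk>X \<in> Ob C; Y \<in> Ob C; Z \<in> Ob C; f \<in> mor C X Y; g \<in> mor C Y Z\<rbrakk>
          \<Longrightarrow> g \<bullet> f \<in> mor C X Z"
    and comp_assoc: "\<lbrakk>W \<in> Ob C; X \<in> Ob C; Y \<in> Ob C; Z \<in> Ob C;
            f \<in> mor C W X; g \<in> mor C X Y; h \<in> mor C Y Z\<rbrakk>
          \<Longrightarrow> (h \<bullet> g) \<bullet> f = h \<bullet> (g \<bullet> f)"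
    and ident_closed: "X \<in> Ob C \<Longrightarrow> Ident C X \<in> mor C X X"
    and comp_ident: "\<lbrakk>X \<in> Ob C; Y \<in> Ob C; f \<in> mor C X Y\<rbrakk> \<Longrightarrow> f \<bullet> Ident C X = f"
    and ident_comp: "\<lbrakk>X \<in> Ob C; Y \<in> Ob C; f \<in> mor C X Y\<rbrakk> \<Longrightarrow> Ident C Y \<bullet> f = f"
    and comp_add_left: "\<lbrakk>X \<in> Ob C; Y \<in> Ob C; Z \<in> Ob C;
            f \<in> mor C X Y; g \<in> mor C Y Z; h \<in> mor C Y Z\<rbrakk>
          \<Longrightarrow> (g \<oplus>\<^bsub>Hom C Y Z\<^esub> h) \<bullet> f = (g \<bullet> f) \<oplus>\<^bsub>Hom C X Z\<^esub> (h \<bullet> f)"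
    and comp_add_right: "\<lbrakk>X \<in> Ob C; Y \<in> Ob C; Z \<in> Ob C;
            f \<in> mor C X Y; g \<in> mor C X Y; h \<in> mor C Y Z\<rbrakk>
          \<Longrightarrow> h \<bullet> (f \<oplus>\<^bsub>Hom C X Y\<^esub> g) = (h \<bullet> f) \<oplus>\<^bsub>Hom C X Z\<^esub> (h \<bullet> g)"
    and comp_smult_left: "\<lbrakk>X \<in> Ob C; Y \<in> Ob C; Z \<in> Ob C;
            a \<in> carrier K; f \<in> mor C X Y; g \<in> mor C Y Z\<rbrakk>
          \<Longrightarrow> (a \<odot>\<^bsub>Hom C Y Z\<^esub> g) \<bullet> f = a \<odot>\<^bsub>Hom C X Z\<^esub> (g \<bullet> f)"
    and comp_smult_right: "\<lbrakk>X \<in> Ob C; Y \<in> Ob C; Z \<in> Ob C;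
            a \<in> carrier K; f \<in> mor C X Y; g \<in> mor C Y Z\<rbrakk>
          \<Longrightarrow> g \<bullet> (a \<odot>\<^bsub>Hom C X Y\<^esub> f) = a \<odot>\<^bsub>Hom C X Z\<^esub> (g \<bullet> f)"

definition is_iso :: "('o, 'm, 'k) lincat \<Rightarrow> 'o \<Rightarrow> 'o \<Rightarrow> 'm \<Rightarrow> bool" where
  "is_iso C A B f \<longleftrightarrow> f \<in> mor C A B \<and>
     (\<exists>g \<in> mor C B A. g \<bullet>\<^bsub>C\<^esub> f = Ident C A \<and> f \<bullet>\<^bsub>C\<^esub> g = Ident C B)"

definition isomorphic :: "('o, 'm, 'k) lincat \<Rightarrow> 'o \<Rightarrow> 'o \<Rightarrow> bool" where
  "isomorphic C A B \<longleftrightarrow> A \<in> Ob C \<and> B \<in> Ob C \<and> (\<exists>f. is_iso C A B f)"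

definition zero_object :: "('o, 'm, 'k) lincat \<Rightarrow> 'o \<Rightarrow> bool" where
  "zero_object C Z \<longleftrightarrow> Z \<in> Ob C \<and>
     (\<forall>A \<in> Ob C. (\<exists>!f. f \<in> mor C Z A) \<and> (\<exists>!f. f \<in> mor C A Z))"

definition biproduct ::
    "('o, 'm, 'k) lincat \<Rightarrow> 'o \<Rightarrow> 'o \<Rightarrow> 'o \<Rightarrow> 'm \<Rightarrow> 'm \<Rightarrow> 'm \<Rightarrow> 'm \<Rightarrow> bool" where
  "biproduct C A B S i\<^sub>A i\<^sub>B p\<^sub>A p\<^sub>B \<longleftrightarrow>
     A \<in> Ob C \<and> B \<in> Ob C \<and> S \<in> Ob C \<and>
     i\<^sub>A \<in> mor C A S \<and> i\<^sub>B \<in> mor C B S \<and> p\<^sub>A \<in> mor C S A \<and> p\<^sub>B \<in> mor C S B \<and>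
     p\<^sub>A \<bullet>\<^bsub>C\<^esub> i\<^sub>A = Ident C A \<and> p\<^sub>B \<bullet>\<^bsub>C\<^esub> i\<^sub>B = Ident C B \<and>
     p\<^sub>B \<bullet>\<^bsub>C\<^esub> i\<^sub>A = \<zero>\<^bsub>Hom C A B\<^esub> \<and> p\<^sub>A \<bullet>\<^bsub>C\<^esub> i\<^sub>B = \<zero>\<^bsub>Hom C B A\<^esub> \<and>
     (i\<^sub>A \<bullet>\<^bsub>C\<^esub> p\<^sub>A) \<oplus>\<^bsub>Hom C S S\<^esub> (i\<^sub>B \<bullet>\<^bsub>C\<^esub> p\<^sub>B) = Ident C S"

definition is_direct_sum :: "('o, 'm, 'k) lincat \<Rightarrow> 'o \<Rightarrow> 'o \<Rightarrow> 'o \<Rightarrow> bool" where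
  "is_direct_sum C A B S \<longleftrightarrow> (\<exists>i\<^sub>A i\<^sub>B p\<^sub>A p\<^sub>B. biproduct C A B S i\<^sub>A i\<^sub>B p\<^sub>A p\<^sub>B)"

locale additive_category = linear_category +
  assumes ex_zero_object: "\<exists>Z. zero_object C Z"
    and ex_direct_sum: "\<lbrakk>A \<in> Ob C; B \<in> Ob C\<rbrakk> \<Longrightarrow> \<exists>S. is_direct_sum C A B S"

definition idempotent_complete :: "('o, 'm, 'k) lincat \<Rightarrow> bool" where
  "idempotent_complete C \<longleftrightarrow>
     (\<forall>A \<in> Ob C. \<forall>e \<in> mor C A A. e \<bullet>\<^bsub>C\<^esub> e = e \<longrightarrow>
        (\<exists>B \<in> Ob C. \<exists>r \<in> mor C A B. \<exists>s \<in> mor C B A.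
           s \<bullet>\<^bsub>C\<^esub> r = e \<and> r \<bullet>\<^bsub>C\<^esub> s = Ident C B))"

text \<open>Over a finite field, finiteness of the morphism sets is finite-dimensionality.\<close>

definition Hom_finite :: "('o, 'm, 'k) lincat \<Rightarrow> bool" where
  "Hom_finite C \<longleftrightarrow> (\<forall>A \<in> Ob C. \<forall>B \<in> Ob C. finite (mor C A B))"


section \<open>Isomorphism classes\<close>

definition iso_class :: "('o, 'm, 'k) lincat \<Rightarrow> 'o \<Rightarrow> 'o set" where
  "iso_class C A = {B. isomorphic C A B}"

definition Iso :: "('o, 'm, 'k) lincat \<Rightarrow> 'o set set" where
  "Iso C = iso_class C ` Ob C"

text \<open>
  The objects that are a direct sum of a member of \<open>X\<close> and a member of \<open>Y\<close>;
  for isomorphism classes \<open>X\<close>, \<open>Y\<close> this is again an isomorphism class.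
\<close>

definition iso_sum :: "('o, 'm, 'k) lincat \<Rightarrow> 'o set \<Rightarrow> 'o set \<Rightarrow> 'o set" where
  "iso_sum C X Y = {S. \<exists>A \<in> X. \<exists>B \<in> Y. is_direct_sum C A B S}"

definition Iso_monoid :: "('o, 'm, 'k) lincat \<Rightarrow> 'o set monoid" where
  "Iso_monoid C = \<lparr>carrier = Iso C, monoid.mult = iso_sum C, one = {Z. zero_object C Z}\<rparr>"

definition rep :: "'o set \<Rightarrow> 'o" where
  "rep X = (SOME A. A \<in> X)"

definition indecomposable :: "('o, 'm, 'k) lincat \<Rightarrow> 'o \<Rightarrow> bool" where
  "indecomposable C S \<longleftrightarrow> S \<in> Ob C \<and> \<not> zero_object C S \<and>
     (\<forall>A B. is_direct_sum C A B S \<longrightarrow> zero_object C A \<or> zero_object C B)"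


section \<open>Exact structures\<close>

definition is_kernel ::
    "('o, 'm, 'k) lincat \<Rightarrow> 'o \<Rightarrow> 'm \<Rightarrow> 'o \<Rightarrow> 'm \<Rightarrow> 'o \<Rightarrow> bool" where
  "is_kernel C X i Y p Z \<longleftrightarrow>
     i \<in> mor C X Y \<and> p \<bullet>\<^bsub>C\<^esub> i = \<zero>\<^bsub>Hom C X Z\<^esub> \<and>
     (\<forall>T \<in> Ob C. \<forall>f \<in> mor C T Y. p \<bullet>\<^bsub>C\<^esub> f = \<zero>\<^bsub>Hom C T Z\<^esub> \<longrightarrow>
        (\<exists>!g. g \<in> mor C T X \<and> i \<bullet>\<^bsub>C\<^esub> g = f))"

definition is_cokernel ::
    "('o, 'm, 'k) lincat \<Rightarrow> 'o \<Rightarrow> 'm \<Rightarrow> 'o \<Rightarrow> 'm \<Rightarrow> 'o \<Rightarrow> bool" where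
  "is_cokernel C X i Y p Z \<longleftrightarrow>
     p \<in> mor C Y Z \<and> p \<bullet>\<^bsub>C\<^esub> i = \<zero>\<^bsub>Hom C X Z\<^esub> \<and>
     (\<forall>T \<in> Ob C. \<forall>f \<in> mor C Y T. f \<bullet>\<^bsub>C\<^esub> i = \<zero>\<^bsub>Hom C X T\<^esub> \<longrightarrow>
        (\<exists>!g. g \<in> mor C Z T \<and> g \<bullet>\<^bsub>C\<^esub> p = f))"

text \<open>The pair \<open>X \<longrightarrow>i Y \<longrightarrow>p Z\<close>.\<close>

definition kernel_cokernel_pair ::
    "('o, 'm, 'k) lincat \<Rightarrow> 'o \<Rightarrow> 'm \<Rightarrow> 'o \<Rightarrow> 'm \<Rightarrow> 'o \<Rightarrow> bool" where
  "kernel_cokernel_pair C X i Y p Z \<longleftrightarrow>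
     X \<in> Ob C \<and> Y \<in> Ob C \<and> Z \<in> Ob C \<and> i \<in> mor C X Y \<and> p \<in> mor C Y Z \<and>
     is_kernel C X i Y p Z \<and> is_cokernel C X i Y p Z"

text \<open>
  \<open>E X i Y p Z\<close> says that \<open>X \<longrightarrow>i Y \<longrightarrow>p Z\<close> belongs to the class
  \<open>E\<close>.
\<close>

type_synonym ('o, 'm) pair_class = "'o \<Rightarrow> 'm \<Rightarrow> 'o \<Rightarrow> 'm \<Rightarrow> 'o \<Rightarrow> bool"

definition inflation :: "('o, 'm) pair_class \<Rightarrow> 'o \<Rightarrow> 'm \<Rightarrow> 'o \<Rightarrow> bool" where
  "inflation E X i Y \<longleftrightarrow> (\<exists>p Z. E X i Y p Z)"

definition deflation :: "('o, 'm) pair_class \<Rightarrow> 'o \<Rightarrow> 'm \<Rightarrow> 'o \<Rightarrow> bool" where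
  "deflation E Y p Z \<longleftrightarrow> (\<exists>X i. E X i Y p Z)"

text \<open>
  \<open>Y \<longleftarrow>i X \<longrightarrow>f X'\<close> with pushout
  \<open>Y \<longrightarrow>f' Y' \<longleftarrow>i' X'\<close>, and dually
  \<open>Y \<longrightarrow>p Z \<longleftarrow>f Z'\<close> with pullback
  \<open>Y \<longleftarrow>f' Y' \<longrightarrow>p' Z'\<close>.
\<close>

definition is_pushout ::
    "('o, 'm, 'k) lincat \<Rightarrow> 'o \<Rightarrow> 'm \<Rightarrow> 'o \<Rightarrow> 'm \<Rightarrow> 'o \<Rightarrow> 'm \<Rightarrow> 'm \<Rightarrow> 'o \<Rightarrow> bool" where
  "is_pushout C X i Y f X' f' i' Y' \<longleftrightarrow>
     Y' \<in> Ob C \<and> f' \<in> mor C Y Y' \<and> i' \<in> mor C X' Y' \<and> f' \<bullet>\<^bsub>C\<^esub> i = i' \<bullet>\<^bsub>C\<^esub> f \<and>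
     (\<forall>T \<in> Ob C. \<forall>u \<in> mor C Y T. \<forall>v \<in> mor C X' T. u \<bullet>\<^bsub>C\<^esub> i = v \<bullet>\<^bsub>C\<^esub> f \<longrightarrow>
        (\<exists>!h. h \<in> mor C Y' T \<and> h \<bullet>\<^bsub>C\<^esub> f' = u \<and> h \<bullet>\<^bsub>C\<^esub> i' = v))"

definition is_pullback ::
    "('o, 'm, 'k) lincat \<Rightarrow> 'o \<Rightarrow> 'm \<Rightarrow> 'o \<Rightarrow> 'm \<Rightarrow> 'o \<Rightarrow> 'm \<Rightarrow> 'm \<Rightarrow> 'o \<Rightarrow> bool" where
  "is_pullback C Y p Z f Z' f' p' Y' \<longleftrightarrow>
     Y' \<in> Ob C \<and> f' \<in> mor C Y' Y \<and> p' \<in> mor C Y' Z' \<and> p \<bullet>\<^bsub>C\<^esub> f' = f \<bullet>\<^bsub>C\<^esub> p' \<and>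
     (\<forall>T \<in> Ob C. \<forall>u \<in> mor C T Y. \<forall>v \<in> mor C T Z'. p \<bullet>\<^bsub>C\<^esub> u = f \<bullet>\<^bsub>C\<^esub> v \<longrightarrow>
        (\<exists>!h. h \<in> mor C T Y' \<and> f' \<bullet>\<^bsub>C\<^esub> h = u \<and> p' \<bullet>\<^bsub>C\<^esub> h = v))"

locale exact_structure =
  fixes C :: "('o, 'm, 'k) lincat" (structure)
    and E :: "('o, 'm) pair_class"
  assumes conflation_pair: "E X i Y p Z \<Longrightarrow> kernel_cokernel_pair C X i Y p Z"
    and conflation_iso_closed:
      "\<lbrakk>E X i Y p Z; X' \<in> Ob C; Y' \<in> Ob C; Z' \<in> Ob C;
        i' \<in> mor C X' Y'; p' \<in> mor C Y' Z';
        is_iso C X X' a; is_iso C Y Y' b; is_iso C Z Z' c;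
        b \<bullet> i = i' \<bullet> a; c \<bullet> p = p' \<bullet> b\<rbrakk> \<Longrightarrow> E X' i' Y' p' Z'"
    and inflation_ident: "X \<in> Ob C \<Longrightarrow> inflation E X (Ident C X) X"
    and deflation_ident: "X \<in> Ob C \<Longrightarrow> deflation E X (Ident C X) X"
    and inflation_comp:
      "\<lbrakk>inflation E X i Y; inflation E Y j Z\<rbrakk> \<Longrightarrow> inflation E X (j \<bullet> i) Z"
    and deflation_comp:
      "\<lbrakk>deflation E X p Y; deflation E Y q Z\<rbrakk> \<Longrightarrow> deflation E X (q \<bullet> p) Z"
    and inflation_pushout:
      "\<lbrakk>inflation E X i Y; X' \<in> Ob C; f \<in> mor C X X'\<rbrakk>
        \<Longrightarrow> \<exists>f' i' Y'. is_pushout C X i Y f X' f' i' Y' \<and> inflation E X' i' Y'"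
    and deflation_pullback:
      "\<lbrakk>deflation E Y p Z; Z' \<in> Ob C; f \<in> mor C Z' Z\<rbrakk>
        \<Longrightarrow> \<exists>f' p' Y'. is_pullback C Y p Z f Z' f' p' Y' \<and> deflation E Y' p' Z'"

text \<open>The pairs isomorphic to \<open>X \<longrightarrow> X \<oplus> Z \<longrightarrow> Z\<close>.\<close>

definition split_structure :: "('o, 'm, 'k) lincat \<Rightarrow> ('o, 'm) pair_class" where
  "split_structure C X i Y p Z \<longleftrightarrow> (\<exists>s r. biproduct C X Z Y i s r p)"


section \<open>Extensions and Hall algebras\<close>

definition extensions ::
    "('o, 'm) pair_class \<Rightarrow> 'o \<Rightarrow> 'o \<Rightarrow> ('m \<times> 'o \<times> 'm) set" where
  "extensions E A B = {(i, Y, p). E B i Y p A}"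

definition ext_equiv ::
    "('o, 'm, 'k) lincat \<Rightarrow> ('o, 'm) pair_class \<Rightarrow> 'o \<Rightarrow> 'o \<Rightarrow>
      (('m \<times> 'o \<times> 'm) \<times> ('m \<times> 'o \<times> 'm)) set" where
  "ext_equiv C E A B =
     {((i, Y, p), (i', Y', p')) | i Y p i' Y' p'.
        (i, Y, p) \<in> extensions E A B \<and> (i', Y', p') \<in> extensions E A B \<and>
        (\<exists>h. is_iso C Y Y' h \<and> h \<bullet>\<^bsub>C\<^esub> i = i' \<and> p' \<bullet>\<^bsub>C\<^esub> h = p)}"

definition Ext1 ::
    "('o, 'm, 'k) lincat \<Rightarrow> ('o, 'm) pair_class \<Rightarrow> 'o \<Rightarrow> 'o \<Rightarrow> ('m \<times> 'o \<times> 'm) set set" where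
  "Ext1 C E A B = extensions E A B // ext_equiv C E A B"

definition Ext1_finite :: "('o, 'm, 'k) lincat \<Rightarrow> ('o, 'm) pair_class \<Rightarrow> bool" where
  "Ext1_finite C E \<longleftrightarrow> (\<forall>A \<in> Ob C. \<forall>B \<in> Ob C. finite (Ext1 C E A B))"

definition Ext1_with_middle ::
    "('o, 'm, 'k) lincat \<Rightarrow> ('o, 'm) pair_class \<Rightarrow> 'o \<Rightarrow> 'o \<Rightarrow> 'o set \<Rightarrow> ('m \<times> 'o \<times> 'm) set set" where
  "Ext1_with_middle C E A B M = {\<xi> \<in> Ext1 C E A B. \<forall>(i, Y, p) \<in> \<xi>. Y \<in> M}"

text \<open>
  The \<open>\<rat>\<close>-algebra with basis \<open>I\<close>, unit the basis element \<open>u\<close>, and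
  structure constants \<open>\<mu>\<close>. The basis element \<open>x\<close> is
  \<open>Poly_Mapping.single x 1\<close>; the polymorphic multiplication of
  \<open>Poly_Mapping\<close> is not used.
\<close>

definition basis_algebra ::
    "'b set \<Rightarrow> 'b \<Rightarrow> ('b \<Rightarrow> 'b \<Rightarrow> ('b \<Rightarrow>\<^sub>0 rat)) \<Rightarrow> (rat, 'b \<Rightarrow>\<^sub>0 rat) module" where
  "basis_algebra I u \<mu> =
     \<lparr>carrier = {f. Poly_Mapping.keys f \<subseteq> I},
      monoid.mult = (\<lambda>f g. \<Sum>x \<in> Poly_Mapping.keys f. \<Sum>y \<in> Poly_Mapping.keys g.
                Poly_Mapping.map ((*) (Poly_Mapping.lookup f x * Poly_Mapping.lookup g y)) (\<mu> x y)),
      one = Poly_Mapping.single u 1,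
      zero = 0,
      add = (+),
      smult = (\<lambda>c. Poly_Mapping.map ((*) c))\<rparr>"

text \<open>
  The sum runs over the middle terms that actually occur, which are finitely many
  if \<open>Ext1 C E A B\<close> is finite.
\<close>

definition hall_product ::
    "('o, 'm, 'k) lincat \<Rightarrow> ('o, 'm) pair_class \<Rightarrow> 'o \<Rightarrow> 'o \<Rightarrow> ('o set \<Rightarrow>\<^sub>0 rat)" where
  "hall_product C E A B =
     (\<Sum>M \<in> {M \<in> Iso C. Ext1_with_middle C E A B M \<noteq> {}}.
        Poly_Mapping.single M
          (of_nat (card (Ext1_with_middle C E A B M)) / of_nat (card (mor C A B))))"

definition hall_algebra ::
    "('o, 'm, 'k) lincat \<Rightarrow> ('o, 'm) pair_class \<Rightarrow> (rat, 'o set \<Rightarrow>\<^sub>0 rat) module" where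
  "hall_algebra C E =
     basis_algebra (Iso C) {Z. zero_object C Z} (\<lambda>X Y. hall_product C E (rep X) (rep Y))"


section \<open>Filtered and graded algebras\<close>

definition rat_ring :: "rat ring" where
  "rat_ring = \<lparr>carrier = UNIV, monoid.mult = (*), one = 1, zero = 0, add = (+)\<rparr>"

definition unital_algebra :: "'r ring \<Rightarrow> ('r, 'a) module \<Rightarrow> bool" where
  "unital_algebra R A \<longleftrightarrow> ring A \<and> module R A \<and>
     (\<forall>c \<in> carrier R. \<forall>x \<in> carrier A. \<forall>y \<in> carrier A.
        (c \<odot>\<^bsub>A\<^esub> x) \<otimes>\<^bsub>A\<^esub> y = c \<odot>\<^bsub>A\<^esub> (x \<otimes>\<^bsub>A\<^esub> y) \<and>
        x \<otimes>\<^bsub>A\<^esub> (c \<odot>\<^bsub>A\<^esub> y) = c \<odot>\<^bsub>A\<^esub> (x \<otimes>\<^bsub>A\<^esub> y))"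

definition algebra_iso ::
    "'r ring \<Rightarrow> ('r, 'a) module \<Rightarrow> ('r, 'b) module \<Rightarrow> ('a \<Rightarrow> 'b) set" where
  "algebra_iso R A B =
     {\<phi> \<in> ring_iso A B. \<forall>c \<in> carrier R. \<forall>x \<in> carrier A. \<phi> (c \<odot>\<^bsub>A\<^esub> x) = c \<odot>\<^bsub>B\<^esub> \<phi> x}"

definition algebra_filtration ::
    "'r ring \<Rightarrow> ('r, 'a) module \<Rightarrow> (nat \<Rightarrow> 'a set) \<Rightarrow> bool" where
  "algebra_filtration R A F \<longleftrightarrow>
     (\<forall>n. submodule (F n) R A) \<and> (\<forall>m n. m \<le> n \<longrightarrow> F m \<subseteq> F n) \<and>
     (\<Union>n. F n) = carrier A \<and> \<one>\<^bsub>A\<^esub> \<in> F 0 \<and>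
     (\<forall>m n. \<forall>x \<in> F m. \<forall>y \<in> F n. x \<otimes>\<^bsub>A\<^esub> y \<in> F (m + n))"

text \<open>\<open>F\<close> in degree \<open>n - 1\<close>, where \<open>F\<close> is zero in degree \<open>-1\<close>.\<close>

definition filtration_pred :: "('r, 'a) module \<Rightarrow> (nat \<Rightarrow> 'a set) \<Rightarrow> nat \<Rightarrow> 'a set" where
  "filtration_pred A F n = (if n = 0 then {\<zero>\<^bsub>A\<^esub>} else F (n - 1))"

definition graded_part :: "('r, 'a) module \<Rightarrow> (nat \<Rightarrow> 'a set) \<Rightarrow> nat \<Rightarrow> 'a set monoid" where
  "graded_part A F n = A\<lparr>carrier := F n\<rparr> A_Mod filtration_pred A F n"

text \<open>
  Elements are families of cosets, one from each \<open>graded_part A F n\<close>, almost all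
  of them zero. The product of cosets of degrees \<open>i\<close> and \<open>n - i\<close> is the
  coset of the product of representatives; \<open>finprod\<close> adds these products in the
  additive group \<open>graded_part A F n\<close>.
\<close>

definition associated_graded ::
    "('r, 'a) module \<Rightarrow> (nat \<Rightarrow> 'a set) \<Rightarrow> ('r, nat \<Rightarrow> 'a set) module" where
  "associated_graded A F =
     \<lparr>carrier = {x. (\<forall>n. x n \<in> carrier (graded_part A F n)) \<and>
                    finite {n. x n \<noteq> \<one>\<^bsub>graded_part A F n\<^esub>}},
      monoid.mult = (\<lambda>x y n. finprod (graded_part A F n)
                (\<lambda>i. rcoset_mult A (filtration_pred A F n) (x i) (y (n - i))) {..n}),
      one = (\<lambda>n. if n = 0 then filtration_pred A F 0 +>\<^bsub>A\<^esub> \<one>\<^bsub>A\<^esub> else \<one>\<^bsub>graded_part A F n\<^esub>),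
      zero = (\<lambda>n. \<one>\<^bsub>graded_part A F n\<^esub>),
      add = (\<lambda>x y n. x n \<otimes>\<^bsub>graded_part A F n\<^esub> y n),
      smult = (\<lambda>c x n. \<Union>a \<in> x n. filtration_pred A F n +>\<^bsub>A\<^esub> (c \<odot>\<^bsub>A\<^esub> a))\<rparr>"

definition graded_class ::
    "('r, 'a) module \<Rightarrow> (nat \<Rightarrow> 'a set) \<Rightarrow> nat \<Rightarrow> 'a \<Rightarrow> (nat \<Rightarrow> 'a set)" where
  "graded_class A F d a =
     (\<lambda>n. if n = d then filtration_pred A F n +>\<^bsub>A\<^esub> a else \<one>\<^bsub>graded_part A F n\<^esub>)"


section \<open>Characteristic functions and skew polynomial algebras\<close>

definition split_characteristic ::
    "('o, 'm, 'k) lincat \<Rightarrow> ('o, 'm) pair_class \<Rightarrow> ('o set \<Rightarrow> nat) \<Rightarrow> bool" where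
  "split_characteristic C E w \<longleftrightarrow>
     (\<forall>X \<in> Iso C. \<forall>Y \<in> Iso C. w (iso_sum C X Y) = w X + w Y) \<and>
     (\<forall>N i X p M. E N i X p M \<and> \<not> split_structure C N i X p M \<longrightarrow>
        w (iso_class C X) < w (iso_class C M) + w (iso_class C N))"

text \<open>The linear span of the basis elements \<open>M\<close> with \<open>w M \<le> n\<close>.\<close>

definition weight_filtration ::
    "('o, 'm, 'k) lincat \<Rightarrow> ('o set \<Rightarrow> nat) \<Rightarrow> nat \<Rightarrow> ('o set \<Rightarrow>\<^sub>0 rat) set" where
  "weight_filtration C w n = {f. Poly_Mapping.keys f \<subseteq> {M \<in> Iso C. w M \<le> n}}"

definition twisted_monoid_algebra ::
    "'b monoid \<Rightarrow> ('b \<Rightarrow> 'b \<Rightarrow> rat) \<Rightarrow> (rat, 'b \<Rightarrow>\<^sub>0 rat) module" where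
  "twisted_monoid_algebra G \<chi> =
     basis_algebra (carrier G) \<one>\<^bsub>G\<^esub> (\<lambda>x y. Poly_Mapping.single (x \<otimes>\<^bsub>G\<^esub> y) (\<chi> x y))"

definition bicharacter :: "'b monoid \<Rightarrow> ('b \<Rightarrow> 'b \<Rightarrow> rat) \<Rightarrow> bool" where
  "bicharacter G \<chi> \<longleftrightarrow>
     (\<forall>x \<in> carrier G. \<forall>y \<in> carrier G. \<chi> x y \<noteq> 0) \<and>
     (\<forall>x \<in> carrier G. \<forall>y \<in> carrier G. \<forall>z \<in> carrier G.
        \<chi> (x \<otimes>\<^bsub>G\<^esub> y) z = \<chi> x z * \<chi> y z \<and> \<chi> x (y \<otimes>\<^bsub>G\<^esub> z) = \<chi> x y * \<chi> x z)"

definition free_comm_monoid_on :: "'b monoid \<Rightarrow> 'b set \<Rightarrow> bool" where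
  "free_comm_monoid_on G S \<longleftrightarrow> comm_monoid G \<and> S \<subseteq> carrier G \<and>
     (\<forall>x \<in> carrier G. \<exists>!m. set_mset m \<subseteq> S \<and> x = (\<Otimes>\<^bsub>G\<^esub>s \<in> set_mset m. s [^]\<^bsub>G\<^esub> count m s))"

text \<open>
  A skew polynomial algebra in commuting-up-to-scalars variables \<open>S\<close> is a monoid
  algebra of the free commutative monoid on \<open>S\<close> (the monomials), twisted by a
  bimultiplicative form. In particular \<open>x \<otimes> y\<close> and \<open>y \<otimes> x\<close> differ by
  the factor \<open>\<chi> x y / \<chi> y x\<close>.
\<close>

definition skew_polynomial_algebra ::
    "'b monoid \<Rightarrow> 'b set \<Rightarrow> ('b \<Rightarrow> 'b \<Rightarrow> rat) \<Rightarrow> (rat, 'b \<Rightarrow>\<^sub>0 rat) module \<Rightarrow> bool" where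
  "skew_polynomial_algebra G S \<chi> A \<longleftrightarrow>
     free_comm_monoid_on G S \<and> bicharacter G \<chi> \<and> unital_algebra rat_ring A \<and>
     (\<lambda>f. f) \<in> algebra_iso rat_ring (twisted_monoid_algebra G \<chi>) A"

definition hom_form :: "('o, 'm, 'k) lincat \<Rightarrow> 'o set \<Rightarrow> 'o set \<Rightarrow> rat" where
  "hom_form C X Y = 1 / of_nat (card (mor C (rep X) (rep Y)))"

end

theory Submission
  imports Defs
begin

text \<open>
  Let \<open>B \<rightarrowtail> Y \<twoheadrightarrow> A\<close> be a conflation. If it splits, then \<open>Y\<close> is
  \<open>A \<oplus> B\<close> and \<open>w Y = w A + w B\<close>; if not, then \<open>w Y\<close> is smaller. So the
  product of \<open>[A]\<close> and \<open>[B]\<close> in the Hall algebra has terms of weight at most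
  \<open>w A + w B\<close>, and its part of maximal weight is a multiple of
  \<open>[A \<oplus> B]\<close>. The coefficient is \<open>1 / |Hom(A, B)|\<close>, because there is exactly one
  class of extensions with middle term \<open>A \<oplus> B\<close>: by the weight such an extension splits,
  all split extensions are equivalent (\<open>split_extensions_equiv\<close>), and every exact structure
  contains the split ones (\<open>split_structure_subset\<close>). This is
  \<open>coeff_hall_product_leading\<close>.

  Passing to the associated graded algebra keeps a weighted basis and discards from each product the
  terms of lower weight (\<open>associated_graded_iso\<close>). What remains are the structure
  constants \<open>[A] [B] = 1 / |Hom(A, B)| [A \<oplus> B]\<close>. The same computation, applied to the split
  structure, shows that they are the structure constants of its Hall algebra
  (\<open>hall_product_split\<close>).

  The form \<open>1 / |Hom(-, -)|\<close> is bimultiplicative since \<open>Hom\<close> turns direct sums in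
  either argument into products, so the twisted monoid algebra is associative and unital
  (\<open>twisted_monoid_algebra_unital\<close>). That it is a skew polynomial algebra is the
  Krull--Schmidt theorem: isomorphism classes form the free commutative monoid on the
  indecomposable ones (\<open>Iso_free_comm_monoid\<close>). Finiteness of the morphism sets gives short
  arguments here. The endomorphism ring of an indecomposable \<open>S\<close> is a finite ring without
  nontrivial idempotents, hence local; and the multiplicity of \<open>S\<close> in \<open>X\<close> is
  determined by the number \<open>|Hom(S, X)| / |rad(S, X)|\<close>, which is multiplicative in
  \<open>X\<close>, larger than 1 for \<open>X = S\<close> and equal to 1 for all other indecomposable
  \<open>X\<close>.
\<close>


section \<open>Direct sums as products\<close>

text \<open>
  Biproducts are determined by either half of their data. Working with the projections alone
  turns all statements about sums of isomorphism classes into uniqueness arguments for morphisms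
  into a product, with no addition of morphisms.
\<close>

definition is_product :: "('o, 'm, 'k) lincat \<Rightarrow> 'o \<Rightarrow> 'o \<Rightarrow> 'o \<Rightarrow> 'm \<Rightarrow> 'm \<Rightarrow> bool" where
  "is_product C A B S p q \<longleftrightarrow>
     A \<in> Ob C \<and> B \<in> Ob C \<and> S \<in> Ob C \<and> p \<in> mor C S A \<and> q \<in> mor C S B \<and>
     (\<forall>T \<in> Ob C. \<forall>u \<in> mor C T A. \<forall>v \<in> mor C T B.
        \<exists>!h. h \<in> mor C T S \<and> p \<bullet>\<^bsub>C\<^esub> h = u \<and> q \<bullet>\<^bsub>C\<^esub> h = v)"

context linear_category
begin

lemma Hom_abelian_group: "\<lbrakk>A \<in> Ob C; B \<in> Ob C\<rbrakk> \<Longrightarrow> abelian_group (Hom C A B)"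
  by (meson module.axioms(2) module_Hom)

lemma zero_mor: "\<lbrakk>A \<in> Ob C; B \<in> Ob C\<rbrakk> \<Longrightarrow> \<zero>\<^bsub>Hom C A B\<^esub> \<in> mor C A B"
  using Hom_abelian_group abelian_group.axioms(1) abelian_monoid.zero_closed by blast

lemma add_mor:
  "\<lbrakk>A \<in> Ob C; B \<in> Ob C; f \<in> mor C A B; g \<in> mor C A B\<rbrakk> \<Longrightarrow> f \<oplus>\<^bsub>Hom C A B\<^esub> g \<in> mor C A B"
  using Hom_abelian_group abelian_group.axioms(1) abelian_monoid.a_closed by metis

lemma add_zero_right:
  "\<lbrakk>A \<in> Ob C; B \<in> Ob C; f \<in> mor C A B\<rbrakk> \<Longrightarrow> f \<oplus>\<^bsub>Hom C A B\<^esub> \<zero>\<^bsub>Hom C A B\<^esub> = f"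
  using Hom_abelian_group abelian_group.axioms(1) abelian_monoid.r_zero by metis

lemma add_zero_left:
  "\<lbrakk>A \<in> Ob C; B \<in> Ob C; f \<in> mor C A B\<rbrakk> \<Longrightarrow> \<zero>\<^bsub>Hom C A B\<^esub> \<oplus>\<^bsub>Hom C A B\<^esub> f = f"
  using Hom_abelian_group abelian_group.axioms(1) abelian_monoid.l_zero by metis

lemma add_self_eq_zero:
  assumes "A \<in> Ob C" "B \<in> Ob C" "f \<in> mor C A B" "f \<oplus>\<^bsub>Hom C A B\<^esub> f = f"
  shows "f = \<zero>\<^bsub>Hom C A B\<^esub>"
proof -
  interpret abelian_group "Hom C A B" using Hom_abelian_group assms by blast
  show ?thesis using assms add.l_cancel_one by blast
qed

lemma comp_zero_left:
  assumes "X \<in> Ob C" "Y \<in> Ob C" "Z \<in> Ob C" "f \<in> mor C X Y"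
  shows "\<zero>\<^bsub>Hom C Y Z\<^esub> \<bullet> f = \<zero>\<^bsub>Hom C X Z\<^esub>"
  by (intro add_self_eq_zero)
    (use assms comp_add_left[of X Y Z f "\<zero>\<^bsub>Hom C Y Z\<^esub>" "\<zero>\<^bsub>Hom C Y Z\<^esub>"] in
      \<open>auto simp: zero_mor comp_closed[of X Y Z] add_zero_left\<close>)

lemma comp_zero_right:
  assumes "X \<in> Ob C" "Y \<in> Ob C" "Z \<in> Ob C" "g \<in> mor C Y Z"
  shows "g \<bullet> \<zero>\<^bsub>Hom C X Y\<^esub> = \<zero>\<^bsub>Hom C X Z\<^esub>"
  by (intro add_self_eq_zero)
    (use assms comp_add_right[of X Y Z "\<zero>\<^bsub>Hom C X Y\<^esub>" "\<zero>\<^bsub>Hom C X Y\<^esub>" g] in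
      \<open>auto simp: zero_mor comp_closed[of X Y Z] add_zero_left\<close>)

lemma product_eqI:
  assumes "is_product C A B S p q" "T \<in> Ob C" "f \<in> mor C T S" "g \<in> mor C T S"
    "p \<bullet> f = p \<bullet> g" "q \<bullet> f = q \<bullet> g"
  shows "f = g"
proof -
  have "p \<bullet> g \<in> mor C T A" "q \<bullet> g \<in> mor C T B"
    using assms unfolding is_product_def by (meson comp_closed)+
  then show ?thesis using assms unfolding is_product_def by metis
qed

lemma product_pairing:
  assumes "is_product C A B S p q" "T \<in> Ob C" "u \<in> mor C T A" "v \<in> mor C T B"
  obtains h where "h \<in> mor C T S" "p \<bullet> h = u" "q \<bullet> h = v"
  using assms unfolding is_product_def by metis

lemma product_swap: "is_product C A B S p q \<Longrightarrow> is_product C B A S q p"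
  unfolding is_product_def by (auto simp: conj_commute)

text \<open>
  The morphism with components \<open>u\<close> and \<open>v\<close> is \<open>i u + j v\<close>, and
  it is the only one because \<open>k = (i p + j q) k\<close>.
\<close>

lemma biproduct_imp_product:
  assumes b: "biproduct C A B S i j p q"
  shows "is_product C A B S p q"
  unfolding is_product_def
proof (intro conjI ballI)
  note b' = b[unfolded biproduct_def]
  show "A \<in> Ob C" "B \<in> Ob C" "S \<in> Ob C" "p \<in> mor C S A" "q \<in> mor C S B" using b' by auto
  fix T u v assume T: "T \<in> Ob C" and u: "u \<in> mor C T A" and v: "v \<in> mor C T B"
  have iu: "i \<bullet> u \<in> mor C T S" and jv: "j \<bullet> v \<in> mor C T S"
    using b' T u v by (meson comp_closed)+
  define h where "h = (i \<bullet> u) \<oplus>\<^bsub>Hom C T S\<^esub> (j \<bullet> v)"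
  have h: "h \<in> mor C T S" unfolding h_def using b' T iu jv by (intro add_mor) auto
  have "p \<bullet> h = ((p \<bullet> i) \<bullet> u) \<oplus>\<^bsub>Hom C T A\<^esub> ((p \<bullet> j) \<bullet> v)"
    unfolding h_def
    using b' T u v iu jv comp_add_right[of T S A "i \<bullet> u" "j \<bullet> v" p]
      comp_assoc[of T A S A u i p] comp_assoc[of T B S A v j p] by auto
  then have ph: "p \<bullet> h = u"
    using b' T u v by (simp add: comp_zero_left[of T B A] ident_comp add_zero_right)
  have "q \<bullet> h = ((q \<bullet> i) \<bullet> u) \<oplus>\<^bsub>Hom C T B\<^esub> ((q \<bullet> j) \<bullet> v)"
    unfolding h_def
    using b' T u v iu jv comp_add_right[of T S B "i \<bullet> u" "j \<bullet> v" q]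
      comp_assoc[of T A S B u i q] comp_assoc[of T B S B v j q] by auto
  then have qh: "q \<bullet> h = v"
    using b' T u v by (simp add: comp_zero_left[of T A B] ident_comp add_zero_left)
  have "k = h" if k: "k \<in> mor C T S" "p \<bullet> k = u" "q \<bullet> k = v" for k
  proof -
    have ip: "i \<bullet> p \<in> mor C S S" and jq: "j \<bullet> q \<in> mor C S S" using b' by (meson comp_closed)+
    have "k = ((i \<bullet> p) \<oplus>\<^bsub>Hom C S S\<^esub> (j \<bullet> q)) \<bullet> k" using b' T k by (simp add: ident_comp)
    also have "\<dots> = ((i \<bullet> p) \<bullet> k) \<oplus>\<^bsub>Hom C T S\<^esub> ((j \<bullet> q) \<bullet> k)"
      using b' T k ip jq by (intro comp_add_left) auto
    also have "(i \<bullet> p) \<bullet> k = i \<bullet> u" using b' T k comp_assoc[of T S A S k p i] by auto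
    also have "(j \<bullet> q) \<bullet> k = j \<bullet> v" using b' T k comp_assoc[of T S B S k q j] by auto
    finally show "k = h" unfolding h_def .
  qed
  then show "\<exists>!h. h \<in> mor C T S \<and> p \<bullet> h = u \<and> q \<bullet> h = v" using h ph qh by metis
qed

text \<open>
  The inclusions are the morphisms with components \<open>(1, 0)\<close> and \<open>(0, 1)\<close>; that
  \<open>i p + j q\<close> is the identity can be checked after composing with the two projections.
\<close>

lemma product_imp_biproduct:
  assumes P: "is_product C A B S p q"
  obtains i j where "biproduct C A B S i j p q"
proof -
  note P' = P[unfolded is_product_def]
  have ob: "A \<in> Ob C" "B \<in> Ob C" "S \<in> Ob C" and pq: "p \<in> mor C S A" "q \<in> mor C S B"
    using P' by auto
  obtain i where i: "i \<in> mor C A S" "p \<bullet> i = Ident C A" "q \<bullet> i = \<zero>\<^bsub>Hom C A B\<^esub>"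
    using product_pairing[OF P ob(1) ident_closed[OF ob(1)] zero_mor[OF ob(1,2)]] .
  obtain j where j: "j \<in> mor C B S" "p \<bullet> j = \<zero>\<^bsub>Hom C B A\<^esub>" "q \<bullet> j = Ident C B"
    using product_pairing[OF P ob(2) zero_mor[OF ob(2,1)] ident_closed[OF ob(2)]] .
  have ip: "i \<bullet> p \<in> mor C S S" and jq: "j \<bullet> q \<in> mor C S S" using ob pq i j by (meson comp_closed)+
  have "(i \<bullet> p) \<oplus>\<^bsub>Hom C S S\<^esub> (j \<bullet> q) = Ident C S"
  proof (rule product_eqI[OF P ob(3)])
    have "p \<bullet> ((i \<bullet> p) \<oplus>\<^bsub>Hom C S S\<^esub> (j \<bullet> q)) =
        ((p \<bullet> i) \<bullet> p) \<oplus>\<^bsub>Hom C S A\<^esub> ((p \<bullet> j) \<bullet> q)"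
      using ob pq i(1) j(1) ip jq comp_add_right[of S S A "i \<bullet> p" "j \<bullet> q" p]
        comp_assoc[of S A S A p i p] comp_assoc[of S B S A q j p] by auto
    then show "p \<bullet> ((i \<bullet> p) \<oplus>\<^bsub>Hom C S S\<^esub> (j \<bullet> q)) = p \<bullet> Ident C S"
      using ob pq i j by (simp add: comp_zero_left[of S B A] ident_comp comp_ident add_zero_right)
    have "q \<bullet> ((i \<bullet> p) \<oplus>\<^bsub>Hom C S S\<^esub> (j \<bullet> q)) =
        ((q \<bullet> i) \<bullet> p) \<oplus>\<^bsub>Hom C S B\<^esub> ((q \<bullet> j) \<bullet> q)"
      using ob pq i(1) j(1) ip jq comp_add_right[of S S B "i \<bullet> p" "j \<bullet> q" q]
        comp_assoc[of S A S B p i q] comp_assoc[of S B S B q j q] by auto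
    then show "q \<bullet> ((i \<bullet> p) \<oplus>\<^bsub>Hom C S S\<^esub> (j \<bullet> q)) = q \<bullet> Ident C S"
      using ob pq i j by (simp add: comp_zero_left[of S A B] ident_comp comp_ident add_zero_left)
  qed (use ob ip jq in \<open>auto simp: add_mor ident_closed\<close>)
  then show ?thesis using that[of i j] ob pq i j unfolding biproduct_def by simp
qed

lemma is_direct_sum_iff_product: "is_direct_sum C A B S \<longleftrightarrow> (\<exists>p q. is_product C A B S p q)"
  unfolding is_direct_sum_def by (meson biproduct_imp_product product_imp_biproduct)

lemma direct_sum_objects:
  "is_direct_sum C A B S \<Longrightarrow> A \<in> Ob C \<and> B \<in> Ob C \<and> S \<in> Ob C"
  unfolding is_direct_sum_def biproduct_def by blast

lemma direct_sum_commute: "is_direct_sum C A B S \<Longrightarrow> is_direct_sum C B A S"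
  unfolding is_direct_sum_iff_product using product_swap by blast

lemma is_isoE:
  assumes "is_iso C A B f"
  obtains g where "f \<in> mor C A B" "g \<in> mor C B A" "g \<bullet> f = Ident C A" "f \<bullet> g = Ident C B"
  using assms unfolding is_iso_def by blast

lemma isomorphicI:
  "\<lbrakk>A \<in> Ob C; B \<in> Ob C; f \<in> mor C A B; g \<in> mor C B A; g \<bullet> f = Ident C A; f \<bullet> g = Ident C B\<rbrakk>
    \<Longrightarrow> isomorphic C A B"
  unfolding isomorphic_def is_iso_def by blast

lemma isomorphicE:
  assumes "isomorphic C A B"
  obtains f g where "A \<in> Ob C" "B \<in> Ob C" "f \<in> mor C A B" "g \<in> mor C B A"
    "g \<bullet> f = Ident C A" "f \<bullet> g = Ident C B"
  using assms unfolding isomorphic_def is_iso_def by blast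

lemma is_iso_ident: "A \<in> Ob C \<Longrightarrow> is_iso C A A (Ident C A)"
  unfolding is_iso_def by (metis ident_closed ident_comp)

lemma is_iso_comp:
  assumes "X \<in> Ob C" "Y \<in> Ob C" "Z \<in> Ob C" "is_iso C X Y f" "is_iso C Y Z g"
  shows "is_iso C X Z (g \<bullet> f)"
proof -
  obtain f' where f: "f \<in> mor C X Y" "f' \<in> mor C Y X" "f' \<bullet> f = Ident C X" "f \<bullet> f' = Ident C Y"
    using assms(4) by (rule is_isoE)
  obtain g' where g: "g \<in> mor C Y Z" "g' \<in> mor C Z Y" "g' \<bullet> g = Ident C Y" "g \<bullet> g' = Ident C Z"
    using assms(5) by (rule is_isoE)
  note ob = assms(1-3)
  have c: "g \<bullet> f \<in> mor C X Z" "f' \<bullet> g' \<in> mor C Z X" using ob f g by (meson comp_closed)+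
  have "(f' \<bullet> g') \<bullet> (g \<bullet> f) = f' \<bullet> ((g' \<bullet> g) \<bullet> f)"
    using ob f g c comp_assoc[of X Z Y X "g \<bullet> f" g' f'] comp_assoc[of X Y Z Y f g g'] by auto
  then have 1: "(f' \<bullet> g') \<bullet> (g \<bullet> f) = Ident C X" using ob f g by (simp add: ident_comp)
  have "(g \<bullet> f) \<bullet> (f' \<bullet> g') = g \<bullet> ((f \<bullet> f') \<bullet> g')"
    using ob f g c comp_assoc[of Z X Y Z "f' \<bullet> g'" f g] comp_assoc[of Z Y X Y g' f' f] by auto
  then have 2: "(g \<bullet> f) \<bullet> (f' \<bullet> g') = Ident C Z" using ob f g by (simp add: ident_comp)
  show ?thesis unfolding is_iso_def using c 1 2 by blast
qed

lemma isomorphic_refl: "A \<in> Ob C \<Longrightarrow> isomorphic C A A"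
  unfolding isomorphic_def using is_iso_ident by blast

lemma isomorphic_sym: "isomorphic C A B \<Longrightarrow> isomorphic C B A"
  by (meson isomorphicE isomorphicI)

lemma isomorphic_trans: "\<lbrakk>isomorphic C X Y; isomorphic C Y Z\<rbrakk> \<Longrightarrow> isomorphic C X Z"
  unfolding isomorphic_def using is_iso_comp by blast

lemma iso_class_eq_iff: "A \<in> Ob C \<Longrightarrow> iso_class C A = iso_class C B \<longleftrightarrow> isomorphic C A B"
  unfolding iso_class_def
  by (safe; metis (mono_tags, lifting) isomorphic_refl isomorphic_sym isomorphic_trans mem_Collect_eq
      isomorphic_def)

lemma iso_class_self: "A \<in> Ob C \<Longrightarrow> A \<in> iso_class C A"
  by (simp add: iso_class_def isomorphic_refl)

lemma iso_class_in_Iso: "A \<in> Ob C \<Longrightarrow> iso_class C A \<in> Iso C"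
  by (simp add: Iso_def)

lemma Iso_member:
  assumes "X \<in> Iso C" "A \<in> X"
  shows "A \<in> Ob C" "iso_class C A = X"
proof -
  obtain B where B: "B \<in> Ob C" "X = iso_class C B" using assms(1) unfolding Iso_def by blast
  then have "isomorphic C B A" using assms(2) by (simp add: iso_class_def)
  then show "A \<in> Ob C" "iso_class C A = X" using B iso_class_eq_iff[of B A] by (simp_all add: isomorphic_def)
qed

lemma rep_in:
  assumes "X \<in> Iso C"
  shows "rep X \<in> X"
proof -
  obtain A where "A \<in> Ob C" "X = iso_class C A" using assms unfolding Iso_def by (rule imageE)
  then have "A \<in> X" using iso_class_self by simp
  then show ?thesis unfolding rep_def by (rule someI)
qed

lemma rep_Ob: "X \<in> Iso C \<Longrightarrow> rep X \<in> Ob C"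
  using Iso_member(1) rep_in by blast

lemma iso_class_rep: "X \<in> Iso C \<Longrightarrow> iso_class C (rep X) = X"
  using Iso_member(2) rep_in by blast

lemma product_iso_transport:
  assumes P: "is_product C A B S p q" and iso: "S' \<in> Ob C" "is_iso C S' S b"
  shows "is_product C A B S' (p \<bullet> b) (q \<bullet> b)"
  unfolding is_product_def
proof (intro conjI ballI)
  note P' = P[unfolded is_product_def]
  have ob: "A \<in> Ob C" "B \<in> Ob C" "S \<in> Ob C" and pq: "p \<in> mor C S A" "q \<in> mor C S B"
    using P' by auto
  then show "A \<in> Ob C" "B \<in> Ob C" "S' \<in> Ob C" using iso by auto
  obtain g where g: "b \<in> mor C S' S" "g \<in> mor C S S'" "g \<bullet> b = Ident C S'" "b \<bullet> g = Ident C S"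
    using iso(2) by (rule is_isoE)
  show "p \<bullet> b \<in> mor C S' A" "q \<bullet> b \<in> mor C S' B" using ob pq g iso by (meson comp_closed)+
  fix T u v assume T: "T \<in> Ob C" and u: "u \<in> mor C T A" and v: "v \<in> mor C T B"
  obtain h where h: "h \<in> mor C T S" "p \<bullet> h = u" "q \<bullet> h = v" using product_pairing[OF P T u v] .
  have bgh: "b \<bullet> (g \<bullet> h) = h" using comp_assoc[of T S S' S h g b] T h g ob iso by (simp add: ident_comp)
  have gh: "g \<bullet> h \<in> mor C T S'" using T h g ob iso by (meson comp_closed)
  have eq: "(p \<bullet> b) \<bullet> k = p \<bullet> (b \<bullet> k)" "(q \<bullet> b) \<bullet> k = q \<bullet> (b \<bullet> k)" if "k \<in> mor C T S'" for k
    using that T ob iso pq g by (meson comp_assoc)+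
  show "\<exists>!h. h \<in> mor C T S' \<and> (p \<bullet> b) \<bullet> h = u \<and> (q \<bullet> b) \<bullet> h = v"
  proof (rule ex1I[of _ "g \<bullet> h"])
    show "g \<bullet> h \<in> mor C T S' \<and> (p \<bullet> b) \<bullet> (g \<bullet> h) = u \<and> (q \<bullet> b) \<bullet> (g \<bullet> h) = v"
      using gh eq bgh h by simp
    fix k assume k: "k \<in> mor C T S' \<and> (p \<bullet> b) \<bullet> k = u \<and> (q \<bullet> b) \<bullet> k = v"
    then have "b \<bullet> k \<in> mor C T S" using T ob iso g by (meson comp_closed)
    then have "b \<bullet> k = h" using k eq h product_eqI[OF P T] by metis
    then show "k = g \<bullet> h" using comp_assoc[of T S' S S' k b g] T k g ob iso by (simp add: ident_comp)
  qed
qed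

lemma direct_sum_iso:
  assumes "is_direct_sum C A B S" "isomorphic C S S'"
  shows "is_direct_sum C A B S'"
  using assms product_iso_transport isomorphic_sym unfolding is_direct_sum_iff_product isomorphic_def
  by metis

lemma product_iso:
  assumes P: "is_product C A B S p q" and P': "is_product C A' B' S' p' q'"
    and a: "is_iso C A A' a" and b: "is_iso C B B' b"
  obtains h where "is_iso C S S' h" "p' \<bullet> h = a \<bullet> p" "q' \<bullet> h = b \<bullet> q"
proof -
  have ob: "A \<in> Ob C" "B \<in> Ob C" "S \<in> Ob C" and pq: "p \<in> mor C S A" "q \<in> mor C S B"
    using P[unfolded is_product_def] by auto
  have ob': "A' \<in> Ob C" "B' \<in> Ob C" "S' \<in> Ob C" and pq': "p' \<in> mor C S' A'" "q' \<in> mor C S' B'"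
    using P'[unfolded is_product_def] by auto
  obtain a' where a: "a \<in> mor C A A'" "a' \<in> mor C A' A" "a' \<bullet> a = Ident C A" "a \<bullet> a' = Ident C A'"
    using a by (rule is_isoE)
  obtain b' where b: "b \<in> mor C B B'" "b' \<in> mor C B' B" "b' \<bullet> b = Ident C B" "b \<bullet> b' = Ident C B'"
    using b by (rule is_isoE)
  have "a \<bullet> p \<in> mor C S A'" "b \<bullet> q \<in> mor C S B'" using ob ob' a b pq by (meson comp_closed)+
  then obtain h where h: "h \<in> mor C S S'" "p' \<bullet> h = a \<bullet> p" "q' \<bullet> h = b \<bullet> q"
    using product_pairing[OF P' ob(3)] by metis
  have "a' \<bullet> p' \<in> mor C S' A" "b' \<bullet> q' \<in> mor C S' B" using ob ob' a b pq' by (meson comp_closed)+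
  then obtain k where k: "k \<in> mor C S' S" "p \<bullet> k = a' \<bullet> p'" "q \<bullet> k = b' \<bullet> q'"
    using product_pairing[OF P ob'(3)] by metis
  have hk: "k \<bullet> h \<in> mor C S S" "h \<bullet> k \<in> mor C S' S'" using ob ob' h k by (meson comp_closed)+
  have "p \<bullet> (k \<bullet> h) = a' \<bullet> (a \<bullet> p)"
    using ob ob' h k pq pq' a comp_assoc[of S S' S A h k p] comp_assoc[of S S' A' A h p' a'] by auto
  then have pkh: "p \<bullet> (k \<bullet> h) = p"
    using ob ob' pq a comp_assoc[of S A A' A p a a'] by (simp add: ident_comp)
  have "q \<bullet> (k \<bullet> h) = b' \<bullet> (b \<bullet> q)"
    using ob ob' h k pq pq' b comp_assoc[of S S' S B h k q] comp_assoc[of S S' B' B h q' b'] by auto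
  then have "q \<bullet> (k \<bullet> h) = q"
    using ob ob' pq b comp_assoc[of S B B' B q b b'] by (simp add: ident_comp)
  then have 1: "k \<bullet> h = Ident C S"
    using pkh product_eqI[OF P ob(3) hk(1) ident_closed[OF ob(3)]] ob pq by (simp add: comp_ident)
  have "p' \<bullet> (h \<bullet> k) = a \<bullet> (a' \<bullet> p')"
    using ob ob' h k pq pq' a comp_assoc[of S' S S' A' k h p'] comp_assoc[of S' S A A' k p a] by auto
  then have phk: "p' \<bullet> (h \<bullet> k) = p'"
    using ob ob' pq' a comp_assoc[of S' A' A A' p' a' a] by (simp add: ident_comp)
  have "q' \<bullet> (h \<bullet> k) = b \<bullet> (b' \<bullet> q')"
    using ob ob' h k pq pq' b comp_assoc[of S' S S' B' k h q'] comp_assoc[of S' S B B' k q b] by auto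
  then have "q' \<bullet> (h \<bullet> k) = q'"
    using ob ob' pq' b comp_assoc[of S' B' B B' q' b' b] by (simp add: ident_comp)
  then have 2: "h \<bullet> k = Ident C S'"
    using phk product_eqI[OF P' ob'(3) hk(2) ident_closed[OF ob'(3)]] ob' pq' by (simp add: comp_ident)
  show ?thesis using that[of h] h k 1 2 unfolding is_iso_def by blast
qed

lemma direct_sum_unique:
  assumes "is_direct_sum C A B S" "is_direct_sum C A' B' S'" "isomorphic C A A'" "isomorphic C B B'"
  shows "isomorphic C S S'"
  using assms product_iso direct_sum_objects unfolding is_direct_sum_iff_product isomorphic_def
  by metis

text \<open>
  If the identity of \<open>A\<close> is zero, then every morphism into or out of \<open>A\<close> factors
  through zero.
\<close>

lemma zero_object_iff_ident:
  assumes "A \<in> Ob C"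
  shows "zero_object C A \<longleftrightarrow> Ident C A = \<zero>\<^bsub>Hom C A A\<^esub>"
proof
  assume "zero_object C A"
  then show "Ident C A = \<zero>\<^bsub>Hom C A A\<^esub>"
    using assms ident_closed zero_mor unfolding zero_object_def by blast
next
  assume e: "Ident C A = \<zero>\<^bsub>Hom C A A\<^esub>"
  have "f = \<zero>\<^bsub>Hom C A B\<^esub>" if "f \<in> mor C A B" "B \<in> Ob C" for f B
    using that assms e comp_ident comp_zero_right by metis
  moreover have "f = \<zero>\<^bsub>Hom C B A\<^esub>" if "f \<in> mor C B A" "B \<in> Ob C" for f B
    using that assms e ident_comp comp_zero_left by metis
  ultimately show "zero_object C A" unfolding zero_object_def using assms zero_mor by blast
qed

lemma zero_object_Hom:
  assumes "zero_object C Z" "A \<in> Ob C"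
  shows "mor C Z A = {\<zero>\<^bsub>Hom C Z A\<^esub>}" "mor C A Z = {\<zero>\<^bsub>Hom C A Z\<^esub>}"
  using assms zero_mor unfolding zero_object_def by blast+

lemma zero_object_iso_class:
  assumes "zero_object C Z"
  shows "{Z. zero_object C Z} = iso_class C Z"
proof -
  have Z: "Z \<in> Ob C" using assms by (simp add: zero_object_def)
  have "isomorphic C Z Z'" if "zero_object C Z'" for Z'
  proof -
    have Z': "Z' \<in> Ob C" using that by (simp add: zero_object_def)
    show ?thesis
      using assms that Z Z' by (intro isomorphicI[OF Z Z', of "\<zero>\<^bsub>Hom C Z Z'\<^esub>" "\<zero>\<^bsub>Hom C Z' Z\<^esub>"])
        (simp_all add: zero_mor comp_zero_left[of Z Z' Z] comp_zero_left[of Z' Z Z'] zero_object_iff_ident)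
  qed
  moreover have "zero_object C Z'" if iso: "isomorphic C Z Z'" for Z'
  proof -
    obtain f g where fg: "Z' \<in> Ob C" "f \<in> mor C Z Z'" "g \<in> mor C Z' Z" "f \<bullet> g = Ident C Z'"
      using iso unfolding isomorphic_def is_iso_def by blast
    then have "f = \<zero>\<^bsub>Hom C Z Z'\<^esub>" using zero_object_Hom[OF assms] by blast
    then have "Ident C Z' = \<zero>\<^bsub>Hom C Z' Z'\<^esub>" using fg Z comp_zero_left[of Z' Z Z' g] by simp
    then show ?thesis using fg zero_object_iff_ident by simp
  qed
  ultimately show ?thesis unfolding iso_class_def by blast
qed

lemma direct_sum_zero_right:
  assumes "zero_object C Z" "A \<in> Ob C"
  shows "is_direct_sum C A Z A"
proof -
  have "is_product C A Z A (Ident C A) \<zero>\<^bsub>Hom C A Z\<^esub>"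
    unfolding is_product_def
    using assms zero_object_Hom[OF assms(1)] assms(1)[unfolded zero_object_def]
    by (auto simp: ident_closed ident_comp intro: comp_zero_left)
  then show ?thesis using is_direct_sum_iff_product by blast
qed

text \<open>
  A morphism into \<open>T\<close> amounts to three components, in \<open>A\<close>, \<open>B\<close> and
  \<open>D\<close>; the last two of them are grouped through \<open>U\<close>.
\<close>

lemma direct_sum_assoc:
  assumes 1: "is_direct_sum C A B S" and 2: "is_direct_sum C S D T" and 3: "is_direct_sum C B D U"
  shows "is_direct_sum C A U T"
proof -
  obtain p q where S: "is_product C A B S p q" using 1 is_direct_sum_iff_product by blast
  obtain s d where T: "is_product C S D T s d" using 2 is_direct_sum_iff_product by blast
  obtain b d' where U: "is_product C B D U b d'" using 3 is_direct_sum_iff_product by blast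
  have ob: "A \<in> Ob C" "B \<in> Ob C" "D \<in> Ob C" "S \<in> Ob C" "T \<in> Ob C" "U \<in> Ob C"
    using S T U unfolding is_product_def by auto
  have m: "p \<in> mor C S A" "q \<in> mor C S B" "s \<in> mor C T S" "d \<in> mor C T D"
      "b \<in> mor C U B" "d' \<in> mor C U D"
    using S T U unfolding is_product_def by auto
  have ps: "p \<bullet> s \<in> mor C T A" and qs: "q \<bullet> s \<in> mor C T B" using ob m by (meson comp_closed)+
  obtain r where r: "r \<in> mor C T U" "b \<bullet> r = q \<bullet> s" "d' \<bullet> r = d"
    using product_pairing[OF U ob(5) qs m(4)] .
  have "is_product C A U T (p \<bullet> s) r"
    unfolding is_product_def
  proof (intro conjI ballI)
    fix X u v assume X: "X \<in> Ob C" and u: "u \<in> mor C X A" and v: "v \<in> mor C X U"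
    have bv: "b \<bullet> v \<in> mor C X B" "d' \<bullet> v \<in> mor C X D" using X v ob m by (meson comp_closed)+
    obtain k where k: "k \<in> mor C X S" "p \<bullet> k = u" "q \<bullet> k = b \<bullet> v"
      using product_pairing[OF S X u bv(1)] .
    obtain h where h: "h \<in> mor C X T" "s \<bullet> h = k" "d \<bullet> h = d' \<bullet> v"
      using product_pairing[OF T X k(1) bv(2)] .
    have eq: "(p \<bullet> s) \<bullet> h' = u \<and> r \<bullet> h' = v \<longleftrightarrow> s \<bullet> h' = k \<and> d \<bullet> h' = d' \<bullet> v"
      if h': "h' \<in> mor C X T" for h'
    proof -
      have c: "s \<bullet> h' \<in> mor C X S" "r \<bullet> h' \<in> mor C X U" using h' X ob m r by (meson comp_closed)+
      have "s \<bullet> h' = k \<longleftrightarrow> p \<bullet> (s \<bullet> h') = u \<and> q \<bullet> (s \<bullet> h') = b \<bullet> v"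
        using k product_eqI[OF S X c(1) k(1)] by auto
      moreover have "r \<bullet> h' = v \<longleftrightarrow> b \<bullet> (r \<bullet> h') = b \<bullet> v \<and> d' \<bullet> (r \<bullet> h') = d' \<bullet> v"
        using product_eqI[OF U X c(2) v] by auto
      moreover have "p \<bullet> (s \<bullet> h') = (p \<bullet> s) \<bullet> h'" "q \<bullet> (s \<bullet> h') = b \<bullet> (r \<bullet> h')"
          "d' \<bullet> (r \<bullet> h') = d \<bullet> h'"
        using h' X ob m r comp_assoc[of X T S A h' s p] comp_assoc[of X T S B h' s q]
          comp_assoc[of X T U B h' r b] comp_assoc[of X T U D h' r d'] by auto
      ultimately show ?thesis by auto
    qed
    show "\<exists>!h. h \<in> mor C X T \<and> (p \<bullet> s) \<bullet> h = u \<and> r \<bullet> h = v"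
      using h eq product_eqI[OF T X] by metis
  qed (use ob ps r in auto)
  then show ?thesis using is_direct_sum_iff_product by blast
qed

lemma iso_sum_class:
  assumes "is_direct_sum C A B S"
  shows "iso_sum C (iso_class C A) (iso_class C B) = iso_class C S"
proof -
  have "isomorphic C S S'" if "isomorphic C A A'" "isomorphic C B B'" "is_direct_sum C A' B' S'" for A' B' S'
    using direct_sum_unique assms that by blast
  moreover have "is_direct_sum C A B S'" if "isomorphic C S S'" for S'
    using direct_sum_iso assms that by blast
  ultimately show ?thesis
    using direct_sum_objects[OF assms] isomorphic_refl[of A] isomorphic_refl[of B]
    unfolding iso_sum_def iso_class_def by blast
qed

end


section \<open>Idempotents in finite rings\<close>

text \<open>
  Two powers \<open>x^i = x^(i+p)\<close> coincide, so from exponent \<open>i\<close> on the powers have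
  period \<open>p\<close>, and the exponent \<open>(i + 1) p\<close> is both large enough and a multiple of
  the period.
\<close>

lemma (in monoid) finite_monoid_idempotent_power:
  assumes fin: "finite (carrier G)" and x: "x \<in> carrier G"
  obtains n :: nat where "n > 0" "x [^] n \<otimes> x [^] n = x [^] n"
proof -
  have "\<not> inj_on (\<lambda>n::nat. x [^] n) UNIV"
    using x finite_subset[OF _ fin, of "range (\<lambda>n::nat. x [^] n)"] finite_imageD[of "\<lambda>n::nat. x [^] n" UNIV]
    by auto
  then obtain i j :: nat where "x [^] i = x [^] j" "i < j"
    unfolding inj_on_def by (metis linorder_neqE_nat)
  then obtain p where p: "p > 0" "x [^] i = x [^] (i + p)"
    using less_imp_add_positive by blast
  have step: "x [^] (m + p) = x [^] m" if m: "m \<ge> i" for m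
  proof -
    obtain d where d: "m = i + d" using m le_Suc_ex by blast
    have "x [^] (m + p) = x [^] (i + p) \<otimes> x [^] d" by (simp add: d x nat_pow_mult ac_simps)
    also have "\<dots> = x [^] m" by (simp add: p(2)[symmetric] d x nat_pow_mult)
    finally show ?thesis .
  qed
  have "x [^] (m + k * p) = x [^] m" if "m \<ge> i" for m k
  proof (induction k)
    case (Suc k)
    have "x [^] (m + Suc k * p) = x [^] ((m + k * p) + p)" by (simp add: ac_simps)
    also have "\<dots> = x [^] (m + k * p)" using that by (intro step) simp
    finally show ?case using Suc by simp
  qed simp
  moreover have "Suc i * p \<ge> i" using p(1) by (cases p) auto
  ultimately have "x [^] (Suc i * p + Suc i * p) = x [^] (Suc i * p)" by blast
  then show ?thesis using that[of "Suc i * p"] p(1) x by (simp add: nat_pow_mult)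
qed

text \<open>
  A finite ring whose only idempotents are 0 and 1 is local: some positive power of each element is
  idempotent, so each element is nilpotent or a unit. After multiplying with the inverse of
  \<open>x + y\<close> one has \<open>a + b = 1\<close>, and nilpotent \<open>a\<close> and \<open>b\<close>
  would give \<open>1 = 0\<close>.
\<close>

lemma (in ring) finite_ring_sum_unit:
  assumes fin: "finite (carrier R)"
    and idem: "\<And>e. \<lbrakk>e \<in> carrier R; e \<otimes> e = e\<rbrakk> \<Longrightarrow> e = \<zero> \<or> e = \<one>"
    and xy: "x \<in> carrier R" "y \<in> carrier R" "x \<oplus> y \<in> Units R"
  shows "x \<in> Units R \<or> y \<in> Units R"
proof (rule ccontr)
  assume neg: "\<not> ?thesis"
  have nil: "\<exists>n::nat. a [^] n = \<zero>" if a: "a \<in> carrier R" "a \<notin> Units R" for a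
  proof -
    obtain n :: nat where n: "n > 0" "a [^] n \<otimes> a [^] n = a [^] n"
      using finite_monoid_idempotent_power[OF fin a(1)] .
    have "a [^] n \<noteq> \<one>"
    proof
      assume "a [^] n = \<one>"
      then obtain m where m: "a [^] Suc m = \<one>" using n(1) gr0_implies_Suc by blast
      then have "a [^] m \<otimes> a = \<one>" "a \<otimes> a [^] m = \<one>"
        using a nat_pow_comm[of a 1 m] by (simp_all)
      then have "a \<in> Units R" unfolding Units_def using a(1) nat_pow_closed by blast
      then show False using a by simp
    qed
    then show ?thesis using idem[OF _ n(2)] a by auto
  qed
  let ?v = "inv (x \<oplus> y)"
  have v: "?v \<in> carrier R" "?v \<in> Units R" using xy by auto
  define a where "a = ?v \<otimes> x"
  define b where "b = ?v \<otimes> y"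
  have ab: "a \<in> carrier R" "b \<in> carrier R" "a \<oplus> b = \<one>"
    using xy v Units_l_inv[OF xy(3)] unfolding a_def b_def by (auto simp: r_distr[symmetric])
  have unit: "z \<in> Units R" if z: "z \<in> carrier R" "?v \<otimes> z \<in> Units R" for z
  proof -
    have "z = (x \<oplus> y) \<otimes> (?v \<otimes> z)"
      using z xy v by (simp add: m_assoc[symmetric])
    then show ?thesis using Units_m_closed[OF xy(3) z(2)] by simp
  qed
  have "a \<notin> Units R" "b \<notin> Units R" using unit xy neg unfolding a_def b_def by blast+
  then obtain n m :: nat where n: "a [^] n = \<zero>" and m: "b [^] m = \<zero>" using nil ab by blast
  have "\<one> \<noteq> \<zero>"
  proof
    assume "\<one> = \<zero>"
    then have "x = \<one>" using xy one_zeroD by auto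
    then show False using neg by simp
  qed
  \<comment> \<open>The last nonzero power \<open>e\<close> of \<open>a\<close> satisfies \<open>e = e (a + b) = e b\<close>, so \<open>e = e b^m = 0\<close>.\<close>
  define k where "k = (LEAST k::nat. a [^] k = \<zero>)"
  have k: "a [^] k = \<zero>" unfolding k_def using n by (rule LeastI)
  then have "k \<noteq> 0" using \<open>\<one> \<noteq> \<zero>\<close> by (cases k) auto
  then obtain l where l: "k = Suc l" using not0_implies_Suc by blast
  define e where "e = a [^] l"
  have e: "e \<in> carrier R" "e \<otimes> a = \<zero>" "e \<noteq> \<zero>"
    using ab k l not_less_Least[of l "\<lambda>k::nat. a [^] k = \<zero>"] unfolding e_def k_def by auto
  have eb: "e = e \<otimes> b" using e ab r_distr[of a b e] by simp
  have "e = e \<otimes> b [^] j" for j :: nat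
    by (induction j) (use e ab in \<open>simp_all add: m_assoc[symmetric] eb[symmetric]\<close>)
  then have "e = \<zero>" using m e by (metis r_null)
  then show False using e by simp
qed

lemma (in ring) complementary_idempotent:
  assumes e: "e \<in> carrier R" "e \<otimes> e = e"
  obtains e' where "e' \<in> carrier R" "e \<oplus> e' = \<one>" "e \<otimes> e' = \<zero>" "e' \<otimes> e = \<zero>" "e' \<otimes> e' = e'"
proof -
  let ?e' = "\<one> \<oplus> \<ominus> e"
  have c: "?e' \<in> carrier R" using e by simp
  have s: "e \<oplus> ?e' = \<one>" using e by (metis a_comm a_inv_closed a_assoc one_closed r_neg r_zero)
  have 1: "e \<otimes> ?e' = \<zero>" using e by (simp add: r_distr r_minus r_neg)
  have 2: "?e' \<otimes> e = \<zero>" using e by (simp add: l_distr l_minus r_neg)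
  have "?e' \<otimes> ?e' = ?e' \<otimes> ?e' \<oplus> e \<otimes> ?e'" using c 1 by simp
  also have "\<dots> = (?e' \<oplus> e) \<otimes> ?e'" using e c l_distr[of ?e' e ?e'] by simp
  also have "\<dots> = ?e'" using s e c a_comm[of e ?e'] by simp
  finally show ?thesis using that c s 1 2 by blast
qed


section \<open>Free commutative monoids\<close>

definition mset_prod :: "('a, 'b) monoid_scheme \<Rightarrow> 'a multiset \<Rightarrow> 'a" where
  "mset_prod G m = (\<Otimes>\<^bsub>G\<^esub>s \<in> set_mset m. s [^]\<^bsub>G\<^esub> count m s)"

context comm_monoid
begin

lemma mset_prod_superset:
  assumes "finite A" "set_mset m \<subseteq> A" "A \<subseteq> carrier G"
  shows "mset_prod G m = (\<Otimes>s \<in> A. s [^] count m s)"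
  unfolding mset_prod_def
  by (rule finprod_mono_neutral_cong_left) (use assms in \<open>auto simp: not_in_iff\<close>)

lemma mset_prod_closed: "set_mset m \<subseteq> carrier G \<Longrightarrow> mset_prod G m \<in> carrier G"
  unfolding mset_prod_def by (rule finprod_closed) auto

lemma mset_prod_empty: "mset_prod G {#} = \<one>"
  by (simp add: mset_prod_def)

lemma mset_prod_single: "s \<in> carrier G \<Longrightarrow> mset_prod G {#s#} = s"
  by (simp add: mset_prod_def)

lemma mset_prod_union:
  assumes "set_mset m \<subseteq> carrier G" "set_mset n \<subseteq> carrier G"
  shows "mset_prod G (m + n) = mset_prod G m \<otimes> mset_prod G n"
proof -
  let ?A = "set_mset m \<union> set_mset n"
  have "mset_prod G (m + n) = (\<Otimes>s \<in> ?A. s [^] count m s \<otimes> s [^] count n s)"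
    unfolding mset_prod_def using assms by (intro finprod_cong') (auto simp: nat_pow_mult)
  also have "\<dots> = (\<Otimes>s \<in> ?A. s [^] count m s) \<otimes> (\<Otimes>s \<in> ?A. s [^] count n s)"
    using assms by (intro finprod_multf) auto
  also have "\<dots> = mset_prod G m \<otimes> mset_prod G n"
    using assms by (simp add: mset_prod_superset[of ?A])
  finally show ?thesis .
qed

lemma multiplicative_mset_prod:
  fixes \<mu> :: "'a \<Rightarrow> 'c::comm_monoid_mult"
  assumes "\<mu> \<one> = 1" "\<And>x y. \<lbrakk>x \<in> carrier G; y \<in> carrier G\<rbrakk> \<Longrightarrow> \<mu> (x \<otimes> y) = \<mu> x * \<mu> y"
    and "set_mset m \<subseteq> carrier G"
  shows "\<mu> (mset_prod G m) = (\<Prod>s \<in># m. \<mu> s)"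
  using assms(3)
proof (induction m)
  case empty
  then show ?case using assms(1) by (simp add: mset_prod_empty)
next
  case (add s m)
  then have "mset_prod G (add_mset s m) = mset_prod G m \<otimes> s"
    using mset_prod_union[of m "{#s#}"] by (simp add: mset_prod_single)
  then show ?case using add assms(2) mset_prod_closed by (simp add: mult.commute)
qed

end

text \<open>
  A generating set \<open>S\<close> is free as soon as, for each \<open>s\<close> in \<open>S\<close>, some
  multiplicative numerical function is larger than 1 at \<open>s\<close> and equal to 1 on the rest of
  \<open>S\<close>: its value at a product is \<open>\<mu> s ^ count m s\<close>, which recovers the exponent
  of \<open>s\<close>. This replaces the exchange argument in the uniqueness of decompositions.
\<close>

lemma free_comm_monoid_onI:
  fixes G :: "'a monoid" (structure)
  assumes "comm_monoid G" and S: "S \<subseteq> carrier G"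
    and gen: "\<And>x. x \<in> carrier G \<Longrightarrow> \<exists>m. set_mset m \<subseteq> S \<and> x = mset_prod G m"
    and sep: "\<And>s. s \<in> S \<Longrightarrow> \<exists>\<mu> :: 'a \<Rightarrow> rat. \<mu> \<one> = 1 \<and>
        (\<forall>x \<in> carrier G. \<forall>y \<in> carrier G. \<mu> (x \<otimes> y) = \<mu> x * \<mu> y) \<and>
        \<mu> s > 1 \<and> (\<forall>t \<in> S. t \<noteq> s \<longrightarrow> \<mu> t = 1)"
  shows "free_comm_monoid_on G S"
proof -
  interpret comm_monoid G by fact
  have "m = n" if m: "set_mset m \<subseteq> S" and n: "set_mset n \<subseteq> S" and eq: "mset_prod G m = mset_prod G n" for m n
  proof (rule multiset_eqI)
    fix s
    show "count m s = count n s"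
    proof (cases "s \<in> S")
      case True
      then obtain \<mu> :: "'a \<Rightarrow> rat" where \<mu>: "\<mu> \<one> = 1"
          "\<And>x y. \<lbrakk>x \<in> carrier G; y \<in> carrier G\<rbrakk> \<Longrightarrow> \<mu> (x \<otimes> y) = \<mu> x * \<mu> y"
          "\<mu> s > 1" "\<And>t. t \<in> S \<Longrightarrow> t \<noteq> s \<Longrightarrow> \<mu> t = 1"
        using sep by metis
      have count: "\<mu> (mset_prod G l) = \<mu> s ^ count l s" if l: "set_mset l \<subseteq> S" for l
      proof -
        have "\<mu> (mset_prod G l) = (\<Prod>t \<in># l. \<mu> t)"
          using l S by (intro multiplicative_mset_prod \<mu>) auto
        also have "\<dots> = \<mu> s ^ count l s"
          using l by (induction l) (auto simp: \<mu>(4))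
        finally show ?thesis .
      qed
      have "\<mu> s ^ count m s = \<mu> s ^ count n s" using count m n eq by metis
      then show ?thesis using \<mu>(3) power_inject_exp by blast
    next
      case False
      then show ?thesis using m n by (metis count_inI subsetD)
    qed
  qed
  then have "\<exists>!m. set_mset m \<subseteq> S \<and> x = mset_prod G m" if "x \<in> carrier G" for x
    using gen[OF that] by metis
  then show ?thesis
    using S comm_monoid_axioms unfolding free_comm_monoid_on_def mset_prod_def by blast
qed


section \<open>Counting morphisms\<close>

context linear_category
begin

lemma product_pair_bij:
  assumes "is_product C A B S p q" "T \<in> Ob C"
  shows "bij_betw (\<lambda>h. (p \<bullet> h, q \<bullet> h)) (mor C T S) (mor C T A \<times> mor C T B)"
  unfolding bij_betw_def
proof (intro conjI inj_onI subset_antisym subsetI)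
  have m: "A \<in> Ob C" "B \<in> Ob C" "S \<in> Ob C" "p \<in> mor C S A" "q \<in> mor C S B"
    using assms unfolding is_product_def by auto
  fix x assume "x \<in> (\<lambda>h. (p \<bullet> h, q \<bullet> h)) ` mor C T S"
  then show "x \<in> mor C T A \<times> mor C T B"
    using m assms(2) comp_closed[of T S A _ p] comp_closed[of T S B _ q] by auto
next
  fix x assume "x \<in> mor C T A \<times> mor C T B"
  then obtain h where "h \<in> mor C T S" "p \<bullet> h = fst x" "q \<bullet> h = snd x"
    using product_pairing[OF assms, of "fst x" "snd x"] by (metis SigmaE fst_conv snd_conv)
  then show "x \<in> (\<lambda>h. (p \<bullet> h, q \<bullet> h)) ` mor C T S"
    by (intro image_eqI[of _ _ h]) (simp_all add: prod_eq_iff)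
qed (use product_eqI[OF assms] in auto)

lemma card_Hom_to_direct_sum:
  assumes "is_direct_sum C A B S" "T \<in> Ob C"
  shows "card (mor C T S) = card (mor C T A) * card (mor C T B)"
proof -
  obtain p q where P: "is_product C A B S p q"
    using assms(1) unfolding is_direct_sum_iff_product by (elim exE)
  show ?thesis using bij_betw_same_card[OF product_pair_bij[OF P assms(2)]] by (simp add: card_cartesian_product)
qed

text \<open>
  The dual of \<open>product_pair_bij\<close>: a morphism \<open>h\<close> is
  \<open>(h i) p + (h j) q\<close>.
\<close>

lemma biproduct_copair_bij:
  assumes b: "biproduct C A B S i j p q" and T: "T \<in> Ob C"
  shows "bij_betw (\<lambda>h. (h \<bullet> i, h \<bullet> j)) (mor C S T) (mor C A T \<times> mor C B T)"
proof -
  note b' = b[unfolded biproduct_def]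
  have ob: "A \<in> Ob C" "B \<in> Ob C" "S \<in> Ob C"
    and m: "i \<in> mor C A S" "j \<in> mor C B S" "p \<in> mor C S A" "q \<in> mor C S B"
    using b' by auto
  have dec: "h = (h \<bullet> i) \<bullet> p \<oplus>\<^bsub>Hom C S T\<^esub> (h \<bullet> j) \<bullet> q" if h: "h \<in> mor C S T" for h
  proof -
    have ij: "i \<bullet> p \<in> mor C S S" "j \<bullet> q \<in> mor C S S" using ob m by (meson comp_closed)+
    have "h = h \<bullet> ((i \<bullet> p) \<oplus>\<^bsub>Hom C S S\<^esub> (j \<bullet> q))" using b' h T by (simp add: comp_ident)
    also have "\<dots> = h \<bullet> (i \<bullet> p) \<oplus>\<^bsub>Hom C S T\<^esub> h \<bullet> (j \<bullet> q)"
      using ob T h ij by (intro comp_add_right) auto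
    finally show ?thesis
      using comp_assoc[of S A S T p i h] comp_assoc[of S B S T q j h] ob T m h by simp
  qed
  show ?thesis
    unfolding bij_betw_def
  proof (intro conjI inj_onI subset_antisym subsetI)
    fix x y assume "x \<in> mor C S T" "y \<in> mor C S T" "(x \<bullet> i, x \<bullet> j) = (y \<bullet> i, y \<bullet> j)"
    then show "x = y" using dec[of x] dec[of y] by auto
  next
    fix x assume "x \<in> (\<lambda>h. (h \<bullet> i, h \<bullet> j)) ` mor C S T"
    then show "x \<in> mor C A T \<times> mor C B T"
      using ob T m comp_closed[of A S T i] comp_closed[of B S T j] by auto
  next
    fix x assume "x \<in> mor C A T \<times> mor C B T"
    then obtain u v where x: "x = (u, v)" and u: "u \<in> mor C A T" and v: "v \<in> mor C B T" by blast
    have uv: "u \<bullet> p \<in> mor C S T" "v \<bullet> q \<in> mor C S T" using ob T m u v by (meson comp_closed)+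
    define h where "h = u \<bullet> p \<oplus>\<^bsub>Hom C S T\<^esub> v \<bullet> q"
    have h: "h \<in> mor C S T" unfolding h_def using ob T uv by (simp add: add_mor)
    have "h \<bullet> i = u \<bullet> (p \<bullet> i) \<oplus>\<^bsub>Hom C A T\<^esub> v \<bullet> (q \<bullet> i)"
      unfolding h_def using ob T m u v uv comp_add_left[of A S T i "u \<bullet> p" "v \<bullet> q"]
        comp_assoc[of A S A T i p u] comp_assoc[of A S B T i q v] by auto
    then have hi: "h \<bullet> i = u"
      using b' T u v by (simp add: comp_zero_right[of A B T] comp_ident add_zero_right)
    have "h \<bullet> j = u \<bullet> (p \<bullet> j) \<oplus>\<^bsub>Hom C B T\<^esub> v \<bullet> (q \<bullet> j)"
      unfolding h_def using ob T m u v uv comp_add_left[of B S T j "u \<bullet> p" "v \<bullet> q"]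
        comp_assoc[of B S A T j p u] comp_assoc[of B S B T j q v] by auto
    then have hj: "h \<bullet> j = v"
      using b' T u v by (simp add: comp_zero_right[of B A T] comp_ident add_zero_left)
    show "x \<in> (\<lambda>h. (h \<bullet> i, h \<bullet> j)) ` mor C S T" using x h hi hj by auto
  qed
qed

lemma card_Hom_from_direct_sum:
  assumes "is_direct_sum C A B S" "T \<in> Ob C"
  shows "card (mor C S T) = card (mor C A T) * card (mor C B T)"
proof -
  obtain i j p q where P: "biproduct C A B S i j p q"
    using assms(1) unfolding is_direct_sum_def by (elim exE)
  show ?thesis using bij_betw_same_card[OF biproduct_copair_bij[OF P assms(2)]] by (simp add: card_cartesian_product)
qed

lemma card_Hom_zero_object:
  assumes "zero_object C Z" "A \<in> Ob C"
  shows "card (mor C Z A) = 1" "card (mor C A Z) = 1"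
  using zero_object_Hom[OF assms] by simp_all

definition endo :: "'o \<Rightarrow> 'm ring" where
  "endo S = \<lparr>carrier = mor C S S, monoid.mult = Comp C, one = Ident C S,
     zero = \<zero>\<^bsub>Hom C S S\<^esub>, add = add (Hom C S S)\<rparr>"

lemma endo_simps [simp]:
  "carrier (endo S) = mor C S S" "f \<otimes>\<^bsub>endo S\<^esub> g = f \<bullet> g" "\<one>\<^bsub>endo S\<^esub> = Ident C S"
  "\<zero>\<^bsub>endo S\<^esub> = \<zero>\<^bsub>Hom C S S\<^esub>" "f \<oplus>\<^bsub>endo S\<^esub> g = f \<oplus>\<^bsub>Hom C S S\<^esub> g"
  by (simp_all add: endo_def)

lemma endo_ring:
  assumes "S \<in> Ob C"
  shows "ring (endo S)"
proof (rule ringI)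
  interpret H: abelian_group "Hom C S S" using Hom_abelian_group assms by simp
  show "abelian_group (endo S)"
    by (rule abelian_groupI) (auto simp: H.a_ac intro: H.add.l_inv_ex)
  show "monoid (endo S)"
    by (rule monoidI) (use assms in \<open>auto simp: comp_closed[of S S S] ident_closed ident_comp
      comp_ident comp_assoc[of S S S S]\<close>)
qed (use assms in \<open>simp_all add: comp_add_left[of S S S] comp_add_right[of S S S]\<close>)

lemma is_iso_iff_Units: "is_iso C S S f \<longleftrightarrow> f \<in> Units (endo S)"
  unfolding is_iso_def Units_def by auto

end

section \<open>Krull--Schmidt\<close>

locale krull_schmidt_category = additive_category +
  assumes Hom_finite: "Hom_finite C" and idempotent_complete: "idempotent_complete C"
begin

lemma finite_mor: "\<lbrakk>A \<in> Ob C; B \<in> Ob C\<rbrakk> \<Longrightarrow> finite (mor C A B)"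
  using Hom_finite unfolding Hom_finite_def by simp

lemma card_mor_pos: "\<lbrakk>A \<in> Ob C; B \<in> Ob C\<rbrakk> \<Longrightarrow> card (mor C A B) > 0"
  using finite_mor zero_mor card_gt_0_iff by fastforce

lemma split_idempotent:
  assumes "A \<in> Ob C" "e \<in> mor C A A" "e \<bullet> e = e"
  obtains B r s where "B \<in> Ob C" "r \<in> mor C A B" "s \<in> mor C B A" "s \<bullet> r = e" "r \<bullet> s = Ident C B"
  using idempotent_complete assms unfolding idempotent_complete_def by blast

text \<open>
  Splitting both \<open>e\<close> and \<open>1 - e\<close> writes \<open>S\<close> as a direct sum of two
  objects, one of which is zero.
\<close>

lemma indecomposable_idempotent:
  assumes S: "indecomposable C S" and e: "e \<in> mor C S S" "e \<bullet> e = e"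
  shows "e = \<zero>\<^bsub>Hom C S S\<^esub> \<or> e = Ident C S"
proof -
  have ob: "S \<in> Ob C" using S unfolding indecomposable_def by simp
  interpret R: ring "endo S" using endo_ring[OF ob] .
  obtain e' where e': "e' \<in> mor C S S" and sum: "e \<oplus>\<^bsub>Hom C S S\<^esub> e' = Ident C S"
    and z: "e' \<bullet> e = \<zero>\<^bsub>Hom C S S\<^esub>" "e \<bullet> e' = \<zero>\<^bsub>Hom C S S\<^esub>" and e'e': "e' \<bullet> e' = e'"
    using R.complementary_idempotent[of e] e by auto
  obtain A r s where A: "A \<in> Ob C" "r \<in> mor C S A" "s \<in> mor C A S" "s \<bullet> r = e" "r \<bullet> s = Ident C A"
    using split_idempotent[OF ob e] .
  obtain B r' s' where B: "B \<in> Ob C" "r' \<in> mor C S B" "s' \<in> mor C B S" "s' \<bullet> r' = e'" "r' \<bullet> s' = Ident C B"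
    using split_idempotent[OF ob e' e'e'] .
  have zero: "r' \<bullet> s = \<zero>\<^bsub>Hom C U V\<^esub>" if "U \<in> Ob C" "V \<in> Ob C" "r \<in> mor C S U" "s \<in> mor C U S"
      "r' \<in> mor C S V" "s' \<in> mor C V S" "r \<bullet> s = Ident C U" "r' \<bullet> s' = Ident C V"
      "(s' \<bullet> r') \<bullet> (s \<bullet> r) = \<zero>\<^bsub>Hom C S S\<^esub>" for U V r s r' s'
  proof -
    have c: "r' \<bullet> s \<in> mor C U V" "s \<bullet> r \<in> mor C S S" "s' \<bullet> r' \<in> mor C S S" "r' \<bullet> (s \<bullet> r) \<in> mor C S V"
      using that ob by (meson comp_closed)+
    have 1: "r' \<bullet> ((s' \<bullet> r') \<bullet> (s \<bullet> r)) = r' \<bullet> (s \<bullet> r)"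
      using comp_assoc[of S S V S "s \<bullet> r" r' s'] comp_assoc[of S V S V "r' \<bullet> (s \<bullet> r)" s' r'] that ob c
      by (simp add: ident_comp)
    have 2: "(r' \<bullet> (s \<bullet> r)) \<bullet> s = r' \<bullet> s"
      using comp_assoc[of U S S V s "s \<bullet> r" r'] comp_assoc[of U S U S s r s] that ob c
      by (simp add: comp_ident)
    show ?thesis
      using 1 2 that ob comp_zero_right[of S S V r'] comp_zero_left[of U S V s] by simp
  qed
  have "biproduct C A B S s s' r r'"
    unfolding biproduct_def
    using ob A B sum z zero[of A B r s r' s'] zero[of B A r' s' r s] by simp
  then have "is_direct_sum C A B S" unfolding is_direct_sum_def by blast
  then have "zero_object C A \<or> zero_object C B" using S unfolding indecomposable_def by blast
  then show ?thesis
  proof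
    assume "zero_object C A"
    then have "s = \<zero>\<^bsub>Hom C A S\<^esub>" using zero_object_Hom(1)[of A S] ob A by auto
    then show ?thesis using A ob comp_zero_left[of S A S r] by simp
  next
    assume "zero_object C B"
    then have "s' = \<zero>\<^bsub>Hom C B S\<^esub>" using zero_object_Hom(1)[of B S] ob B by auto
    then have "e' = \<zero>\<^bsub>Hom C S S\<^esub>" using B ob comp_zero_left[of S B S r'] by simp
    then show ?thesis using sum ob e by (simp add: add_zero_right)
  qed
qed

lemma indecomposable_local:
  assumes S: "indecomposable C S" and fg: "f \<in> mor C S S" "g \<in> mor C S S"
    and iso: "is_iso C S S (f \<oplus>\<^bsub>Hom C S S\<^esub> g)"
  shows "is_iso C S S f \<or> is_iso C S S g"
proof -
  have ob: "S \<in> Ob C" using S unfolding indecomposable_def by simp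
  interpret R: ring "endo S" using endo_ring[OF ob] .
  show ?thesis
    using R.finite_ring_sum_unit[of f g] finite_mor[OF ob ob] indecomposable_idempotent[OF S] fg iso
    by (simp add: is_iso_iff_Units)
qed

text \<open>
  Since the endomorphism ring of an indecomposable \<open>S\<close> is local, this is the radical of the
  category evaluated at \<open>(S, X)\<close>: the morphisms that are not split monomorphisms.
\<close>

definition radical where
  "radical S X = {f \<in> mor C S X. \<forall>g \<in> mor C X S. \<not> is_iso C S S (g \<bullet> f)}"

lemma zero_not_iso:
  assumes "S \<in> Ob C" "\<not> zero_object C S"
  shows "\<not> is_iso C S S \<zero>\<^bsub>Hom C S S\<^esub>"
  using assms comp_zero_left[of S S S] zero_object_iff_ident unfolding is_iso_def
  by (metis comp_zero_right)

lemma radical_zero: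
  assumes "indecomposable C S" "X \<in> Ob C"
  shows "\<zero>\<^bsub>Hom C S X\<^esub> \<in> radical S X"
  using assms zero_not_iso[of S] unfolding radical_def indecomposable_def
  by (simp add: zero_mor comp_zero_right[of S X S])

lemma finite_radical: "\<lbrakk>S \<in> Ob C; X \<in> Ob C\<rbrakk> \<Longrightarrow> finite (radical S X)"
  unfolding radical_def using finite_mor by simp

text \<open>
  A morphism into \<open>A \<oplus> B\<close> is radical if and only if both of its components are:
  \<open>g h = (g i)(p h) + (g j)(q h)\<close> is a sum of non-isomorphisms, hence a non-isomorphism
  by \<open>indecomposable_local\<close>.
\<close>

lemma card_radical_direct_sum:
  assumes S: "indecomposable C S" and sum: "is_direct_sum C A B X"
  shows "card (radical S X) = card (radical S A) * card (radical S B)"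
proof -
  obtain i j p q where bi: "biproduct C A B X i j p q"
    using sum unfolding is_direct_sum_def by (elim exE)
  note b' = bi[unfolded biproduct_def]
  have ob: "A \<in> Ob C" "B \<in> Ob C" "X \<in> Ob C" "S \<in> Ob C"
    and m: "i \<in> mor C A X" "j \<in> mor C B X" "p \<in> mor C X A" "q \<in> mor C X B"
    using b' S unfolding indecomposable_def by auto
  let ?F = "\<lambda>h. (p \<bullet> h, q \<bullet> h)"
  have bij: "bij_betw ?F (mor C S X) (mor C S A \<times> mor C S B)"
    using product_pair_bij[OF biproduct_imp_product[OF bi] ob(4)] .
  have iff: "h \<in> radical S X \<longleftrightarrow> p \<bullet> h \<in> radical S A \<and> q \<bullet> h \<in> radical S B" if h: "h \<in> mor C S X" for h
  proof
    have ph: "p \<bullet> h \<in> mor C S A" "q \<bullet> h \<in> mor C S B" using ob m h by (meson comp_closed)+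
    {
      assume r: "h \<in> radical S X"
      have "\<not> is_iso C S S (g \<bullet> (p \<bullet> h))" if g: "g \<in> mor C A S" for g
        using r comp_closed[of X A S p g] comp_assoc[of S X A S h p g] ob m g h unfolding radical_def by auto
      moreover have "\<not> is_iso C S S (g \<bullet> (q \<bullet> h))" if g: "g \<in> mor C B S" for g
        using r comp_closed[of X B S q g] comp_assoc[of S X B S h q g] ob m g h unfolding radical_def by auto
      ultimately show "p \<bullet> h \<in> radical S A \<and> q \<bullet> h \<in> radical S B" using ph unfolding radical_def by simp
    next
      assume r: "p \<bullet> h \<in> radical S A \<and> q \<bullet> h \<in> radical S B"
      have "\<not> is_iso C S S (g \<bullet> h)" if g: "g \<in> mor C X S" for g
      proof
        assume iso: "is_iso C S S (g \<bullet> h)"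
        have gi: "g \<bullet> i \<in> mor C A S" "g \<bullet> j \<in> mor C B S" using ob m g by (meson comp_closed)+
        have ij: "i \<bullet> p \<in> mor C X X" "j \<bullet> q \<in> mor C X X" using ob m by (meson comp_closed)+
        have ijh: "(i \<bullet> p) \<bullet> h \<in> mor C S X" "(j \<bullet> q) \<bullet> h \<in> mor C S X" using ob ij h by (meson comp_closed)+
        have e: "(i \<bullet> p) \<bullet> h = i \<bullet> (p \<bullet> h)" "(j \<bullet> q) \<bullet> h = j \<bullet> (q \<bullet> h)"
          using ob m h comp_assoc[of S X A X h p i] comp_assoc[of S X B X h q j] by auto
        have "h = (i \<bullet> p \<oplus>\<^bsub>Hom C X X\<^esub> j \<bullet> q) \<bullet> h" using b' h ob by (simp add: ident_comp)
        also have "\<dots> = (i \<bullet> p) \<bullet> h \<oplus>\<^bsub>Hom C S X\<^esub> (j \<bullet> q) \<bullet> h"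
          using ob ij h by (intro comp_add_left) auto
        finally have "g \<bullet> h = g \<bullet> (i \<bullet> (p \<bullet> h)) \<oplus>\<^bsub>Hom C S S\<^esub> g \<bullet> (j \<bullet> (q \<bullet> h))"
          using ob g ijh comp_add_right[of S X S "(i \<bullet> p) \<bullet> h" "(j \<bullet> q) \<bullet> h" g] e by simp
        also have "\<dots> = (g \<bullet> i) \<bullet> (p \<bullet> h) \<oplus>\<^bsub>Hom C S S\<^esub> (g \<bullet> j) \<bullet> (q \<bullet> h)"
          using ob g m ph comp_assoc[of S A X S "p \<bullet> h" i g] comp_assoc[of S B X S "q \<bullet> h" j g] by simp
        finally have "is_iso C S S ((g \<bullet> i) \<bullet> (p \<bullet> h)) \<or> is_iso C S S ((g \<bullet> j) \<bullet> (q \<bullet> h))"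
          using iso indecomposable_local[OF S] ob gi ph comp_closed[of S A S "p \<bullet> h" "g \<bullet> i"]
            comp_closed[of S B S "q \<bullet> h" "g \<bullet> j"] by simp
        then show False using r gi unfolding radical_def by blast
      qed
      then show "h \<in> radical S X" using h unfolding radical_def by simp
    }
  qed
  have bij': "bij_betw ?F (radical S X) (radical S A \<times> radical S B)"
  proof (rule bij_betw_subset[OF bij])
    show "radical S X \<subseteq> mor C S X" unfolding radical_def by auto
    show "?F ` radical S X = radical S A \<times> radical S B"
    proof (intro subset_antisym subsetI)
      fix x assume "x \<in> ?F ` radical S X"
      then show "x \<in> radical S A \<times> radical S B" using iff unfolding radical_def by auto
    next
      fix x assume x: "x \<in> radical S A \<times> radical S B"
      then have "x \<in> mor C S A \<times> mor C S B" unfolding radical_def by auto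
      then obtain h where "h \<in> mor C S X" "x = ?F h" using bij unfolding bij_betw_def by blast
      then show "x \<in> ?F ` radical S X" using x iff by auto
    qed
  qed
  show ?thesis using bij_betw_same_card[OF bij'] by (simp add: card_cartesian_product)
qed

text \<open>
  A morphism outside the radical has a left inverse \<open>g'\<close>, so \<open>f g'\<close> is a nonzero
  idempotent of the indecomposable \<open>T\<close>, hence the identity, and \<open>f\<close> is an
  isomorphism.
\<close>

lemma radical_indecomposable:
  assumes S: "indecomposable C S" and T: "indecomposable C T" and ST: "\<not> isomorphic C S T"
  shows "radical S T = mor C S T"
proof (rule ccontr)
  have ob: "S \<in> Ob C" "T \<in> Ob C" using S T unfolding indecomposable_def by auto
  assume "radical S T \<noteq> mor C S T"
  then obtain f g where fg: "f \<in> mor C S T" "g \<in> mor C T S" "is_iso C S S (g \<bullet> f)"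
    unfolding radical_def by blast
  obtain u where u: "u \<in> mor C S S" "u \<bullet> (g \<bullet> f) = Ident C S" using fg(3) unfolding is_iso_def by blast
  define g' where "g' = u \<bullet> g"
  have g': "g' \<in> mor C T S" "g' \<bullet> f = Ident C S"
    unfolding g'_def using ob u fg comp_closed[of T S S g u] comp_assoc[of S T S S f g u] by auto
  have c: "f \<bullet> g' \<in> mor C T T" using ob fg g' by (meson comp_closed)
  have "(f \<bullet> g') \<bullet> (f \<bullet> g') = f \<bullet> g'"
    using ob c fg g' comp_assoc[of T T S T "f \<bullet> g'" g' f] comp_assoc[of T S T S g' f g'] by (simp add: ident_comp)
  then consider "f \<bullet> g' = \<zero>\<^bsub>Hom C T T\<^esub>" | "f \<bullet> g' = Ident C T" using indecomposable_idempotent[OF T c] by blast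
  then show False
  proof cases
    case 1
    have "(f \<bullet> g') \<bullet> f = f" using ob fg g' comp_assoc[of S T S T f g' f] by (simp add: comp_ident)
    then have "f = \<zero>\<^bsub>Hom C S T\<^esub>" using 1 ob fg comp_zero_left[of S T T f] by simp
    then have "Ident C S = \<zero>\<^bsub>Hom C S S\<^esub>" using g' ob comp_zero_right[of S T S g'] by simp
    then show False using S ob zero_object_iff_ident unfolding indecomposable_def by simp
  next
    case 2
    then show False using isomorphicI[OF ob fg(1) g'(1) g'(2)] ST by simp
  qed
qed

lemma card_radical_self:
  assumes "indecomposable C S"
  shows "card (radical S S) < card (mor C S S)"
proof (rule psubset_card_mono)
  have ob: "S \<in> Ob C" using assms unfolding indecomposable_def by simp
  show "finite (mor C S S)" using finite_mor ob by simp
  have "Ident C S \<notin> radical S S"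
    using is_iso_ident[OF ob] ident_closed[OF ob] ident_comp[OF ob ob ident_closed[OF ob]]
    unfolding radical_def by force
  then show "radical S S \<subset> mor C S S" using ident_closed[OF ob] unfolding radical_def by blast
qed

end


section \<open>The monoid of isomorphism classes\<close>

context additive_category
begin

lemma Iso_monoid_simps [simp]:
  "carrier (Iso_monoid C) = Iso C" "X \<otimes>\<^bsub>Iso_monoid C\<^esub> Y = iso_sum C X Y"
  "\<one>\<^bsub>Iso_monoid C\<^esub> = {Z. zero_object C Z}"
  by (simp_all add: Iso_monoid_def)

lemma iso_sum_reps:
  assumes "X \<in> Iso C" "Y \<in> Iso C"
  obtains S where "is_direct_sum C (rep X) (rep Y) S" "iso_sum C X Y = iso_class C S"
proof -
  obtain S where S: "is_direct_sum C (rep X) (rep Y) S"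
    using ex_direct_sum[OF rep_Ob[OF assms(1)] rep_Ob[OF assms(2)]] by (elim exE)
  show ?thesis using that[OF S] iso_sum_class[OF S] assms by (simp add: iso_class_rep)
qed

lemma zero_class_Iso: "{Z. zero_object C Z} \<in> Iso C"
proof -
  obtain Z where Z: "zero_object C Z" using ex_zero_object by (elim exE)
  then have "Z \<in> Ob C" by (simp add: zero_object_def)
  then show ?thesis using zero_object_iso_class[OF Z] iso_class_in_Iso by simp
qed

lemma Iso_comm_monoid: "comm_monoid (Iso_monoid C)"
proof (rule comm_monoidI)
  fix X Y assume "X \<in> carrier (Iso_monoid C)" "Y \<in> carrier (Iso_monoid C)"
  then have XY: "X \<in> Iso C" "Y \<in> Iso C" by simp_all
  obtain S where S: "is_direct_sum C (rep X) (rep Y) S" "iso_sum C X Y = iso_class C S"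
    using iso_sum_reps[OF XY] .
  show "X \<otimes>\<^bsub>Iso_monoid C\<^esub> Y \<in> carrier (Iso_monoid C)"
    using S direct_sum_objects[OF S(1)] by (simp add: iso_class_in_Iso)
  show "X \<otimes>\<^bsub>Iso_monoid C\<^esub> Y = Y \<otimes>\<^bsub>Iso_monoid C\<^esub> X"
    using S iso_sum_class[OF direct_sum_commute[OF S(1)]] XY by (simp add: iso_class_rep)
next
  fix X Y Z assume "X \<in> carrier (Iso_monoid C)" "Y \<in> carrier (Iso_monoid C)" "Z \<in> carrier (Iso_monoid C)"
  then have XYZ: "X \<in> Iso C" "Y \<in> Iso C" "Z \<in> Iso C" by simp_all
  obtain S where S: "is_direct_sum C (rep X) (rep Y) S" "iso_sum C X Y = iso_class C S"
    using iso_sum_reps[OF XYZ(1,2)] .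
  obtain U where U: "is_direct_sum C (rep Y) (rep Z) U" "iso_sum C Y Z = iso_class C U"
    using iso_sum_reps[OF XYZ(2,3)] .
  obtain T where T: "is_direct_sum C S (rep Z) T"
    using ex_direct_sum[of S "rep Z"] direct_sum_objects[OF S(1)] rep_Ob[OF XYZ(3)] by blast
  have "iso_sum C (iso_sum C X Y) Z = iso_class C T"
    using iso_sum_class[OF T] S XYZ by (simp add: iso_class_rep)
  moreover have "iso_sum C X (iso_sum C Y Z) = iso_class C T"
    using iso_sum_class[OF direct_sum_assoc[OF S(1) T U(1)]] U XYZ by (simp add: iso_class_rep)
  ultimately show "X \<otimes>\<^bsub>Iso_monoid C\<^esub> Y \<otimes>\<^bsub>Iso_monoid C\<^esub> Z = X \<otimes>\<^bsub>Iso_monoid C\<^esub> (Y \<otimes>\<^bsub>Iso_monoid C\<^esub> Z)"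
    by simp
next
  show "\<one>\<^bsub>Iso_monoid C\<^esub> \<in> carrier (Iso_monoid C)" using zero_class_Iso by simp
next
  fix X assume "X \<in> carrier (Iso_monoid C)"
  then have X: "X \<in> Iso C" by simp
  obtain Z where Z: "zero_object C Z" using ex_zero_object by (elim exE)
  show "\<one>\<^bsub>Iso_monoid C\<^esub> \<otimes>\<^bsub>Iso_monoid C\<^esub> X = X"
    using iso_sum_class[OF direct_sum_commute[OF direct_sum_zero_right[OF Z rep_Ob[OF X]]]] X
    by (simp add: zero_object_iso_class[OF Z] iso_class_rep)
qed

text \<open>
  If \<open>A'\<close> is isomorphic to \<open>A\<close>, then \<open>A'\<close> is a direct sum of \<open>A\<close>
  and a zero object.
\<close>

lemma sum_multiplicative_iso_invariant:
  fixes f :: "_ \<Rightarrow> 'r::comm_monoid_mult"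
  assumes mult: "\<And>A B S. is_direct_sum C A B S \<Longrightarrow> f S = f A * f B"
    and zero: "\<And>Z. zero_object C Z \<Longrightarrow> f Z = 1"
    and iso: "isomorphic C A A'"
  shows "f A' = f A"
proof -
  obtain Z where Z: "zero_object C Z" using ex_zero_object by (elim exE)
  have "A \<in> Ob C" using iso unfolding isomorphic_def by simp
  then have "is_direct_sum C A Z A'" using direct_sum_iso[OF direct_sum_zero_right[OF Z] iso] by simp
  then show ?thesis using mult zero[OF Z] by simp
qed

lemma sum_multiplicative_classes:
  fixes f :: "_ \<Rightarrow> 'r::comm_monoid_mult"
  assumes mult: "\<And>A B S. is_direct_sum C A B S \<Longrightarrow> f S = f A * f B"
    and zero: "\<And>Z. zero_object C Z \<Longrightarrow> f Z = 1"
  shows "A \<in> Ob C \<Longrightarrow> f (rep (iso_class C A)) = f A"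
    and "\<lbrakk>X \<in> Iso C; Y \<in> Iso C\<rbrakk> \<Longrightarrow> f (rep (iso_sum C X Y)) = f (rep X) * f (rep Y)"
    and "f (rep {Z. zero_object C Z}) = 1"
proof -
  show 1: "f (rep (iso_class C A)) = f A" if "A \<in> Ob C" for A
    using sum_multiplicative_iso_invariant[of f, OF mult zero, of A "rep (iso_class C A)"]
      rep_in[OF iso_class_in_Iso[OF that]] by (simp add: iso_class_def)
  show "f (rep (iso_sum C X Y)) = f (rep X) * f (rep Y)" if XY: "X \<in> Iso C" "Y \<in> Iso C"
  proof -
    obtain S where S: "is_direct_sum C (rep X) (rep Y) S" "iso_sum C X Y = iso_class C S"
      using iso_sum_reps[OF XY] .
    then show ?thesis using 1[of S] direct_sum_objects[OF S(1)] mult[OF S(1)] by simp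
  qed
  show "f (rep {Z. zero_object C Z}) = 1"
    using rep_in[OF zero_class_Iso] zero by simp
qed

end

context krull_schmidt_category
begin

lemma Hom_form_multiplicative:
  fixes T assumes "T \<in> Ob C"
  shows "is_direct_sum C A B S \<Longrightarrow>
      (1 / of_nat (card (mor C S T)) :: rat) = 1 / of_nat (card (mor C A T)) * (1 / of_nat (card (mor C B T)))"
    and "is_direct_sum C A B S \<Longrightarrow>
      (1 / of_nat (card (mor C T S)) :: rat) = 1 / of_nat (card (mor C T A)) * (1 / of_nat (card (mor C T B)))"
    and "zero_object C Z \<Longrightarrow> (1 / of_nat (card (mor C Z T)) :: rat) = 1"
    and "zero_object C Z \<Longrightarrow> (1 / of_nat (card (mor C T Z)) :: rat) = 1"
  using assms by (simp_all add: card_Hom_from_direct_sum card_Hom_to_direct_sum card_Hom_zero_object)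

lemma hom_form_iso_class:
  assumes "A \<in> Ob C" "B \<in> Ob C"
  shows "hom_form C (iso_class C A) (iso_class C B) = 1 / of_nat (card (mor C A B))"
proof -
  have "rep (iso_class C A) \<in> Ob C" "B \<in> Ob C" using assms rep_Ob iso_class_in_Iso by blast+
  then show ?thesis
    using sum_multiplicative_classes(1)[of "\<lambda>X. 1 / of_nat (card (mor C X B)) :: rat" A]
      sum_multiplicative_classes(1)[of "\<lambda>X. 1 / of_nat (card (mor C (rep (iso_class C A)) X)) :: rat" B]
      Hom_form_multiplicative assms
    unfolding hom_form_def by simp
qed

lemma hom_form_bicharacter: "bicharacter (Iso_monoid C) (hom_form C)"
  unfolding bicharacter_def Iso_monoid_simps
proof (intro conjI ballI)
  fix X Y assume XY: "X \<in> Iso C" "Y \<in> Iso C"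
  show "hom_form C X Y \<noteq> 0"
    using card_mor_pos[OF rep_Ob[OF XY(1)] rep_Ob[OF XY(2)]] unfolding hom_form_def by simp
  fix Z assume Z: "Z \<in> Iso C"
  show "hom_form C (iso_sum C X Y) Z = hom_form C X Z * hom_form C Y Z"
    unfolding hom_form_def
    by (rule sum_multiplicative_classes(2)[of "\<lambda>A. 1 / of_nat (card (mor C A (rep Z)))"])
      (use Hom_form_multiplicative XY rep_Ob[OF Z] in auto)
  show "hom_form C X (iso_sum C Y Z) = hom_form C X Y * hom_form C X Z"
    unfolding hom_form_def
    by (rule sum_multiplicative_classes(2)[of "\<lambda>A. 1 / of_nat (card (mor C (rep X) A))"])
      (use Hom_form_multiplicative XY Z rep_Ob[OF XY(1)] in auto)
qed

text \<open>
  This is \<open>d^m\<close>, where \<open>d\<close> is the order of the residue field of the endomorphism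
  ring of \<open>S\<close> and \<open>m\<close> is the multiplicity of \<open>S\<close> as a summand of
  \<open>X\<close>.
\<close>

definition residue_index where
  "residue_index S X = (of_nat (card (mor C S X)) / of_nat (card (radical S X)) :: rat)"

lemma card_radical_pos: "\<lbrakk>indecomposable C S; X \<in> Ob C\<rbrakk> \<Longrightarrow> card (radical S X) > 0"
  using radical_zero finite_radical[of S X] card_gt_0_iff unfolding indecomposable_def by blast

lemma residue_index_multiplicative:
  assumes "indecomposable C S"
  shows "is_direct_sum C A B X \<Longrightarrow> residue_index S X = residue_index S A * residue_index S B"
    and "zero_object C Z \<Longrightarrow> residue_index S Z = 1"
proof -
  have S: "S \<in> Ob C" using assms unfolding indecomposable_def by simp
  show "residue_index S X = residue_index S A * residue_index S B" if "is_direct_sum C A B X"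
    using card_radical_direct_sum[OF assms that] card_Hom_to_direct_sum[OF that S]
    unfolding residue_index_def by simp
  assume Z: "zero_object C Z"
  then have Z': "Z \<in> Ob C" unfolding zero_object_def by simp
  have "radical S Z = mor C S Z"
    using radical_zero[OF assms Z'] zero_object_Hom(2)[OF Z S] unfolding radical_def by auto
  then show "residue_index S Z = 1"
    using card_Hom_zero_object(2)[OF Z S] unfolding residue_index_def by simp
qed

text \<open>
  Induction on the order of the endomorphism ring: if \<open>X = A \<oplus> B\<close>, then
  \<open>|End X| = |End A| |Hom(A, B)| |Hom(B, A)| |End B|\<close>, and both endomorphism rings on the
  right have more than one element.
\<close>

lemma decomposition_exists:
  assumes "X \<in> Ob C"
  shows "\<exists>m. set_mset m \<subseteq> iso_class C ` {X. indecomposable C X} \<and>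
    iso_class C X = mset_prod (Iso_monoid C) m"
  using assms
proof (induction "card (mor C X X)" arbitrary: X rule: less_induct)
  case less
  let ?I = "iso_class C ` {X. indecomposable C X}"
  interpret M: comm_monoid "Iso_monoid C" by (rule Iso_comm_monoid)
  have I: "?I \<subseteq> carrier (Iso_monoid C)" by (auto simp: indecomposable_def iso_class_in_Iso)
  consider "zero_object C X" | "indecomposable C X"
    | A B where "is_direct_sum C A B X" "\<not> zero_object C A" "\<not> zero_object C B"
    using less.prems unfolding indecomposable_def by blast
  then show ?case
  proof cases
    case 1
    then show ?thesis
      using zero_object_iso_class[OF 1] M.mset_prod_empty by (intro exI[of _ "{#}"]) simp
  next
    case 2
    then show ?thesis
      using M.mset_prod_single[of "iso_class C X"] less.prems
      by (intro exI[of _ "{#iso_class C X#}"]) (simp add: iso_class_in_Iso)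
  next
    case 3
    have ob: "A \<in> Ob C" "B \<in> Ob C" using direct_sum_objects[OF 3(1)] by simp_all
    have gt1: "card (mor C Y Y) > 1" if "Y \<in> Ob C" "\<not> zero_object C Y" for Y
    proof -
      have "{Ident C Y, \<zero>\<^bsub>Hom C Y Y\<^esub>} \<subseteq> mor C Y Y" using that zero_mor ident_closed by simp
      moreover have "card {Ident C Y, \<zero>\<^bsub>Hom C Y Y\<^esub>} = 2" using that zero_object_iff_ident by simp
      ultimately show ?thesis 
        using card_mono[OF finite_mor[OF that(1) that(1)], of "{Ident C Y, \<zero>\<^bsub>Hom C Y Y\<^esub>}"] by simp
    qed
    have "card (mor C X X) = card (mor C A A) * card (mor C A B) * (card (mor C B A) * card (mor C B B))"
      using card_Hom_from_direct_sum[OF 3(1) less.prems] card_Hom_to_direct_sum[OF 3(1) ob(1)]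
        card_Hom_to_direct_sum[OF 3(1) ob(2)] by simp
    moreover have "card (mor C A B) \<ge> 1" "card (mor C B A) \<ge> 1" using card_mor_pos ob by (simp_all add: Suc_leI)
    moreover have "card (mor C A A) > 1" "card (mor C B B) > 1" using gt1 ob 3 by simp_all
    moreover have "a < a * b * (c * d)" if "a > 1" "b \<ge> 1" "c \<ge> 1" "d > 1" for a b c d :: nat
    proof -
      have "1 * (1 * d) \<le> b * (c * d)" using that by (intro mult_le_mono) auto
      then have "1 < b * (c * d)" using that by linarith
      then have "a * 1 < a * (b * (c * d))" using that by (intro mult_strict_left_mono) linarith+
      then show ?thesis by (simp add: mult.assoc)
    qed
    ultimately have lt: "card (mor C A A) < card (mor C X X)" "card (mor C B B) < card (mor C X X)"
      by (metis, metis mult.commute)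
    obtain m where m: "set_mset m \<subseteq> ?I" "iso_class C A = mset_prod (Iso_monoid C) m"
      using less.hyps[OF lt(1) ob(1)] by blast
    obtain n where n: "set_mset n \<subseteq> ?I" "iso_class C B = mset_prod (Iso_monoid C) n"
      using less.hyps[OF lt(2) ob(2)] by blast
    have "iso_class C X = mset_prod (Iso_monoid C) (m + n)"
      using M.mset_prod_union[of m n] m n I iso_sum_class[OF 3(1)] by auto
    then show ?thesis using m n by (intro exI[of _ "m + n"]) auto
  qed
qed

text \<open>
  Krull--Schmidt: existence of decompositions is \<open>decomposition_exists\<close>, and uniqueness
  holds because the multiplicity of \<open>S\<close> can be read off from
  \<open>residue_index S\<close>.
\<close>

theorem Iso_free_comm_monoid:
  "free_comm_monoid_on (Iso_monoid C) (iso_class C ` {X. indecomposable C X})"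
proof (rule free_comm_monoid_onI[OF Iso_comm_monoid])
  show "iso_class C ` {X. indecomposable C X} \<subseteq> carrier (Iso_monoid C)"
    by (auto simp: indecomposable_def iso_class_in_Iso)
  show "\<exists>m. set_mset m \<subseteq> iso_class C ` {X. indecomposable C X} \<and> X = mset_prod (Iso_monoid C) m"
    if "X \<in> carrier (Iso_monoid C)" for X
    using decomposition_exists[OF rep_Ob, of X] that by (simp add: iso_class_rep)
  fix X assume "X \<in> iso_class C ` {X. indecomposable C X}"
  then obtain S where S: "indecomposable C S" and X: "X = iso_class C S" by blast
  have ob: "S \<in> Ob C" using S unfolding indecomposable_def by simp
  let ?\<mu> = "\<lambda>Y. residue_index S (rep Y)"
  note rm = residue_index_multiplicative[OF S]
  have mult: "\<And>A. A \<in> Ob C \<Longrightarrow> ?\<mu> (iso_class C A) = residue_index S A"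
      "\<And>X Y. \<lbrakk>X \<in> Iso C; Y \<in> Iso C\<rbrakk> \<Longrightarrow> ?\<mu> (iso_sum C X Y) = ?\<mu> X * ?\<mu> Y"
      "?\<mu> {Z. zero_object C Z} = 1"
    using sum_multiplicative_classes[of "residue_index S"] rm by blast+
  have "?\<mu> X > 1"
    using mult(1)[OF ob] card_radical_self[OF S] card_radical_pos[OF S ob] X unfolding residue_index_def by simp
  moreover have "?\<mu> Y = 1" if "Y \<in> iso_class C ` {X. indecomposable C X}" "Y \<noteq> X" for Y
  proof -
    obtain T where T: "indecomposable C T" and Y: "Y = iso_class C T" using \<open>Y \<in> _\<close> by blast
    have T': "T \<in> Ob C" using T unfolding indecomposable_def by simp
    have "\<not> isomorphic C S T" using \<open>Y \<noteq> X\<close> X Y iso_class_eq_iff[OF ob] by blast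
    then have "radical S T = mor C S T" by (rule radical_indecomposable[OF S T])
    then show ?thesis using mult(1)[OF T'] card_mor_pos[OF ob T'] Y unfolding residue_index_def by simp
  qed
  ultimately show "\<exists>\<mu> :: _ \<Rightarrow> rat. \<mu> \<one>\<^bsub>Iso_monoid C\<^esub> = 1 \<and>
      (\<forall>x \<in> carrier (Iso_monoid C). \<forall>y \<in> carrier (Iso_monoid C). \<mu> (x \<otimes>\<^bsub>Iso_monoid C\<^esub> y) = \<mu> x * \<mu> y) \<and>
      \<mu> X > 1 \<and> (\<forall>t \<in> iso_class C ` {X. indecomposable C X}. t \<noteq> X \<longrightarrow> \<mu> t = 1)"
    using mult(2,3) by (intro exI[of _ ?\<mu>]) simp
qed

end


section \<open>Algebras given by structure constants\<close>

abbreviation coeff :: "('b \<Rightarrow>\<^sub>0 rat) \<Rightarrow> 'b \<Rightarrow> rat" where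
  "coeff \<equiv> Poly_Mapping.lookup"

abbreviation scale :: "rat \<Rightarrow> ('b \<Rightarrow>\<^sub>0 rat) \<Rightarrow> ('b \<Rightarrow>\<^sub>0 rat)" where
  "scale c \<equiv> Poly_Mapping.map ((*) c)"

text \<open>
  The multiplication of \<open>basis_algebra\<close>, on all finitely supported functions, so that it is
  bilinear without any condition on the supports.
\<close>

definition bilinear_mult :: "('b \<Rightarrow> 'b \<Rightarrow> ('b \<Rightarrow>\<^sub>0 rat)) \<Rightarrow> ('b \<Rightarrow>\<^sub>0 rat) \<Rightarrow> ('b \<Rightarrow>\<^sub>0 rat) \<Rightarrow> ('b \<Rightarrow>\<^sub>0 rat)" where
  "bilinear_mult \<mu> f g = (\<Sum>x \<in> Poly_Mapping.keys f. \<Sum>y \<in> Poly_Mapping.keys g.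
     scale (coeff f x * coeff g y) (\<mu> x y))"

lemma basis_algebra_simps [simp]:
  "carrier (basis_algebra I u \<mu>) = {f. Poly_Mapping.keys f \<subseteq> I}"
  "f \<otimes>\<^bsub>basis_algebra I u \<mu>\<^esub> g = bilinear_mult \<mu> f g"
  "\<one>\<^bsub>basis_algebra I u \<mu>\<^esub> = Poly_Mapping.single u 1"
  "\<zero>\<^bsub>basis_algebra I u \<mu>\<^esub> = 0"
  "f \<oplus>\<^bsub>basis_algebra I u \<mu>\<^esub> g = f + g"
  "c \<odot>\<^bsub>basis_algebra I u \<mu>\<^esub> f = scale c f"
  by (simp_all add: basis_algebra_def bilinear_mult_def)

lemma rat_ring_simps [simp]:
  "carrier rat_ring = UNIV" "a \<otimes>\<^bsub>rat_ring\<^esub> b = a * b" "\<one>\<^bsub>rat_ring\<^esub> = 1"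
  "\<zero>\<^bsub>rat_ring\<^esub> = 0" "a \<oplus>\<^bsub>rat_ring\<^esub> b = a + b"
  by (simp_all add: rat_ring_def)

lemma cring_rat_ring: "cring rat_ring"
  by (rule cringI; (rule abelian_groupI comm_monoidI)?)
    (auto simp: algebra_simps intro: exI[of _ "- _"] add.left_inverse)

lemma coeff_scale [simp]: "coeff (scale c f) x = c * coeff f x"
  by (simp add: Poly_Mapping.map.rep_eq when_def)

lemma keys_subset_iff: "Poly_Mapping.keys f \<subseteq> A \<longleftrightarrow> (\<forall>x. coeff f x \<noteq> 0 \<longrightarrow> x \<in> A)"
  by (auto simp: in_keys_iff)

lemma coeff_bilinear_mult:
  assumes "finite A" "finite B" "Poly_Mapping.keys f \<subseteq> A" "Poly_Mapping.keys g \<subseteq> B"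
  shows "coeff (bilinear_mult \<mu> f g) z = (\<Sum>x\<in>A. \<Sum>y\<in>B. coeff f x * coeff g y * coeff (\<mu> x y) z)"
proof -
  have "coeff (bilinear_mult \<mu> f g) z =
      (\<Sum>x\<in>Poly_Mapping.keys f. \<Sum>y\<in>Poly_Mapping.keys g. coeff f x * coeff g y * coeff (\<mu> x y) z)"
    by (simp add: bilinear_mult_def lookup_sum)
  also have "\<dots> = (\<Sum>x\<in>Poly_Mapping.keys f. \<Sum>y\<in>B. coeff f x * coeff g y * coeff (\<mu> x y) z)"
    using assms by (intro sum.cong refl sum.mono_neutral_left) (auto simp: in_keys_iff)
  also have "\<dots> = (\<Sum>x\<in>A. \<Sum>y\<in>B. coeff f x * coeff g y * coeff (\<mu> x y) z)"
    using assms by (intro sum.mono_neutral_left) (auto simp: in_keys_iff)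
  finally show ?thesis .
qed

lemma bilinear_mult_add_left: "bilinear_mult \<mu> (f + f') g = bilinear_mult \<mu> f g + bilinear_mult \<mu> f' g"
proof (rule poly_mapping_eqI)
  fix z
  let ?A = "Poly_Mapping.keys f \<union> Poly_Mapping.keys f'" and ?B = "Poly_Mapping.keys g"
  have "Poly_Mapping.keys (f + f') \<subseteq> ?A" by (rule keys_add)
  then show "coeff (bilinear_mult \<mu> (f + f') g) z = coeff (bilinear_mult \<mu> f g + bilinear_mult \<mu> f' g) z"
    by (simp add: coeff_bilinear_mult[of ?A ?B] lookup_add algebra_simps sum.distrib)
qed

lemma bilinear_mult_add_right: "bilinear_mult \<mu> g (f + f') = bilinear_mult \<mu> g f + bilinear_mult \<mu> g f'"
proof (rule poly_mapping_eqI)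
  fix z
  let ?A = "Poly_Mapping.keys f \<union> Poly_Mapping.keys f'" and ?B = "Poly_Mapping.keys g"
  have "Poly_Mapping.keys (f + f') \<subseteq> ?A" by (rule keys_add)
  then show "coeff (bilinear_mult \<mu> g (f + f')) z = coeff (bilinear_mult \<mu> g f + bilinear_mult \<mu> g f') z"
    by (simp add: coeff_bilinear_mult[of ?B ?A] lookup_add algebra_simps sum.distrib)
qed

lemma keys_scale_subset: "Poly_Mapping.keys (scale c f) \<subseteq> Poly_Mapping.keys f"
  by (auto simp: in_keys_iff)

lemma bilinear_mult_scale:
  "bilinear_mult \<mu> (scale c f) g = scale c (bilinear_mult \<mu> f g)"
  "bilinear_mult \<mu> f (scale c g) = scale c (bilinear_mult \<mu> f g)"
proof -
  let ?A = "Poly_Mapping.keys f" and ?B = "Poly_Mapping.keys g"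
  show "bilinear_mult \<mu> (scale c f) g = scale c (bilinear_mult \<mu> f g)"
    using keys_scale_subset[of c f]
    by (intro poly_mapping_eqI) (simp add: coeff_bilinear_mult[of ?A ?B] sum_distrib_left ac_simps)
  show "bilinear_mult \<mu> f (scale c g) = scale c (bilinear_mult \<mu> f g)"
    using keys_scale_subset[of c g]
    by (intro poly_mapping_eqI) (simp add: coeff_bilinear_mult[of ?A ?B] sum_distrib_left ac_simps)
qed

lemma bilinear_mult_zero [simp]: "bilinear_mult \<mu> 0 g = 0" "bilinear_mult \<mu> g 0 = 0"
  by (simp_all add: bilinear_mult_def)

lemma bilinear_mult_sum:
  "bilinear_mult \<mu> (sum F A) g = (\<Sum>a\<in>A. bilinear_mult \<mu> (F a) g)"
  "bilinear_mult \<mu> g (sum F A) = (\<Sum>a\<in>A. bilinear_mult \<mu> g (F a))"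
  by (induction A rule: infinite_finite_induct) (simp_all add: bilinear_mult_add_left bilinear_mult_add_right)

lemma bilinear_mult_single:
  "bilinear_mult \<mu> (Poly_Mapping.single x a) (Poly_Mapping.single y b) = scale (a * b) (\<mu> x y)"
  by (rule poly_mapping_eqI) (simp add: coeff_bilinear_mult[of "{x}" "{y}"])

lemma sum_of_singles: "f = (\<Sum>x\<in>Poly_Mapping.keys f. Poly_Mapping.single x (coeff f x))"
proof (rule poly_mapping_eqI)
  fix z
  show "coeff f z = coeff (\<Sum>x\<in>Poly_Mapping.keys f. Poly_Mapping.single x (coeff f x)) z"
    by (simp add: lookup_sum lookup_single when_def in_keys_iff)
qed

lemma keys_bilinear_mult:
  assumes "\<And>x y. \<lbrakk>x \<in> Poly_Mapping.keys f; y \<in> Poly_Mapping.keys g\<rbrakk> \<Longrightarrow> Poly_Mapping.keys (\<mu> x y) \<subseteq> I"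
  shows "Poly_Mapping.keys (bilinear_mult \<mu> f g) \<subseteq> I"
proof (rule ccontr)
  assume "\<not> ?thesis"
  then obtain z where z: "coeff (bilinear_mult \<mu> f g) z \<noteq> 0" "z \<notin> I" by (auto simp: in_keys_iff)
  have "coeff f x * coeff g y * coeff (\<mu> x y) z = 0"
    if "x \<in> Poly_Mapping.keys f" "y \<in> Poly_Mapping.keys g" for x y
    using assms[OF that] z(2) by (auto simp: in_keys_iff)
  then have "coeff (bilinear_mult \<mu> f g) z = 0"
    unfolding coeff_bilinear_mult[OF finite_keys finite_keys subset_refl subset_refl]
    by (intro sum.neutral ballI)
  then show False using z by simp
qed

lemma bilinear_mult_cong:
  assumes "\<And>x y. \<lbrakk>x \<in> Poly_Mapping.keys f; y \<in> Poly_Mapping.keys g\<rbrakk> \<Longrightarrow> \<mu> x y = \<mu>' x y"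
  shows "bilinear_mult \<mu> f g = bilinear_mult \<mu>' f g"
  using assms unfolding bilinear_mult_def by simp

lemma keys_add_subset:
  "\<lbrakk>Poly_Mapping.keys f \<subseteq> I; Poly_Mapping.keys g \<subseteq> I\<rbrakk> \<Longrightarrow> Poly_Mapping.keys (f + g) \<subseteq> I"
  using keys_add[of f g] by blast

lemma basis_algebra_abelian_group: "abelian_group (basis_algebra I u \<mu>)"
proof (rule abelian_groupI)
  fix f assume "f \<in> carrier (basis_algebra I u \<mu>)"
  then show "\<exists>g \<in> carrier (basis_algebra I u \<mu>). g \<oplus>\<^bsub>basis_algebra I u \<mu>\<^esub> f = \<zero>\<^bsub>basis_algebra I u \<mu>\<^esub>"
    by (intro bexI[of _ "- f"]) auto
qed (auto simp: ac_simps intro: keys_add_subset[THEN subsetD])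

lemma basis_algebra_module: "module rat_ring (basis_algebra I u \<mu>)"
proof (rule moduleI[OF cring_rat_ring basis_algebra_abelian_group])
  fix c f assume "f \<in> carrier (basis_algebra I u \<mu>)"
  then show "c \<odot>\<^bsub>basis_algebra I u \<mu>\<^esub> f \<in> carrier (basis_algebra I u \<mu>)"
    using keys_scale_subset[of c f] by auto
qed (auto intro!: poly_mapping_eqI simp: lookup_add algebra_simps)

lemma basis_algebra_minus:
  assumes "f \<in> carrier (basis_algebra I u \<mu>)"
  shows "\<ominus>\<^bsub>basis_algebra I u \<mu>\<^esub> f = - f"
proof -
  interpret abelian_group "basis_algebra I u \<mu>" by (rule basis_algebra_abelian_group)
  show ?thesis using assms by (intro minus_equality) auto
qed

lemma basis_algebra_iso_cong:
  assumes "\<And>x y. \<lbrakk>x \<in> I; y \<in> I\<rbrakk> \<Longrightarrow> \<mu> x y = \<mu>' x y"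
  shows "(\<lambda>f. f) \<in> algebra_iso rat_ring (basis_algebra I u \<mu>) (basis_algebra I u \<mu>')"
proof -
  have "bilinear_mult \<mu> f g = bilinear_mult \<mu>' f g"
    if "Poly_Mapping.keys f \<subseteq> I" "Poly_Mapping.keys g \<subseteq> I" for f g
    using assms that by (intro bilinear_mult_cong) blast
  then show ?thesis unfolding algebra_iso_def ring_iso_def ring_hom_def by (auto simp: bij_betw_def)
qed

text \<open>
  Associativity needs to be checked on basis elements only. There it is the cocycle identity
  \<open>\<chi> x y * \<chi> (x y) z = \<chi> y z * \<chi> x (y z)\<close>, whose two sides are the product
  of the three values of \<open>\<chi>\<close> on pairs by bimultiplicativity. Likewise \<open>\<chi> 1 x\<close>
  equals its own square, hence is 1.
\<close>

theorem twisted_monoid_algebra_unital: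
  fixes G :: "'b monoid" (structure)
  assumes G: "comm_monoid G" and \<chi>: "bicharacter G \<chi>"
    and \<mu>: "\<And>x y. \<lbrakk>x \<in> carrier G; y \<in> carrier G\<rbrakk> \<Longrightarrow> \<mu> x y = Poly_Mapping.single (x \<otimes> y) (\<chi> x y)"
  shows "unital_algebra rat_ring (basis_algebra (carrier G) \<one> \<mu>)" (is "unital_algebra _ ?A")
proof -
  interpret G: comm_monoid G by (rule G)
  let ?s = "Poly_Mapping.single"
  have closed: "Poly_Mapping.keys (bilinear_mult \<mu> f g) \<subseteq> carrier G"
    if fg: "Poly_Mapping.keys f \<subseteq> carrier G" "Poly_Mapping.keys g \<subseteq> carrier G" for f g
  proof (rule keys_bilinear_mult)
    fix x y assume "x \<in> Poly_Mapping.keys f" "y \<in> Poly_Mapping.keys g"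
    then have xy: "x \<in> carrier G" "y \<in> carrier G" using fg by auto
    then show "Poly_Mapping.keys (\<mu> x y) \<subseteq> carrier G" using \<mu>[OF xy] by simp
  qed
  have single: "bilinear_mult \<mu> (?s x a) (?s y b) = ?s (x \<otimes> y) (a * b * \<chi> x y)"
    if "x \<in> carrier G" "y \<in> carrier G" for x y a b
    using \<mu>[OF that] by (simp add: bilinear_mult_single)
  have one: "\<chi> \<one> x = 1" "\<chi> x \<one> = 1" if x: "x \<in> carrier G" for x
  proof -
    have "\<chi> (\<one> \<otimes> \<one>) x = \<chi> \<one> x * \<chi> \<one> x" "\<chi> x (\<one> \<otimes> \<one>) = \<chi> x \<one> * \<chi> x \<one>"
      "\<chi> \<one> x \<noteq> 0" "\<chi> x \<one> \<noteq> 0"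
      using \<chi> x G.one_closed unfolding bicharacter_def by blast+
    then show "\<chi> \<one> x = 1" "\<chi> x \<one> = 1" by auto
  qed
  have assoc: "bilinear_mult \<mu> (bilinear_mult \<mu> f g) h = bilinear_mult \<mu> f (bilinear_mult \<mu> g h)"
    if f: "Poly_Mapping.keys f \<subseteq> carrier G" and g: "Poly_Mapping.keys g \<subseteq> carrier G"
      and h: "Poly_Mapping.keys h \<subseteq> carrier G" for f g h
  proof -
    let ?f = "\<lambda>x. ?s x (coeff f x)" and ?g = "\<lambda>x. ?s x (coeff g x)" and ?h = "\<lambda>x. ?s x (coeff h x)"
    let ?F = "Poly_Mapping.keys f" and ?G = "Poly_Mapping.keys g" and ?H = "Poly_Mapping.keys h"
    have "bilinear_mult \<mu> (bilinear_mult \<mu> f g) h =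
        bilinear_mult \<mu> (bilinear_mult \<mu> (sum ?f ?F) (sum ?g ?G)) (sum ?h ?H)"
      by (simp flip: sum_of_singles)
    also have "\<dots> = (\<Sum>z\<in>?H. \<Sum>y\<in>?G. \<Sum>x\<in>?F. bilinear_mult \<mu> (bilinear_mult \<mu> (?f x) (?g y)) (?h z))"
      by (simp only: bilinear_mult_sum)
    also have "\<dots> = (\<Sum>z\<in>?H. \<Sum>y\<in>?G. \<Sum>x\<in>?F. bilinear_mult \<mu> (?f x) (bilinear_mult \<mu> (?g y) (?h z)))"
    proof (intro sum.cong refl)
      fix x y z assume "z \<in> ?H" "y \<in> ?G" "x \<in> ?F"
      then have c: "x \<in> carrier G" "y \<in> carrier G" "z \<in> carrier G" using f g h by auto
      have "\<chi> (x \<otimes> y) z = \<chi> x z * \<chi> y z" "\<chi> x (y \<otimes> z) = \<chi> x y * \<chi> x z"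
        using \<chi> c unfolding bicharacter_def by blast+
      then show "bilinear_mult \<mu> (bilinear_mult \<mu> (?f x) (?g y)) (?h z) =
          bilinear_mult \<mu> (?f x) (bilinear_mult \<mu> (?g y) (?h z))"
        using c by (simp add: single G.m_assoc ac_simps)
    qed
    also have "\<dots> = bilinear_mult \<mu> (sum ?f ?F) (bilinear_mult \<mu> (sum ?g ?G) (sum ?h ?H))"
      by (simp only: bilinear_mult_sum)
    also have "\<dots> = bilinear_mult \<mu> f (bilinear_mult \<mu> g h)"
      by (simp flip: sum_of_singles)
    finally show ?thesis .
  qed
  have unit: "bilinear_mult \<mu> (?s \<one> 1) f = f" "bilinear_mult \<mu> f (?s \<one> 1) = f"
    if f: "Poly_Mapping.keys f \<subseteq> carrier G" for f
  proof -
    let ?f = "\<lambda>x. ?s x (coeff f x)"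
    have "bilinear_mult \<mu> (?s \<one> 1) (sum ?f (Poly_Mapping.keys f)) = sum ?f (Poly_Mapping.keys f)"
      unfolding bilinear_mult_sum using f by (intro sum.cong) (auto simp: single one)
    then show "bilinear_mult \<mu> (?s \<one> 1) f = f" by (simp flip: sum_of_singles)
    have "bilinear_mult \<mu> (sum ?f (Poly_Mapping.keys f)) (?s \<one> 1) = sum ?f (Poly_Mapping.keys f)"
      unfolding bilinear_mult_sum using f by (intro sum.cong) (auto simp: single one)
    then show "bilinear_mult \<mu> f (?s \<one> 1) = f" by (simp flip: sum_of_singles)
  qed
  have "ring ?A"
  proof (rule ringI[OF basis_algebra_abelian_group])
    show "monoid ?A"
      by (rule monoidI) (use closed assoc unit in auto)
  qed (simp_all add: bilinear_mult_add_left bilinear_mult_add_right)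
  then show ?thesis
    unfolding unital_algebra_def using basis_algebra_module by (auto simp: bilinear_mult_scale)
qed


section \<open>The associated graded algebra of a weight filtration\<close>

text \<open>
  An algebra with a weighted basis such that no product of basis elements has terms of weight above
  the sum of the weights, so that the span of the elements of bounded weight is a filtration.
\<close>

locale weighted_basis =
  fixes I :: "'b set" and u :: 'b and \<mu> :: "'b \<Rightarrow> 'b \<Rightarrow> ('b \<Rightarrow>\<^sub>0 rat)" and w :: "'b \<Rightarrow> nat"
  assumes unit: "u \<in> I" "w u = 0"
    and weight: "\<lbrakk>x \<in> I; y \<in> I\<rbrakk> \<Longrightarrow> Poly_Mapping.keys (\<mu> x y) \<subseteq> {z \<in> I. w z \<le> w x + w y}"
begin

abbreviation A :: "(rat, 'b \<Rightarrow>\<^sub>0 rat) module" where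
  "A \<equiv> basis_algebra I u \<mu>"

definition F :: "nat \<Rightarrow> ('b \<Rightarrow>\<^sub>0 rat) set" where
  "F n = {f. Poly_Mapping.keys f \<subseteq> {z \<in> I. w z \<le> n}}"

lemma F_iff: "f \<in> F n \<longleftrightarrow> (\<forall>z. coeff f z \<noteq> 0 \<longrightarrow> z \<in> I \<and> w z \<le> n)"
  unfolding F_def by (auto simp: in_keys_iff)

lemma F_add: "\<lbrakk>f \<in> F n; g \<in> F n\<rbrakk> \<Longrightarrow> f + g \<in> F n"
  unfolding F_def mem_Collect_eq by (rule keys_add_subset)

lemma F_mult:
  assumes "f \<in> F m" "g \<in> F n"
  shows "bilinear_mult \<mu> f g \<in> F (m + n)"
  unfolding F_def
proof (rule CollectI, rule keys_bilinear_mult)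
  fix x y assume "x \<in> Poly_Mapping.keys f" "y \<in> Poly_Mapping.keys g"
  then have "x \<in> I" "y \<in> I" "w x + w y \<le> m + n" using assms unfolding F_def by (auto intro: add_mono)
  then show "Poly_Mapping.keys (\<mu> x y) \<subseteq> {z \<in> I. w z \<le> m + n}" using weight[of x y] by fastforce
qed

theorem weight_algebra_filtration: "algebra_filtration rat_ring A F"
  unfolding algebra_filtration_def
proof (intro conjI allI impI ballI)
  interpret module rat_ring A by (rule basis_algebra_module)
  fix n
  show "submodule (F n) rat_ring A"
  proof (rule submoduleI)
    show sub: "F n \<subseteq> carrier A" by (auto simp: F_def)
    show "\<ominus>\<^bsub>A\<^esub> f \<in> F n" if "f \<in> F n" for f
    proof -
      have "\<ominus>\<^bsub>A\<^esub> f = - f" by (rule basis_algebra_minus[OF subsetD[OF sub that]])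
      then show ?thesis using that by (simp add: F_iff)
    qed
    show "f \<oplus>\<^bsub>A\<^esub> g \<in> F n" if "f \<in> F n" "g \<in> F n" for f g
      using F_add[OF that] by simp
    show "\<zero>\<^bsub>A\<^esub> \<in> F n" by (simp add: F_iff)
    show "c \<odot>\<^bsub>A\<^esub> f \<in> F n" if "f \<in> F n" for c f
      using that by (simp add: F_iff)
  qed
next
  show "F m \<subseteq> F n" if "m \<le> n" for m n using that by (force simp: F_iff)
  show "(\<Union>n. F n) = carrier A"
  proof
    show "carrier A \<subseteq> (\<Union>n. F n)"
    proof
      fix f assume f: "f \<in> carrier A"
      have "w z \<le> Max (w ` Poly_Mapping.keys f)" if "z \<in> Poly_Mapping.keys f" for z
        using that by (intro Max_ge) auto
      then have "f \<in> F (Max (w ` Poly_Mapping.keys f))" using f unfolding F_def by auto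
      then show "f \<in> (\<Union>n. F n)" by blast
    qed
  qed (auto simp: F_def)
  show "\<one>\<^bsub>A\<^esub> \<in> F 0" using unit by (simp add: F_def)
  show "f \<otimes>\<^bsub>A\<^esub> g \<in> F (m + n)" if "f \<in> F m" "g \<in> F n" for m n f g
    using F_mult[OF that] by simp
qed

text \<open>
  The coset of \<open>f\<close> modulo the span of the basis elements of weight below \<open>n\<close> (see
  \<open>coset_eq\<close>), described by coefficients. Defined for every \<open>f\<close>, it depends only
  on the coefficients in weight exactly \<open>n\<close>, which makes it the degree \<open>n\<close>
  component of the isomorphism \<open>associated_graded_iso\<close>.
\<close>

definition leading_class :: "nat \<Rightarrow> ('b \<Rightarrow>\<^sub>0 rat) \<Rightarrow> ('b \<Rightarrow>\<^sub>0 rat) set" where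
  "leading_class n f = {g \<in> F n. \<forall>z. w z = n \<longrightarrow> coeff g z = coeff f z}"

definition part :: "nat \<Rightarrow> ('b \<Rightarrow>\<^sub>0 rat) \<Rightarrow> ('b \<Rightarrow>\<^sub>0 rat)" where
  "part n f = (\<Sum>x \<in> {x \<in> Poly_Mapping.keys f. w x = n}. Poly_Mapping.single x (coeff f x))"

lemma coeff_part [simp]: "coeff (part n f) z = (if w z = n then coeff f z else 0)"
  by (auto simp: part_def lookup_sum lookup_single when_def in_keys_iff)

lemma part_in: "f \<in> carrier A \<Longrightarrow> part n f \<in> F n" "f \<in> carrier A \<Longrightarrow> part n f \<in> leading_class n f"
  by (auto simp: F_iff leading_class_def keys_subset_iff)

lemma leading_class_eq_iff:
  assumes "f \<in> carrier A"
  shows "leading_class n f = leading_class n g \<longleftrightarrow> (\<forall>z. w z = n \<longrightarrow> coeff f z = coeff g z)"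
proof
  assume "leading_class n f = leading_class n g"
  then have "part n f \<in> leading_class n g" using part_in(2)[OF assms, of n] by simp
  then have g: "coeff (part n f) z = coeff g z" if "w z = n" for z
    using that by (simp add: leading_class_def)
  show "\<forall>z. w z = n \<longrightarrow> coeff f z = coeff g z"
  proof (intro allI impI)
    fix z assume "w z = n"
    then show "coeff f z = coeff g z" using g[of z] by simp
  qed
qed (simp add: leading_class_def)

lemma F_carrier: "f \<in> F n \<Longrightarrow> f \<in> carrier A"
  by (auto simp: F_def)

lemma F_diff: "\<lbrakk>f \<in> F n; g \<in> F n\<rbrakk> \<Longrightarrow> f - g \<in> F n"
  using F_add[of f n "- g"] by (simp add: F_iff)

text \<open>
  In degree 0 both sides are \<open>{0}\<close> because weights are natural numbers.
\<close>

lemma filtration_pred_eq: "filtration_pred A F n = leading_class n 0"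
proof (cases n)
  case 0
  have "f = 0" if "f \<in> leading_class 0 0" for f
    using that by (intro poly_mapping_eqI) (auto simp: leading_class_def F_iff)
  then show ?thesis using 0 by (auto simp: filtration_pred_def leading_class_def F_iff)
next
  case (Suc m)
  have "f \<in> F m \<longleftrightarrow> f \<in> leading_class n 0" for f
    unfolding leading_class_def F_iff Suc by (auto simp: le_Suc_eq)
  then show ?thesis using Suc by (auto simp: filtration_pred_def)
qed

lemma coset_eq:
  assumes "f \<in> F n"
  shows "filtration_pred A F n +>\<^bsub>A\<^esub> f = leading_class n f"
proof -
  have "filtration_pred A F n +>\<^bsub>A\<^esub> f = (\<lambda>g. g + f) ` leading_class n 0"
    by (auto simp: filtration_pred_eq a_r_coset_def r_coset_def)
  also have "\<dots> = leading_class n f"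
  proof
    show "(\<lambda>g. g + f) ` leading_class n 0 \<subseteq> leading_class n f"
      using assms by (auto simp: leading_class_def lookup_add F_add)
    show "leading_class n f \<subseteq> (\<lambda>g. g + f) ` leading_class n 0"
    proof
      fix g assume "g \<in> leading_class n f"
      then have "g - f \<in> leading_class n 0" using assms by (auto simp: leading_class_def lookup_minus F_diff)
      then show "g \<in> (\<lambda>g. g + f) ` leading_class n 0" by (rule image_eqI[rotated]) simp
    qed
  qed
  finally show ?thesis .
qed

abbreviation gr_part :: "nat \<Rightarrow> ('b \<Rightarrow>\<^sub>0 rat) set monoid" where
  "gr_part n \<equiv> graded_part A F n"

lemma one_graded_part: "\<one>\<^bsub>gr_part n\<^esub> = leading_class n 0"
  by (simp add: graded_part_def A_FactGroup_def FactGroup_def filtration_pred_eq)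

lemma carrier_graded_part: "carrier (gr_part n) = leading_class n ` carrier A"
proof -
  have "carrier (gr_part n) = (\<lambda>f. filtration_pred A F n +>\<^bsub>A\<^esub> f) ` F n"
    by (auto simp: graded_part_def A_FactGroup_def FactGroup_def RCOSETS_def a_r_coset_def r_coset_def)
  also have "\<dots> = leading_class n ` F n" using coset_eq by simp
  also have "\<dots> = leading_class n ` carrier A"
  proof
    show "leading_class n ` F n \<subseteq> leading_class n ` carrier A" using F_carrier by blast
    show "leading_class n ` carrier A \<subseteq> leading_class n ` F n"
    proof
      fix X assume "X \<in> leading_class n ` carrier A"
      then obtain f where f: "f \<in> carrier A" "X = leading_class n f" by blast
      then have "X = leading_class n (part n f)"
        using leading_class_eq_iff[OF f(1), of n "part n f"] by simp
      then show "X \<in> leading_class n ` F n" using part_in(1)[OF f(1)] by blast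
    qed
  qed
  finally show ?thesis .
qed

lemma mult_graded_part:
  assumes f: "f \<in> carrier A" and g: "g \<in> carrier A"
  shows "leading_class n f \<otimes>\<^bsub>gr_part n\<^esub> leading_class n g = leading_class n (f + g)"
proof -
  have "leading_class n f \<otimes>\<^bsub>gr_part n\<^esub> leading_class n g =
      {h + k | h k. h \<in> leading_class n f \<and> k \<in> leading_class n g}"
    by (auto simp: graded_part_def A_FactGroup_def FactGroup_def set_mult_def)
  also have "\<dots> = leading_class n (f + g)"
  proof (intro subset_antisym subsetI)
    fix x assume "x \<in> {h + k | h k. h \<in> leading_class n f \<and> k \<in> leading_class n g}"
    then show "x \<in> leading_class n (f + g)" by (auto simp: leading_class_def lookup_add F_add)
  next
    fix x assume x: "x \<in> leading_class n (f + g)"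
    have "part n f \<in> leading_class n f" using part_in(2)[OF f] .
    moreover have "x - part n f \<in> leading_class n g"
      using x part_in(1)[OF f, of n] by (auto simp: leading_class_def lookup_add lookup_minus F_diff)
    moreover have "x = part n f + (x - part n f)" by simp
    ultimately show "x \<in> {h + k | h k. h \<in> leading_class n f \<and> k \<in> leading_class n g}" by blast
  qed
  finally show ?thesis .
qed

lemma carrier_A_add: "\<lbrakk>f \<in> carrier A; g \<in> carrier A\<rbrakk> \<Longrightarrow> f + g \<in> carrier A"
  using keys_add_subset[of f I g] by simp

lemma graded_part_comm_monoid: "comm_monoid (gr_part n)"
proof -
  have zero: "0 \<in> carrier A" by simp
  show ?thesis
    by (rule comm_monoidI)
      (auto simp: carrier_graded_part one_graded_part mult_graded_part carrier_A_add zero ac_simps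
        simp del: basis_algebra_simps(1))
qed

lemma finprod_graded_part:
  assumes "finite J" "\<And>i. i \<in> J \<Longrightarrow> h i \<in> carrier A"
  shows "sum h J \<in> carrier A \<and> finprod (gr_part n) (\<lambda>i. leading_class n (h i)) J = leading_class n (sum h J)"
proof -
  interpret comm_monoid "gr_part n" by (rule graded_part_comm_monoid)
  show ?thesis
    using assms
  proof (induction J rule: finite_induct)
    case empty
    then show ?case by (simp add: one_graded_part)
  next
    case (insert i J)
    then have IH: "sum h J \<in> carrier A" "h i \<in> carrier A"
        "finprod (gr_part n) (\<lambda>i. leading_class n (h i)) J = leading_class n (sum h J)" by auto
    have "(\<lambda>i. leading_class n (h i)) \<in> J \<rightarrow> carrier (gr_part n)" "leading_class n (h i) \<in> carrier (gr_part n)"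
      using insert.prems unfolding carrier_graded_part by blast+
    then have "finprod (gr_part n) (\<lambda>i. leading_class n (h i)) (insert i J) =
        leading_class n (h i) \<otimes>\<^bsub>gr_part n\<^esub> leading_class n (sum h J)"
      using insert.hyps IH(3) by simp
    also have "\<dots> = leading_class n (h i + sum h J)" using IH by (intro mult_graded_part)
    finally show ?case using insert.hyps carrier_A_add[OF IH(2,1)] by simp
  qed
qed

text \<open>
  A pair of basis elements contributes to weight \<open>i + j\<close> only if its weights are exactly
  \<open>i\<close> and \<open>j\<close>: otherwise their sum is smaller, and products do not raise weights.
\<close>

lemma leading_coeff_mult:
  assumes f: "f \<in> F i" and g: "g \<in> F j" and z: "w z = i + j"
  shows "coeff (bilinear_mult \<mu> f g) z = coeff (bilinear_mult \<mu> (part i f) (part j g)) z"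
proof -
  let ?X = "Poly_Mapping.keys f" and ?Y = "Poly_Mapping.keys g"
  have eq: "coeff f x * coeff g y * coeff (\<mu> x y) z =
      coeff (part i f) x * coeff (part j g) y * coeff (\<mu> x y) z" if "x \<in> ?X" "y \<in> ?Y" for x y
  proof (cases "w x = i \<and> w y = j")
    case False
    have "x \<in> I" "y \<in> I" "w x \<le> i" "w y \<le> j" using f g that unfolding F_def by auto
    then have "coeff (\<mu> x y) z = 0" using weight[of x y] z False by (force simp: keys_subset_iff)
    then show ?thesis by simp
  qed auto
  have sub: "Poly_Mapping.keys (part i f) \<subseteq> ?X" "Poly_Mapping.keys (part j g) \<subseteq> ?Y"
    by (auto simp: in_keys_iff split: if_splits)
  have "coeff (bilinear_mult \<mu> f g) z = (\<Sum>x\<in>?X. \<Sum>y\<in>?Y. coeff f x * coeff g y * coeff (\<mu> x y) z)"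
    by (simp add: coeff_bilinear_mult[of ?X ?Y])
  also have "\<dots> = (\<Sum>x\<in>?X. \<Sum>y\<in>?Y. coeff (part i f) x * coeff (part j g) y * coeff (\<mu> x y) z)"
    by (intro sum.cong refl eq)
  also have "\<dots> = coeff (bilinear_mult \<mu> (part i f) (part j g)) z"
    by (rule coeff_bilinear_mult[symmetric]) (simp_all add: sub)
  finally show ?thesis .
qed

lemma rcoset_mult_leading_class:
  assumes f: "f \<in> carrier A" and g: "g \<in> carrier A"
  shows "rcoset_mult A (filtration_pred A F (i + j)) (leading_class i f) (leading_class j g) =
    leading_class (i + j) (bilinear_mult \<mu> (part i f) (part j g))"
proof -
  have "filtration_pred A F (i + j) +>\<^bsub>A\<^esub> (a \<otimes>\<^bsub>A\<^esub> b) = leading_class (i + j) (bilinear_mult \<mu> (part i f) (part j g))"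
    if a: "a \<in> leading_class i f" and b: "b \<in> leading_class j g" for a b
  proof -
    have ab: "a \<in> F i" "b \<in> F j" using a b by (auto simp: leading_class_def)
    have "part i a = part i f" "part j b = part j g"
      using a b by (auto intro!: poly_mapping_eqI simp: leading_class_def)
    then have "leading_class (i + j) (bilinear_mult \<mu> a b) = leading_class (i + j) (bilinear_mult \<mu> (part i f) (part j g))"
      using leading_coeff_mult[OF ab] F_mult[OF ab] F_mult[OF part_in(1)[OF f] part_in(1)[OF g], of i j]
      by (subst leading_class_eq_iff[OF F_carrier]) auto
    then show ?thesis using coset_eq[OF F_mult[OF ab]] by simp
  qed
  then show ?thesis
    using part_in(2)[OF f, of i] part_in(2)[OF g, of j] unfolding rcoset_mult_def by blast
qed

text \<open>
  The structure constants \<open>\<mu>'\<close> are obtained from \<open>\<mu>\<close> by dropping all terms of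
  weight less than the maximal one.
\<close>

definition leading_coefficients :: "('b \<Rightarrow> 'b \<Rightarrow> ('b \<Rightarrow>\<^sub>0 rat)) \<Rightarrow> bool" where
  "leading_coefficients \<mu>' \<longleftrightarrow> (\<forall>x \<in> I. \<forall>y \<in> I. \<mu>' x y = part (w x + w y) (\<mu> x y))"

abbreviation gr :: "(rat, nat \<Rightarrow> ('b \<Rightarrow>\<^sub>0 rat) set) module" where
  "gr \<equiv> associated_graded A F"

text \<open>
  The sum over the pairs of degrees \<open>i\<close> and \<open>n - i\<close> collects the pairs of basis
  elements \<open>x\<close>, \<open>y\<close> with \<open>w x + w y = n\<close>, and these are the pairs whose
  product under \<open>\<mu>'\<close> has terms of weight \<open>n\<close>.
\<close>

lemma graded_mult:
  assumes \<mu>': "leading_coefficients \<mu>'" and f: "f \<in> carrier A" and g: "g \<in> carrier A"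
  shows "leading_class n (bilinear_mult \<mu>' f g) = finprod (gr_part n)
    (\<lambda>i. rcoset_mult A (filtration_pred A F n) (leading_class i f) (leading_class (n - i) g)) {..n}"
proof -
  interpret comm_monoid "gr_part n" by (rule graded_part_comm_monoid)
  let ?h = "\<lambda>i. bilinear_mult \<mu> (part i f) (part (n - i) g)"
  have h: "?h i \<in> carrier A" if "i \<in> {..n}" for i
    using F_carrier[OF F_mult[OF part_in(1)[OF f] part_in(1)[OF g]]] .
  have "finprod (gr_part n)
      (\<lambda>i. rcoset_mult A (filtration_pred A F n) (leading_class i f) (leading_class (n - i) g)) {..n} =
      finprod (gr_part n) (\<lambda>i. leading_class n (?h i)) {..n}"
  proof (rule finprod_cong')
    show "(\<lambda>i. leading_class n (?h i)) \<in> {..n} \<rightarrow> carrier (gr_part n)"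
      using h unfolding carrier_graded_part by blast
    show "rcoset_mult A (filtration_pred A F n) (leading_class i f) (leading_class (n - i) g) =
        leading_class n (?h i)" if "i \<in> {..n}" for i
      using rcoset_mult_leading_class[OF f g, of i "n - i"] that by simp
  qed simp
  also have "\<dots> = leading_class n (\<Sum>i\<le>n. ?h i)"
    using finprod_graded_part[of "{..n}" ?h n] h by blast
  also have "\<dots> = leading_class n (bilinear_mult \<mu>' f g)"
  proof (subst leading_class_eq_iff)
    show "(\<Sum>i\<le>n. ?h i) \<in> carrier A" using finprod_graded_part[of "{..n}" ?h n] h by blast
    show "\<forall>z. w z = n \<longrightarrow> coeff (\<Sum>i\<le>n. ?h i) z = coeff (bilinear_mult \<mu>' f g) z"
    proof (intro allI impI)
      fix z assume z: "w z = n"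
      let ?X = "Poly_Mapping.keys f" and ?Y = "Poly_Mapping.keys g"
      let ?c = "\<lambda>x y. coeff f x * coeff g y * coeff (\<mu> x y) z"
      have sub: "Poly_Mapping.keys (part i f) \<subseteq> ?X" "Poly_Mapping.keys (part i g) \<subseteq> ?Y" for i
        by (auto simp: in_keys_iff split: if_splits)
      have "coeff (\<Sum>i\<le>n. ?h i) z = (\<Sum>i\<le>n. \<Sum>x\<in>?X. \<Sum>y\<in>?Y. if w x = i \<and> w y = n - i then ?c x y else 0)"
        by (auto simp: lookup_sum coeff_bilinear_mult[of ?X ?Y, OF _ _ sub] intro!: sum.cong)
      also have "\<dots> = (\<Sum>x\<in>?X. \<Sum>i\<le>n. \<Sum>y\<in>?Y. if w x = i \<and> w y = n - i then ?c x y else 0)"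
        by (rule sum.swap)
      also have "\<dots> = (\<Sum>x\<in>?X. \<Sum>y\<in>?Y. \<Sum>i\<le>n. if w x = i \<and> w y = n - i then ?c x y else 0)"
        by (intro sum.cong refl sum.swap)
      also have "\<dots> = (\<Sum>x\<in>?X. \<Sum>y\<in>?Y. coeff f x * coeff g y * coeff (\<mu>' x y) z)"
      proof (intro sum.cong refl)
        fix x y assume "x \<in> ?X" "y \<in> ?Y"
        then have "\<mu>' x y = part (w x + w y) (\<mu> x y)"
          using \<mu>' f g unfolding leading_coefficients_def by auto
        then have "coeff (\<mu>' x y) z = (if w x + w y = n then coeff (\<mu> x y) z else 0)" using z by auto
        moreover have "(\<Sum>i\<le>n. if w x = i \<and> w y = n - i then ?c x y else 0) =
            (\<Sum>i\<le>n. if i = w x then (if w x + w y = n then ?c x y else 0) else 0)"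
          by (intro sum.cong) auto
        moreover have "\<dots> = (if w x + w y = n then ?c x y else 0)" by auto
        ultimately show "(\<Sum>i\<le>n. if w x = i \<and> w y = n - i then ?c x y else 0) =
            coeff f x * coeff g y * coeff (\<mu>' x y) z" by simp
      qed
      also have "\<dots> = coeff (bilinear_mult \<mu>' f g) z" by (simp add: coeff_bilinear_mult[of ?X ?Y])
      finally show "coeff (\<Sum>i\<le>n. ?h i) z = coeff (bilinear_mult \<mu>' f g) z" .
    qed
  qed
  finally show ?thesis ..
qed

text \<open>
  A family of cosets that is almost everywhere zero comes from the sum of the homogeneous
  representatives of its nonzero members.
\<close>

lemma leading_family_surj:
  assumes X: "X \<in> carrier gr"
  shows "\<exists>f \<in> carrier A. X = (\<lambda>n. leading_class n f)"
proof -
  define N where "N = {n. X n \<noteq> \<one>\<^bsub>gr_part n\<^esub>}"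
  have N: "finite N" and "\<forall>n. X n \<in> leading_class n ` carrier A"
    using X unfolding associated_graded_def N_def by (simp_all add: carrier_graded_part)
  then have "\<forall>n. \<exists>h. h \<in> carrier A \<and> X n = leading_class n h" by blast
  then obtain h where h: "\<And>n. h n \<in> carrier A" "\<And>n. X n = leading_class n (h n)" by metis
  define f where "f = (\<Sum>n\<in>N. part n (h n))"
  have coeff_f: "coeff f z = (if w z \<in> N then coeff (h (w z)) z else 0)" for z
    using N by (simp add: f_def lookup_sum)
  have f: "f \<in> carrier A"
    using h(1) by (auto simp: keys_subset_iff coeff_f split: if_splits)
  have "X n = leading_class n f" for n
  proof (cases "n \<in> N")
    case True
    then show ?thesis using h leading_class_eq_iff[OF h(1), of n n f] by (auto simp: coeff_f)
  next
    case False
    then have "X n = leading_class n 0" by (simp add: N_def one_graded_part)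
    then show ?thesis using False leading_class_eq_iff[of 0 n f] by (auto simp: coeff_f)
  qed
  then show ?thesis using f by blast
qed

text \<open>
  A finitely supported function is determined by its homogeneous parts, and the degree \<open>n\<close>
  part of the associated graded algebra consists of the possible parts of weight \<open>n\<close>. So the
  associated graded algebra has the same basis, and only the products change: they lose their terms
  of lower weight.
\<close>

theorem associated_graded_iso:
  assumes \<mu>': "leading_coefficients \<mu>'"
  shows "(\<lambda>f n. leading_class n f) \<in> algebra_iso rat_ring (basis_algebra I u \<mu>') gr"
proof -
  let ?B = "basis_algebra I u \<mu>'" and ?\<phi> = "\<lambda>f n. leading_class n f"
  have cB: "carrier ?B = carrier A" by simp
  have car: "?\<phi> f \<in> carrier gr" if f: "f \<in> carrier A" for f
  proof -
    have "leading_class n f = leading_class n 0" if "n \<notin> w ` Poly_Mapping.keys f" for n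
      using leading_class_eq_iff[OF f, of n 0] that by (auto simp: in_keys_iff)
    then have "{n. leading_class n f \<noteq> \<one>\<^bsub>gr_part n\<^esub>} \<subseteq> w ` Poly_Mapping.keys f"
      unfolding one_graded_part by blast
    then have "finite {n. leading_class n f \<noteq> \<one>\<^bsub>gr_part n\<^esub>}" by (rule finite_subset) simp
    moreover have "leading_class n f \<in> carrier (gr_part n)" for n
      using f unfolding carrier_graded_part by (rule imageI)
    ultimately show ?thesis unfolding associated_graded_def by simp
  qed
  have hom: "?\<phi> \<in> ring_hom ?B gr"
  proof (rule ring_hom_memI)
    fix f assume f: "f \<in> carrier ?B"
    then show "?\<phi> f \<in> carrier gr" using car cB by simp
    fix g assume g: "g \<in> carrier ?B"
    show "?\<phi> (f \<otimes>\<^bsub>?B\<^esub> g) = ?\<phi> f \<otimes>\<^bsub>gr\<^esub> ?\<phi> g"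
      using graded_mult[OF \<mu>', of f g] f g by (simp add: associated_graded_def)
    show "?\<phi> (f \<oplus>\<^bsub>?B\<^esub> g) = ?\<phi> f \<oplus>\<^bsub>gr\<^esub> ?\<phi> g"
      using mult_graded_part[of f g] f g by (simp add: associated_graded_def)
  next
    have "filtration_pred A F 0 +>\<^bsub>A\<^esub> \<one>\<^bsub>A\<^esub> = leading_class 0 (Poly_Mapping.single u 1)"
      using coset_eq[of "Poly_Mapping.single u 1" 0] unit by (simp add: F_def)
    moreover have "leading_class n (Poly_Mapping.single u 1) = leading_class n 0" if "n \<noteq> 0" for n
      using leading_class_eq_iff[of "Poly_Mapping.single u 1" n 0] that unit
      by (auto simp: lookup_single when_def)
    ultimately show "?\<phi> \<one>\<^bsub>?B\<^esub> = \<one>\<^bsub>gr\<^esub>"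
      by (auto simp: associated_graded_def one_graded_part fun_eq_iff)
  qed
  have inj: "inj_on ?\<phi> (carrier ?B)"
  proof (rule inj_onI)
    fix f g assume f: "f \<in> carrier ?B" and g: "g \<in> carrier ?B" and eq: "?\<phi> f = ?\<phi> g"
    show "f = g"
    proof (rule poly_mapping_eqI)
      fix z
      have "leading_class (w z) f = leading_class (w z) g" using fun_cong[OF eq] .
      then show "coeff f z = coeff g z" using leading_class_eq_iff[of f "w z" g] f by simp
    qed
  qed
  have surj: "?\<phi> ` carrier ?B = carrier gr"
    using car leading_family_surj unfolding cB by blast
  have smult: "?\<phi> (c \<odot>\<^bsub>?B\<^esub> f) = c \<odot>\<^bsub>gr\<^esub> ?\<phi> f" if f: "f \<in> carrier ?B" for c f
  proof
    fix n
    have "filtration_pred A F n +>\<^bsub>A\<^esub> (c \<odot>\<^bsub>A\<^esub> a) = leading_class n (scale c f)"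
      if a: "a \<in> leading_class n f" for a
    proof -
      have "scale c a \<in> F n" using a by (simp add: leading_class_def F_iff)
      then have "filtration_pred A F n +>\<^bsub>A\<^esub> (c \<odot>\<^bsub>A\<^esub> a) = leading_class n (scale c a)"
        using coset_eq by simp
      also have "\<dots> = leading_class n (scale c f)"
        using a by (simp add: leading_class_def)
      finally show ?thesis .
    qed
    then have "(\<Union>a \<in> leading_class n f. filtration_pred A F n +>\<^bsub>A\<^esub> (c \<odot>\<^bsub>A\<^esub> a)) = leading_class n (scale c f)"
      using part_in(2)[of f n] f by auto
    then show "?\<phi> (c \<odot>\<^bsub>?B\<^esub> f) n = (c \<odot>\<^bsub>gr\<^esub> ?\<phi> f) n" by (simp add: associated_graded_def)
  qed
  show ?thesis
    unfolding algebra_iso_def ring_iso_def bij_betw_def using hom inj surj smult by blast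
qed

lemma leading_class_single:
  assumes "x \<in> I"
  shows "(\<lambda>n. leading_class n (Poly_Mapping.single x 1)) = graded_class A F (w x) (Poly_Mapping.single x 1)"
proof
  fix n
  let ?x = "Poly_Mapping.single x (1 :: rat)"
  show "leading_class n ?x = graded_class A F (w x) ?x n"
  proof (cases "n = w x")
    case True
    then show ?thesis using coset_eq[of ?x n] assms by (simp add: graded_class_def F_def)
  next
    case False
    then have "leading_class n ?x = leading_class n 0"
      using leading_class_eq_iff[of ?x n 0] assms by (auto simp: lookup_single when_def)
    then show ?thesis using False by (simp add: graded_class_def one_graded_part)
  qed
qed

end


section \<open>Split conflations\<close>

lemma (in linear_category) cokernel_of_ident:
  assumes "X \<in> Ob C" "Z \<in> Ob C" "is_cokernel C X (Ident C X) X p Z"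
  shows "p = \<zero>\<^bsub>Hom C X Z\<^esub>" "zero_object C Z"
proof -
  have p: "p \<in> mor C X Z" "p \<bullet> Ident C X = \<zero>\<^bsub>Hom C X Z\<^esub>"
    and u: "\<And>f. \<lbrakk>f \<in> mor C X Z; f \<bullet> Ident C X = \<zero>\<^bsub>Hom C X Z\<^esub>\<rbrakk> \<Longrightarrow>
      \<exists>!g. g \<in> mor C Z Z \<and> g \<bullet> p = f"
    using assms unfolding is_cokernel_def by blast+
  show p0: "p = \<zero>\<^bsub>Hom C X Z\<^esub>" using p assms by (simp add: comp_ident)
  have "Ident C Z \<in> mor C Z Z \<and> Ident C Z \<bullet> p = p" "\<zero>\<^bsub>Hom C Z Z\<^esub> \<in> mor C Z Z \<and> \<zero>\<^bsub>Hom C Z Z\<^esub> \<bullet> p = p"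
    using assms p p0 by (simp_all add: ident_closed ident_comp zero_mor comp_zero_left[of X Z Z])
  then have "Ident C Z = \<zero>\<^bsub>Hom C Z Z\<^esub>" using u[OF p] by blast
  then show "zero_object C Z" using assms zero_object_iff_ident by simp
qed

locale exact_category = additive_category K C + exact_structure C E for K and C (structure) and E
begin

text \<open>
  Every exact structure contains the split conflations. The cokernel of the identity of \<open>X\<close>
  is a zero object, so \<open>X \<longrightarrow> 0\<close> is a deflation. Its pullback along
  \<open>Z \<longrightarrow> 0\<close> is the projection of the product of \<open>X\<close> and \<open>Z\<close> onto
  \<open>Z\<close>, which is therefore a deflation; its kernel is unique up to isomorphism and thus given
  by the inclusion of \<open>X\<close>.
\<close>

lemma split_structure_subset:
  assumes "split_structure C X i Y p Z"
  shows "E X i Y p Z"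
proof -
  obtain s r where b: "biproduct C X Z Y i s r p" using assms unfolding split_structure_def by blast
  note b' = b[unfolded biproduct_def]
  have ob: "X \<in> Ob C" "Y \<in> Ob C" "Z \<in> Ob C"
    and m: "i \<in> mor C X Y" "p \<in> mor C Y Z" "r \<in> mor C Y X"
    using b' by auto
  have P: "is_product C X Z Y r p" using biproduct_imp_product[OF b] .
  obtain q O' where q: "E X (Ident C X) X q O'" using inflation_ident[OF ob(1)] unfolding inflation_def by blast
  have q': "O' \<in> Ob C" "q \<in> mor C X O'" "is_cokernel C X (Ident C X) X q O'"
    using conflation_pair[OF q] unfolding kernel_cokernel_pair_def by auto
  have O': "q = \<zero>\<^bsub>Hom C X O'\<^esub>" "zero_object C O'" using cokernel_of_ident[OF ob(1) q'(1,3)] .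
  let ?z = "\<zero>\<^bsub>Hom C Z O'\<^esub>"
  have "deflation E X q O'" using q unfolding deflation_def by blast
  then obtain f' p' Y' where pb: "is_pullback C X q O' ?z Z f' p' Y'" and "deflation E Y' p' Z"
    using deflation_pullback[of X q O' Z ?z] ob q' zero_mor by blast
  then obtain W i' where W: "E W i' Y' p' Z" unfolding deflation_def by blast
  have W': "W \<in> Ob C" "Y' \<in> Ob C" "i' \<in> mor C W Y'" "p' \<in> mor C Y' Z"
    using conflation_pair[OF W] unfolding kernel_cokernel_pair_def by auto
  have P': "is_product C X Z Y' f' p'"
  proof -
    have "q \<bullet> u = ?z \<bullet> v" if "T \<in> Ob C" "u \<in> mor C T X" "v \<in> mor C T Z" for T u v
      using that ob q' O' by (simp add: comp_zero_left[of T X O'] comp_zero_left[of T Z O'])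
    then show ?thesis using pb ob W' unfolding is_pullback_def is_product_def by simp
  qed
  obtain h where h: "is_iso C Y' Y h" "r \<bullet> h = Ident C X \<bullet> f'" "p \<bullet> h = Ident C Z \<bullet> p'"
    using product_iso[OF P' P is_iso_ident[OF ob(1)] is_iso_ident[OF ob(3)]] .
  have hm: "h \<in> mor C Y' Y" using h(1) unfolding is_iso_def by simp
  define j where "j = h \<bullet> i'"
  have j: "j \<in> mor C W Y" unfolding j_def using W' ob hm by (meson comp_closed)
  have Ej: "E W j Y p Z"
  proof (rule conflation_iso_closed[OF W W'(1) ob(2,3) j m(2) is_iso_ident[OF W'(1)] h(1) is_iso_ident[OF ob(3)]])
    show "h \<bullet> i' = j \<bullet> Ident C W" using j W' ob by (simp add: j_def[symmetric] comp_ident)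
    show "Ident C Z \<bullet> p' = p \<bullet> h" using h by simp
  qed
  have ker: "is_kernel C W j Y p Z" using conflation_pair[OF Ej] unfolding kernel_cokernel_pair_def by simp
  have pj: "p \<bullet> j = \<zero>\<^bsub>Hom C W Z\<^esub>"
    and ker_ex: "\<And>T f. \<lbrakk>T \<in> Ob C; f \<in> mor C T Y; p \<bullet> f = \<zero>\<^bsub>Hom C T Z\<^esub>\<rbrakk> \<Longrightarrow> \<exists>!g. g \<in> mor C T W \<and> j \<bullet> g = f"
    using ker unfolding is_kernel_def by simp_all
  obtain g where g: "g \<in> mor C X W" "j \<bullet> g = i" using ker_ex[OF ob(1) m(1)] b' by auto
  define k where "k = r \<bullet> j"
  have k: "k \<in> mor C W X" unfolding k_def using j m ob W' by (meson comp_closed)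
  have ik: "i \<bullet> k = j"
  proof (rule product_eqI[OF P W'(1) _ j])
    show "i \<bullet> k \<in> mor C W Y" using k m ob W' by (meson comp_closed)
    show "r \<bullet> (i \<bullet> k) = r \<bullet> j"
      using comp_assoc[of W X Y X k i r] k m ob W' b' by (simp add: ident_comp k_def)
    show "p \<bullet> (i \<bullet> k) = p \<bullet> j"
      using comp_assoc[of W X Y Z k i p] k m ob W' b' pj by (simp add: comp_zero_left[of W X Z])
  qed
  have kg: "k \<bullet> g = Ident C X"
    using comp_assoc[of X W Y X g j r] g m ob W' b' j by (simp add: k_def)
  have gk: "g \<bullet> k \<in> mor C W W" using g k ob W' by (meson comp_closed)
  \<comment> \<open>Morphisms into a kernel are determined by their composition with \<open>j\<close>.\<close>
  have "j \<bullet> (g \<bullet> k) = j" using comp_assoc[of W X W Y k g j] g k j ik ob W' by simp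
  moreover have "j \<bullet> Ident C W = j" using j W' ob by (simp add: comp_ident)
  ultimately have "g \<bullet> k = Ident C W"
    using ker_ex[OF W'(1) j pj] gk ident_closed[OF W'(1)] by blast
  then have "is_iso C W X k" unfolding is_iso_def using k g kg by blast
  then show ?thesis
  proof (rule conflation_iso_closed[OF Ej ob m(1,2) _ is_iso_ident[OF ob(2)] is_iso_ident[OF ob(3)]])
    show "Ident C Y \<bullet> j = i \<bullet> k" using ik j W' ob by (simp add: ident_comp)
    show "Ident C Z \<bullet> p = p \<bullet> Ident C Y" using m ob by (simp add: ident_comp comp_ident)
  qed
qed

end

section \<open>Leading terms in the Hall algebra\<close>

text \<open>
  Both the given exact structure and the split structure are instances, so that the leading terms of
  their Hall products are computed at once.
\<close>

locale conflation_class = krull_schmidt_category K C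
  for K and C :: "('o, 'm, 'k) lincat" (structure) +
  fixes E :: "('o, 'm) pair_class"
  assumes conflation_objects: "E X i Y p Z \<Longrightarrow> X \<in> Ob C \<and> Y \<in> Ob C \<and> Z \<in> Ob C"
    and conflation_morphisms: "E X i Y p Z \<Longrightarrow> i \<in> mor C X Y \<and> p \<in> mor C Y Z"
    and split_conflation: "split_structure C X i Y p Z \<Longrightarrow> E X i Y p Z"
begin

lemma equiv_extensions: "equiv (extensions E A B) (ext_equiv C E A B)"
proof (rule equivI)
  show "refl_on (extensions E A B) (ext_equiv C E A B)"
  proof (rule refl_onI)
    fix t assume "t \<in> extensions E A B"
    then obtain i Y p where t: "t = (i, Y, p)" "E B i Y p A" by (auto simp: extensions_def)
    have "is_iso C Y Y (Ident C Y)" "Ident C Y \<bullet> i = i" "p \<bullet> Ident C Y = p"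
      using conflation_objects[OF t(2)] conflation_morphisms[OF t(2)]
      by (simp_all add: is_iso_ident ident_comp[of B Y] comp_ident[of Y A])
    then show "(t, t) \<in> ext_equiv C E A B" using t unfolding ext_equiv_def extensions_def by blast
  qed
  show "sym (ext_equiv C E A B)"
  proof (rule symI)
    fix s t assume "(s, t) \<in> ext_equiv C E A B"
    then obtain i Y p i' Y' p' h where st: "s = (i, Y, p)" "t = (i', Y', p')"
        and E: "E B i Y p A" "E B i' Y' p' A" and h: "is_iso C Y Y' h" "h \<bullet> i = i'" "p' \<bullet> h = p"
      unfolding ext_equiv_def extensions_def by blast
    note m = conflation_objects[OF E(1)] conflation_objects[OF E(2)]
      conflation_morphisms[OF E(1)] conflation_morphisms[OF E(2)]
    obtain g where g: "h \<in> mor C Y Y'" "g \<in> mor C Y' Y" "g \<bullet> h = Ident C Y" "h \<bullet> g = Ident C Y'"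
      using h(1) by (rule is_isoE)
    have "g \<bullet> i' = i" using h(2) comp_assoc[of B Y Y' Y i h g] m g by (simp add: ident_comp[of B Y])
    moreover have "p \<bullet> g = p'" using h(3) comp_assoc[of Y' Y Y' A g h p'] m g by (simp add: comp_ident[of Y' A])
    moreover have "is_iso C Y' Y g" unfolding is_iso_def using g by blast
    ultimately show "(t, s) \<in> ext_equiv C E A B" using st E unfolding ext_equiv_def extensions_def by blast
  qed
  show "trans (ext_equiv C E A B)"
  proof (rule transI)
    fix s t v assume "(s, t) \<in> ext_equiv C E A B" "(t, v) \<in> ext_equiv C E A B"
    then obtain i Y p i' Y' p' h i2 Y2 p2 h' where st: "s = (i, Y, p)" "v = (i2, Y2, p2)"
        and E: "E B i Y p A" "E B i' Y' p' A" "E B i2 Y2 p2 A"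
        and h: "is_iso C Y Y' h" "h \<bullet> i = i'" "p' \<bullet> h = p"
        and h': "is_iso C Y' Y2 h'" "h' \<bullet> i' = i2" "p2 \<bullet> h' = p'"
      unfolding ext_equiv_def extensions_def by blast
    note m = conflation_objects[OF E(1)] conflation_objects[OF E(2)] conflation_objects[OF E(3)]
      conflation_morphisms[OF E(1)] conflation_morphisms[OF E(2)] conflation_morphisms[OF E(3)]
    have hm: "h \<in> mor C Y Y'" "h' \<in> mor C Y' Y2" using h h' unfolding is_iso_def by auto
    have "is_iso C Y Y2 (h' \<bullet> h)" using is_iso_comp[OF _ _ _ h(1) h'(1)] m by simp
    moreover have "(h' \<bullet> h) \<bullet> i = i2" using comp_assoc[of B Y Y' Y2 i h h'] m hm h h' by simp
    moreover have "p2 \<bullet> (h' \<bullet> h) = p" using comp_assoc[of Y Y' Y2 A h h' p2] m hm h h' by simp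
    ultimately show "(s, v) \<in> ext_equiv C E A B" using st E unfolding ext_equiv_def extensions_def by blast
  qed
qed (auto simp: ext_equiv_def)

text \<open>
  All split extensions are equivalent: the isomorphism of products that is the identity on
  both factors is compatible with the inclusions and the projections.
\<close>

lemma split_extensions_equiv:
  assumes s: "split_structure C B i Y p A" "split_structure C B i' Y' p' A"
  shows "((i, Y, p), (i', Y', p')) \<in> ext_equiv C E A B"
proof -
  obtain t r where b: "biproduct C B A Y i t r p" using s(1) unfolding split_structure_def by blast
  obtain t' r' where b': "biproduct C B A Y' i' t' r' p'" using s(2) unfolding split_structure_def by blast
  note d = b[unfolded biproduct_def] and d' = b'[unfolded biproduct_def]
  have ob: "A \<in> Ob C" "B \<in> Ob C" "Y \<in> Ob C" "Y' \<in> Ob C" using d d' by auto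
  obtain h where h: "is_iso C Y Y' h" "r' \<bullet> h = Ident C B \<bullet> r" "p' \<bullet> h = Ident C A \<bullet> p"
    using product_iso[OF biproduct_imp_product[OF b] biproduct_imp_product[OF b'] is_iso_ident[OF ob(2)]
      is_iso_ident[OF ob(1)]] .
  have m: "h \<in> mor C Y Y'" "i \<in> mor C B Y" "i' \<in> mor C B Y'" "r \<in> mor C Y B" "p \<in> mor C Y A"
      "r' \<in> mor C Y' B" "p' \<in> mor C Y' A"
    using d d' h(1) unfolding is_iso_def by auto
  have eq: "r' \<bullet> h = r" "p' \<bullet> h = p" using h m ob by (simp_all add: ident_comp)
  have "h \<bullet> i = i'"
  proof (rule product_eqI[OF biproduct_imp_product[OF b'] ob(2) _ m(3)])
    show "h \<bullet> i \<in> mor C B Y'" using m ob by (meson comp_closed)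
    show "r' \<bullet> (h \<bullet> i) = r' \<bullet> i'" using comp_assoc[of B Y Y' B i h r'] m ob eq d d' by simp
    show "p' \<bullet> (h \<bullet> i) = p' \<bullet> i'" using comp_assoc[of B Y Y' A i h p'] m ob eq d d' by simp
  qed
  then show ?thesis
    using h(1) eq s split_conflation unfolding ext_equiv_def extensions_def by blast
qed

lemma split_middle:
  assumes "split_structure C B i Y p A"
  shows "is_direct_sum C A B Y"
  using assms direct_sum_commute unfolding split_structure_def is_direct_sum_def by blast

lemma Ext1_member:
  assumes "\<xi> \<in> Ext1 C E A B"
  obtains i Y p where "(i, Y, p) \<in> \<xi>" "E B i Y p A" "\<xi> = ext_equiv C E A B `` {(i, Y, p)}"
proof -
  obtain t where t: "t \<in> extensions E A B" "\<xi> = ext_equiv C E A B `` {t}"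
    using assms unfolding Ext1_def by (rule quotientE)
  then have "t \<in> \<xi>" using equiv_class_self[OF equiv_extensions] by blast
  then show ?thesis using that t by (auto simp: extensions_def)
qed

end

locale characteristic_weight = conflation_class +
  fixes w :: "'b set \<Rightarrow> nat"
  assumes Ext1_finite: "Ext1_finite C E"
    and characteristic: "split_characteristic C E w"
begin

lemma weight_direct_sum:
  assumes "is_direct_sum C A B S"
  shows "w (iso_class C S) = w (iso_class C A) + w (iso_class C B)"
  using characteristic iso_sum_class[OF assms] direct_sum_objects[OF assms] iso_class_in_Iso
  unfolding split_characteristic_def by metis

text \<open>
  The weight of the middle term detects whether a conflation splits.
\<close>

lemma weight_conflation:
  assumes "E B i Y p A"
  shows "w (iso_class C Y) \<le> w (iso_class C A) + w (iso_class C B)"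
    and "w (iso_class C Y) = w (iso_class C A) + w (iso_class C B) \<Longrightarrow> split_structure C B i Y p A"
proof -
  have "w (iso_class C Y) < w (iso_class C A) + w (iso_class C B)" if "\<not> split_structure C B i Y p A"
    using characteristic assms that unfolding split_characteristic_def by blast
  moreover have "w (iso_class C Y) = w (iso_class C A) + w (iso_class C B)" if "split_structure C B i Y p A"
    using weight_direct_sum[OF split_middle[OF that]] .
  ultimately show "w (iso_class C Y) \<le> w (iso_class C A) + w (iso_class C B)"
    "w (iso_class C Y) = w (iso_class C A) + w (iso_class C B) \<Longrightarrow> split_structure C B i Y p A"
    by (metis less_imp_le order_refl, metis less_irrefl)
qed

text \<open>
  An extension whose middle term is isomorphic to the direct sum of its ends has the maximal weight,
  so it splits; hence it represents the trivial class.
\<close>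

lemma Ext1_with_middle_split:
  assumes "is_direct_sum C A B S"
  shows "card (Ext1_with_middle C E A B (iso_class C S)) = 1"
proof -
  have ob: "A \<in> Ob C" "B \<in> Ob C" "S \<in> Ob C" using direct_sum_objects[OF assms] by auto
  obtain i p where s: "split_structure C B i S p A"
    using direct_sum_commute[OF assms] unfolding is_direct_sum_def split_structure_def by blast
  let ?\<xi> = "ext_equiv C E A B `` {(i, S, p)}"
  have mem: "(i, S, p) \<in> extensions E A B" using split_conflation[OF s] by (simp add: extensions_def)
  have "?\<xi> \<in> Ext1 C E A B" unfolding Ext1_def using mem by (rule quotientI)
  moreover have "Y' \<in> iso_class C S" if "(i', Y', p') \<in> ?\<xi>" for i' Y' p'
  proof -
    have "E B i' Y' p' A" "\<exists>h. is_iso C S Y' h" using that unfolding ext_equiv_def extensions_def by auto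
    then show ?thesis using ob conflation_objects unfolding iso_class_def isomorphic_def by blast
  qed
  ultimately have "?\<xi> \<in> Ext1_with_middle C E A B (iso_class C S)" unfolding Ext1_with_middle_def by auto
  moreover have "\<xi> = ?\<xi>" if "\<xi> \<in> Ext1_with_middle C E A B (iso_class C S)" for \<xi>
  proof -
    have \<xi>: "\<xi> \<in> Ext1 C E A B" "\<forall>(i, Y, p) \<in> \<xi>. Y \<in> iso_class C S"
      using that unfolding Ext1_with_middle_def by auto
    obtain i' Y' p' where c: "(i', Y', p') \<in> \<xi>" "E B i' Y' p' A" "\<xi> = ext_equiv C E A B `` {(i', Y', p')}"
      using Ext1_member[OF \<xi>(1)] .
    have "isomorphic C S Y'" using \<xi>(2) c(1) unfolding iso_class_def by auto
    then have "is_direct_sum C A B Y'" using direct_sum_iso[OF assms] by simp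
    then have "split_structure C B i' Y' p' A"
      using weight_conflation(2)[OF c(2)] weight_direct_sum by simp
    then have "((i', Y', p'), (i, S, p)) \<in> ext_equiv C E A B" using split_extensions_equiv s by simp
    then show ?thesis using c(3) equiv_class_eq[OF equiv_extensions] by simp
  qed
  ultimately have "Ext1_with_middle C E A B (iso_class C S) = {?\<xi>}" by blast
  then show ?thesis by simp
qed

lemma Ext1_with_middle_nonempty:
  assumes "M \<in> Iso C" "Ext1_with_middle C E A B M \<noteq> {}"
  obtains i Y p where "E B i Y p A" "M = iso_class C Y"
proof -
  obtain \<xi> where \<xi>: "\<xi> \<in> Ext1 C E A B" "\<forall>(i, Y, p) \<in> \<xi>. Y \<in> M"
    using assms(2) unfolding Ext1_with_middle_def by blast
  obtain i Y p where c: "(i, Y, p) \<in> \<xi>" "E B i Y p A" using Ext1_member[OF \<xi>(1)] by metis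
  then have "Y \<in> M" using \<xi>(2) by auto
  then show ?thesis using that[OF c(2)] Iso_member(2)[OF assms(1)] by simp
qed

lemma finite_middle_terms:
  assumes "A \<in> Ob C" "B \<in> Ob C"
  shows "finite {M \<in> Iso C. Ext1_with_middle C E A B M \<noteq> {}}"
proof (rule finite_subset)
  \<comment> \<open>The class of the middle term of a chosen representative.\<close>
  let ?f = "\<lambda>\<xi>. iso_class C (fst (snd (SOME t. t \<in> \<xi>)))"
  show "finite (?f ` Ext1 C E A B)" using Ext1_finite assms unfolding Ext1_finite_def by blast
  show "{M \<in> Iso C. Ext1_with_middle C E A B M \<noteq> {}} \<subseteq> ?f ` Ext1 C E A B"
  proof
    fix M assume "M \<in> {M \<in> Iso C. Ext1_with_middle C E A B M \<noteq> {}}"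
    then obtain \<xi> where M: "M \<in> Iso C" and \<xi>: "\<xi> \<in> Ext1 C E A B" "\<forall>(i, Y, p) \<in> \<xi>. Y \<in> M"
      unfolding Ext1_with_middle_def by blast
    obtain t where "t \<in> \<xi>" using Ext1_member[OF \<xi>(1)] by metis
    then have "(SOME t. t \<in> \<xi>) \<in> \<xi>" by (rule someI)
    then have "fst (snd (SOME t. t \<in> \<xi>)) \<in> M" using \<xi>(2) by (auto simp: split_beta)
    then have "?f \<xi> = M" using Iso_member(2)[OF M] by simp
    then show "M \<in> ?f ` Ext1 C E A B" using \<xi>(1) by blast
  qed
qed

lemma coeff_hall_product:
  assumes "A \<in> Ob C" "B \<in> Ob C"
  shows "coeff (hall_product C E A B) M =
    (if M \<in> Iso C then of_nat (card (Ext1_with_middle C E A B M)) / of_nat (card (mor C A B)) else 0)"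
  using finite_middle_terms[OF assms]
  by (auto simp: hall_product_def lookup_sum lookup_single when_def)

lemma hall_product_keys:
  assumes "A \<in> Ob C" "B \<in> Ob C" "M \<in> Poly_Mapping.keys (hall_product C E A B)"
  obtains i Y p where "E B i Y p A" "M = iso_class C Y"
proof -
  have "coeff (hall_product C E A B) M \<noteq> 0" using assms(3) by (simp add: in_keys_iff)
  then have "M \<in> Iso C" "Ext1_with_middle C E A B M \<noteq> {}"
    by (auto simp: coeff_hall_product[OF assms(1,2)] split: if_splits)
  then show ?thesis using Ext1_with_middle_nonempty that by metis
qed

lemma hall_product_weight:
  assumes "X \<in> Iso C" "Y \<in> Iso C"
  shows "Poly_Mapping.keys (hall_product C E (rep X) (rep Y)) \<subseteq> {M \<in> Iso C. w M \<le> w X + w Y}"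
proof
  fix M assume M: "M \<in> Poly_Mapping.keys (hall_product C E (rep X) (rep Y))"
  obtain i S p where S: "E (rep Y) i S p (rep X)" "M = iso_class C S"
    using hall_product_keys[OF rep_Ob[OF assms(1)] rep_Ob[OF assms(2)] M] .
  then show "M \<in> {M \<in> Iso C. w M \<le> w X + w Y}"
    using weight_conflation(1)[OF S(1)] conflation_objects[OF S(1)] assms
    by (simp add: iso_class_rep iso_class_in_Iso)
qed

text \<open>
  The leading term of a Hall product comes from the class of split extensions alone, whose coefficient is
  \<open>1 / |Hom|\<close>.
\<close>

lemma coeff_hall_product_leading:
  assumes XY: "X \<in> Iso C" "Y \<in> Iso C" and M: "w M = w X + w Y"
  shows "coeff (hall_product C E (rep X) (rep Y)) M = coeff (Poly_Mapping.single (iso_sum C X Y) (hom_form C X Y)) M"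
proof -
  have ob: "rep X \<in> Ob C" "rep Y \<in> Ob C" using XY rep_Ob by auto
  obtain S where S: "is_direct_sum C (rep X) (rep Y) S" "iso_sum C X Y = iso_class C S"
    using iso_sum_reps[OF XY] .
  show ?thesis
  proof (cases "M = iso_class C S")
    case True
    then show ?thesis
      using Ext1_with_middle_split[OF S(1)] direct_sum_objects[OF S(1)] S(2)
      by (simp add: coeff_hall_product[OF ob] iso_class_in_Iso hom_form_def)
  next
    case False
    have "M \<notin> Poly_Mapping.keys (hall_product C E (rep X) (rep Y))"
    proof
      assume key: "M \<in> Poly_Mapping.keys (hall_product C E (rep X) (rep Y))"
      obtain i T p where T: "E (rep Y) i T p (rep X)" "M = iso_class C T"
        using hall_product_keys[OF ob key] .
      then have "split_structure C (rep Y) i T p (rep X)"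
        using weight_conflation(2)[OF T(1)] M XY by (simp add: iso_class_rep)
      then have "is_direct_sum C (rep X) (rep Y) T" by (rule split_middle)
      then have "M = iso_class C S"
        using T(2) S iso_sum_class[of "rep X" "rep Y" T] XY by (simp add: iso_class_rep)
      then show False using False by simp
    qed
    then show ?thesis using False S(2) by (simp add: in_keys_iff lookup_single when_def)
  qed
qed

end

section \<open>The Hall algebra of the split structure\<close>

context krull_schmidt_category
begin

lemma split_conflation_class: "conflation_class K C (split_structure C)"
proof unfold_locales
  show "X \<in> Ob C \<and> Y \<in> Ob C \<and> Z \<in> Ob C" "i \<in> mor C X Y \<and> p \<in> mor C Y Z"
    if "split_structure C X i Y p Z" for X i Y p Z
    using that unfolding split_structure_def biproduct_def by blast+
qed

lemma split_Ext1_finite: "Ext1_finite C (split_structure C)"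
  unfolding Ext1_finite_def
proof (intro ballI)
  interpret S: conflation_class K C "split_structure C" by (rule split_conflation_class)
  fix A B
  have eq: "\<xi> = \<eta>" if \<xi>: "\<xi> \<in> Ext1 C (split_structure C) A B" and \<eta>: "\<eta> \<in> Ext1 C (split_structure C) A B" for \<xi> \<eta>
  proof -
    obtain i Y p where 1: "split_structure C B i Y p A"
        "\<xi> = ext_equiv C (split_structure C) A B `` {(i, Y, p)}" using S.Ext1_member[OF \<xi>] .
    obtain i' Y' p' where 2: "split_structure C B i' Y' p' A"
        "\<eta> = ext_equiv C (split_structure C) A B `` {(i', Y', p')}" using S.Ext1_member[OF \<eta>] .
    show ?thesis
      using equiv_class_eq[OF S.equiv_extensions S.split_extensions_equiv[OF 1(1) 2(1)]] 1(2) 2(2) by simp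
  qed
  show "finite (Ext1 C (split_structure C) A B)"
  proof (cases "Ext1 C (split_structure C) A B = {}")
    case False
    then obtain \<xi> where "\<xi> \<in> Ext1 C (split_structure C) A B" by blast
    then have "Ext1 C (split_structure C) A B = {\<xi>}" using eq by blast
    then show ?thesis by simp
  qed simp
qed

lemma split_characteristic_weight:
  assumes "split_characteristic C E w"
  shows "characteristic_weight K C (split_structure C) w"
proof (intro characteristic_weight.intro characteristic_weight_axioms.intro split_conflation_class split_Ext1_finite)
  show "split_characteristic C (split_structure C) w"
    using assms unfolding split_characteristic_def by blast
qed

text \<open>
  The weight \<open>w\<close> is characteristic also for the split structure, which has no
  non-split conflations. So the product is its own leading term.
\<close>

lemma hall_product_split:
  assumes w: "split_characteristic C E w" and XY: "X \<in> Iso C" "Y \<in> Iso C"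
  shows "hall_product C (split_structure C) (rep X) (rep Y) = Poly_Mapping.single (iso_sum C X Y) (hom_form C X Y)"
proof (rule poly_mapping_eqI)
  interpret S: characteristic_weight K C "split_structure C" w using split_characteristic_weight[OF w] .
  fix M
  have wXY: "w (iso_sum C X Y) = w X + w Y" using w XY unfolding split_characteristic_def by blast
  show "coeff (hall_product C (split_structure C) (rep X) (rep Y)) M =
      coeff (Poly_Mapping.single (iso_sum C X Y) (hom_form C X Y)) M"
  proof (cases "w M = w X + w Y")
    case True
    then show ?thesis by (rule S.coeff_hall_product_leading[OF XY])
  next
    case False
    have "M \<notin> Poly_Mapping.keys (hall_product C (split_structure C) (rep X) (rep Y))"
    proof
      assume key: "M \<in> Poly_Mapping.keys (hall_product C (split_structure C) (rep X) (rep Y))"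
      obtain i T p where T: "split_structure C (rep Y) i T p (rep X)" "M = iso_class C T"
        using S.hall_product_keys[OF rep_Ob[OF XY(1)] rep_Ob[OF XY(2)] key] .
      then have "M = iso_sum C X Y"
        using iso_sum_class[OF S.split_middle[OF T(1)]] XY by (simp add: iso_class_rep)
      then show False using False wXY by simp
    qed
    then show ?thesis using False wXY by (auto simp: in_keys_iff lookup_single when_def)
  qed
qed

end

section \<open>The associated graded Hall algebra\<close>

theorem corollary4p3:
  fixes K :: "'k ring"
    and C :: "('o, 'm, 'k) lincat"
    and E :: "('o, 'm) pair_class"
    and w :: "'o set \<Rightarrow> nat"
  assumes "field K" and "finite (carrier K)"
    and "additive_category K C" and "Hom_finite C" and "idempotent_complete C"
    and "exact_structure C E" and "Ext1_finite C E"
    and "split_characteristic C E w"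
  shows "algebra_filtration rat_ring (hall_algebra C E) (weight_filtration C w) \<and>
    (\<exists>\<phi> \<in> algebra_iso rat_ring (hall_algebra C (split_structure C))
             (associated_graded (hall_algebra C E) (weight_filtration C w)).
       \<forall>M \<in> Iso C. \<phi> (Poly_Mapping.single M 1) =
         graded_class (hall_algebra C E) (weight_filtration C w) (w M) (Poly_Mapping.single M 1)) \<and>
    skew_polynomial_algebra (Iso_monoid C) (iso_class C ` {X. indecomposable C X}) (hom_form C)
      (hall_algebra C (split_structure C)) \<and>
    (\<forall>A \<in> Ob C. \<forall>B \<in> Ob C.
       Poly_Mapping.single (iso_class C A) 1
           \<otimes>\<^bsub>hall_algebra C (split_structure C)\<^esub> Poly_Mapping.single (iso_class C B) 1 =
         Poly_Mapping.single (iso_sum C (iso_class C A) (iso_class C B))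
           (1 / of_nat (card (mor C A B))))"
proof -
  interpret krull_schmidt_category K C
    using assms by (intro krull_schmidt_category.intro krull_schmidt_category_axioms.intro)
  interpret X: exact_category K C E using assms by (intro exact_category.intro)
  interpret H: characteristic_weight K C E w
  proof
    show "X \<in> Ob C \<and> Y \<in> Ob C \<and> Z \<in> Ob C" "i \<in> mor C X Y \<and> p \<in> mor C Y Z" if "E X i Y p Z" for X i Y p Z
      using X.conflation_pair[OF that] unfolding kernel_cokernel_pair_def by simp_all
  qed (use X.split_structure_subset assms in auto)
  interpret M: comm_monoid "Iso_monoid C" by (rule Iso_comm_monoid)
  let ?\<mu> = "\<lambda>X Y. hall_product C E (rep X) (rep Y)"
  let ?\<nu> = "\<lambda>X Y. hall_product C (split_structure C) (rep X) (rep Y)"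
  have split: "?\<nu> X Y = Poly_Mapping.single (iso_sum C X Y) (hom_form C X Y)" if "X \<in> Iso C" "Y \<in> Iso C" for X Y
    using hall_product_split[OF assms(8) that] .
  interpret W: weighted_basis "Iso C" "{Z. zero_object C Z}" ?\<mu> w
  proof
    show "{Z. zero_object C Z} \<in> Iso C" by (rule zero_class_Iso)
    have "iso_sum C {Z. zero_object C Z} {Z. zero_object C Z} = {Z. zero_object C Z}"
      using M.l_one[OF M.one_closed] by simp
    then show "w {Z. zero_object C Z} = 0"
      using assms(8) zero_class_Iso unfolding split_characteristic_def by (metis add_cancel_right_right)
    show "Poly_Mapping.keys (?\<mu> X Y) \<subseteq> {Z \<in> Iso C. w Z \<le> w X + w Y}" if "X \<in> Iso C" "Y \<in> Iso C" for X Y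
      using H.hall_product_weight[OF that] .
  qed
  have F: "weight_filtration C w = W.F" by (rule ext) (simp add: weight_filtration_def W.F_def)
  have lead: "W.leading_coefficients ?\<nu>"
    unfolding W.leading_coefficients_def
  proof (intro ballI poly_mapping_eqI)
    fix X Y M assume XY: "X \<in> Iso C" "Y \<in> Iso C"
    have "w (iso_sum C X Y) = w X + w Y" using assms(8) XY unfolding split_characteristic_def by blast
    then show "coeff (?\<nu> X Y) M = coeff (W.part (w X + w Y) (?\<mu> X Y)) M"
      using H.coeff_hall_product_leading[OF XY, of M] by (auto simp: split[OF XY] lookup_single when_def)
  qed
  have 1: "algebra_filtration rat_ring (hall_algebra C E) (weight_filtration C w)"
    unfolding hall_algebra_def F by (rule W.weight_algebra_filtration)
  have 2: "\<exists>\<phi> \<in> algebra_iso rat_ring (hall_algebra C (split_structure C))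
      (associated_graded (hall_algebra C E) (weight_filtration C w)).
      \<forall>M \<in> Iso C. \<phi> (Poly_Mapping.single M 1) =
        graded_class (hall_algebra C E) (weight_filtration C w) (w M) (Poly_Mapping.single M 1)"
    unfolding hall_algebra_def F
    by (intro bexI[OF _ W.associated_graded_iso[OF lead]] ballI) (rule W.leading_class_single)
  have "unital_algebra rat_ring (hall_algebra C (split_structure C))"
    using twisted_monoid_algebra_unital[OF Iso_comm_monoid hom_form_bicharacter, of ?\<nu>] split
    by (simp add: hall_algebra_def)
  moreover have "(\<lambda>f. f) \<in> algebra_iso rat_ring (twisted_monoid_algebra (Iso_monoid C) (hom_form C))
      (hall_algebra C (split_structure C))"
    unfolding hall_algebra_def twisted_monoid_algebra_def Iso_monoid_simps
    by (rule basis_algebra_iso_cong) (simp add: split)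
  ultimately have 3: "skew_polynomial_algebra (Iso_monoid C) (iso_class C ` {X. indecomposable C X}) (hom_form C)
      (hall_algebra C (split_structure C))"
    unfolding skew_polynomial_algebra_def using Iso_free_comm_monoid hom_form_bicharacter by simp
  have 4: "Poly_Mapping.single (iso_class C A) 1
      \<otimes>\<^bsub>hall_algebra C (split_structure C)\<^esub> Poly_Mapping.single (iso_class C B) 1 =
      Poly_Mapping.single (iso_sum C (iso_class C A) (iso_class C B)) (1 / of_nat (card (mor C A B)))"
    if "A \<in> Ob C" "B \<in> Ob C" for A B
    using split[of "iso_class C A" "iso_class C B"] that
    by (simp add: hall_algebra_def bilinear_mult_single iso_class_in_Iso hom_form_iso_class)
  show ?thesis using 1 2 3 4 by blast
qed

end
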